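(* Suppose that there is a Ramsey cardinal, or more generally that there is a generic elementary embedding with critical point $\omega_1$ that is well-founded out to the image of $\beth_2(\omega_1)^+ = (2^{2^{\aleph_1}})^+$. Then for any uncountable set of reals $X\subseteq\mathbb{R}$, any $l<\omega$ and any coloring $c:[X]^2\rightarrow l$ of the unordered pairs of $X$, there is a set $Y\subseteq X$ homeomorphic to $\mathbb{Q}$ (with the subspace topology from $\mathbb{R}$) such that the range of $c\restriction [Y]^2$ contains at most two colors.
   Context: "There is a generic elementary embedding with critical point $\omega_1$ well-founded out to the image of $\kappa$" means: there is a pair $t=(\mathbb{P},\dot D)$ that is nice to $\kappa$, in the following sense. $\mathbb{P}$ is a notion of forcing with a strongest condition $1_{\mathbb{P}}$ and $\dot D$ is a $\mathbb{P}$-name for an ultrafilter on the Boolean algebra $\mathcal{P}(\omega_1)^V=\{A\subseteq\omega_1^V: A\in V\}$. For $p\in\mathbb{P}$ let $J^t_p=\{A\subseteq\omega_1: p\Vdash \check A\notin\dot D\}$. The pair is pre-nice if every $J^t_p$ is a normal ideal on $\omega_1$. For ground-model functions $f,g:\omega_1\to\mathrm{Ord}$, write $f\le_{\dot D} g$ iff $\{\alpha<\omega_1: f(\alpha)\le g(\alpha)\}\in\dot D$. The pair is nice to $\kappa$ if it is pre-nice and $1_{\mathbb{P}}$ forces that the set $({}^{\omega_1}\kappa)^V$ of ground-model functions from $\omega_1$ to $\kappa$ is pre-wellordered by $\le_{\dot D}$. *)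

theory Defs
  imports "HOL-Analysis.Analysis" "HOL-Library.FuncSet" "HOL-Library.Ramsey"
begin

unbundle cardinal_syntax

section \<open>Cardinals\<close>

text \<open>
  As in the cardinal library, a cardinal is a reflexive well-order of minimal order type; its
  ordinals are the elements of its field.
\<close>

definition omega1 :: "nat set rel"
  where "omega1 = cardSuc natLeq"

text \<open>\<open>(2 ^ (2 ^ \<aleph>\<^sub>1))\<^sup>+\<close>, that is, the successor of \<open>\<beth>\<^sub>2(\<omega>\<^sub>1)\<close>.\<close>

definition beth2_omega1_plus :: "((nat set \<Rightarrow> bool) \<Rightarrow> bool) set rel"
  where "beth2_omega1_plus = cardSuc (ctwo ^c (ctwo ^c omega1))"

text \<open>
  An uncountable cardinal \<open>\<kappa>\<close> such that every 2-colouring of its finite subsets has a homogeneous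
  set of size \<open>\<kappa>\<close>; the colour may depend on the size \<open>n\<close> of the subsets.
\<close>

definition Ramsey_cardinal :: "'a rel \<Rightarrow> bool"
  where "Ramsey_cardinal \<kappa> \<longleftrightarrow>
    Card_order \<kappa> \<and> natLeq <o \<kappa> \<and>
    (\<forall>c :: 'a set \<Rightarrow> bool. \<exists>H \<subseteq> Field \<kappa>. |H| =o \<kappa> \<and>
      (\<forall>n. \<forall>a \<in> [H]\<^bsup>n\<^esup>. \<forall>b \<in> [H]\<^bsup>n\<^esup>. c a = c b))"


section \<open>Normal ideals\<close>

text \<open>
  Ideals are proper and contain the bounded sets. The second requirement is what makes the
  critical point of the induced embedding \<open>\<omega>\<^sub>1\<close>; without it the dual of a principal ultrafilter
  would count as normal.
\<close>

definition normal_ideal :: "'w rel \<Rightarrow> 'w set set \<Rightarrow> bool"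
  where "normal_ideal r J \<longleftrightarrow>
    J \<subseteq> Pow (Field r) \<and> {} \<in> J \<and> Field r \<notin> J \<and>
    (\<forall>A \<in> J. \<forall>B. B \<subseteq> A \<longrightarrow> B \<in> J) \<and>
    (\<forall>A \<in> J. \<forall>B \<in> J. A \<union> B \<in> J) \<and>
    (\<forall>\<alpha> \<in> Field r. underS r \<alpha> \<in> J) \<and>
    (\<forall>A. (\<forall>\<alpha> \<in> Field r. A \<alpha> \<in> J) \<longrightarrow>
      {\<beta> \<in> Field r. \<exists>\<alpha> \<in> underS r \<beta>. \<beta> \<in> A \<alpha>} \<in> J)"


section \<open>Forcing\<close>

text \<open>
  \<open>(p, q) \<in> P\<close> means that the condition \<open>p\<close> extends \<open>q\<close>; the conditions are the elements of
  \<open>Field P\<close>. The distinguished condition \<open>\<one>\<close> is the one extended by every condition.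
\<close>

definition notion_of_forcing :: "'p rel \<Rightarrow> 'p \<Rightarrow> bool"
  where "notion_of_forcing P one \<longleftrightarrow>
    Preorder P \<and> one \<in> Field P \<and> (\<forall>p \<in> Field P. (p, one) \<in> P)"

text \<open>
  The ground model \<open>V\<close> is the HOL universe. Only subsets, in the extension, of sets \<open>S \<in> V\<close> have
  to be named. A pair \<open>(x, u)\<close> in a name stands for the canonical name of \<open>x\<close> paired with \<open>u\<close>;
  up to forced equality, every name for a subset of \<open>S\<close> has this form.
\<close>

type_synonym ('x, 'p) pname = "('x \<times> 'p) set"

definition subset_names :: "'p rel \<Rightarrow> 'x set \<Rightarrow> ('x, 'p) pname set"
  where "subset_names P S = Pow (S \<times> Field P)"

text \<open>
  A sentence of the forcing language is identified with the predicate of being forced: \<open>\<phi> p\<close>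
  reads \<open>p \<tturnstile> \<phi>\<close>. The clauses for the connectives are the usual recursive ones, with
  membership, negation, conjunction and the universal quantifier as primitives.
  \<open>forced_all S \<phi>\<close> quantifies over \<open>x \<in> S\<close> if \<open>S\<close> is a set of ground-model objects, and
  over the subsets of \<open>S'\<close> in the extension if \<open>S = subset_names P S'\<close>.
\<close>

type_synonym 'p sentence = "'p \<Rightarrow> bool"

definition forced_mem :: "'p rel \<Rightarrow> 'x \<Rightarrow> ('x, 'p) pname \<Rightarrow> 'p sentence"
  where "forced_mem P x N p \<longleftrightarrow>
    (\<forall>q. (q, p) \<in> P \<longrightarrow> (\<exists>s. (s, q) \<in> P \<and> (\<exists>u. (x, u) \<in> N \<and> (s, u) \<in> P)))"

definition forced_not :: "'p rel \<Rightarrow> 'p sentence \<Rightarrow> 'p sentence"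
  where "forced_not P \<phi> p \<longleftrightarrow> (\<forall>q. (q, p) \<in> P \<longrightarrow> \<not> \<phi> q)"

definition forced_and :: "'p sentence \<Rightarrow> 'p sentence \<Rightarrow> 'p sentence"  (infixr \<open>\<^bold>\<and>\<close> 35)
  where "(\<phi> \<^bold>\<and> \<psi>) p \<longleftrightarrow> \<phi> p \<and> \<psi> p"

definition forced_all :: "'x set \<Rightarrow> ('x \<Rightarrow> 'p sentence) \<Rightarrow> 'p sentence"
  where "forced_all S \<phi> p \<longleftrightarrow> (\<forall>x \<in> S. \<phi> x p)"

definition forced_or :: "'p rel \<Rightarrow> 'p sentence \<Rightarrow> 'p sentence \<Rightarrow> 'p sentence"
  where "forced_or P \<phi> \<psi> = forced_not P (forced_not P \<phi> \<^bold>\<and> forced_not P \<psi>)"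

definition forced_imp :: "'p rel \<Rightarrow> 'p sentence \<Rightarrow> 'p sentence \<Rightarrow> 'p sentence"
  where "forced_imp P \<phi> \<psi> = forced_not P (\<phi> \<^bold>\<and> forced_not P \<psi>)"

definition forced_ex :: "'p rel \<Rightarrow> 'x set \<Rightarrow> ('x \<Rightarrow> 'p sentence) \<Rightarrow> 'p sentence"
  where "forced_ex P S \<phi> = forced_not P (forced_all S (\<lambda>x. forced_not P (\<phi> x)))"


section \<open>Nice pairs\<close>

text \<open>``\<open>D\<close> is an ultrafilter on the Boolean algebra \<open>\<P>(W)\<^sup>V\<close>''.\<close>

definition ultrafilter_sentence :: "'p rel \<Rightarrow> 'w set \<Rightarrow> ('w set, 'p) pname \<Rightarrow> 'p sentence"
  where "ultrafilter_sentence P W D =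
    (forced_mem P W D
     \<^bold>\<and> forced_not P (forced_mem P {} D)
     \<^bold>\<and> forced_all (Pow W) (\<lambda>A. forced_all (Pow W) (\<lambda>B.
         forced_imp P (forced_mem P A D \<^bold>\<and> forced_mem P B D) (forced_mem P (A \<inter> B) D)))
     \<^bold>\<and> forced_all (Pow W) (\<lambda>B. forced_all (Pow B) (\<lambda>A.
         forced_imp P (forced_mem P A D) (forced_mem P B D)))
     \<^bold>\<and> forced_all (Pow W) (\<lambda>A.
         forced_or P (forced_mem P A D) (forced_mem P (W - A) D)))"

definition ultrafilter_name :: "'p rel \<Rightarrow> 'p \<Rightarrow> 'w set \<Rightarrow> ('w set, 'p) pname \<Rightarrow> bool"
  where "ultrafilter_name P one W D \<longleftrightarrow>
    D \<in> subset_names P (Pow W) \<and> ultrafilter_sentence P W D one"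

definition J_ideal :: "'p rel \<Rightarrow> 'w set \<Rightarrow> ('w set, 'p) pname \<Rightarrow> 'p \<Rightarrow> 'w set set"
  where "J_ideal P W D p = {A. A \<subseteq> W \<and> forced_not P (forced_mem P A D) p}"

definition pre_nice :: "'p rel \<Rightarrow> 'p \<Rightarrow> (nat set set, 'p) pname \<Rightarrow> bool"
  where "pre_nice P one D \<longleftrightarrow>
    notion_of_forcing P one \<and> ultrafilter_name P one (Field omega1) D \<and>
    (\<forall>p \<in> Field P. normal_ideal omega1 (J_ideal P (Field omega1) D p))"

text \<open>``\<open>f \<le>\<^sub>D g\<close>'', for \<open>f, g : W \<rightarrow> \<kappa>\<close> in the ground model.\<close>

definition le_sentence ::
    "'p rel \<Rightarrow> 'w set \<Rightarrow> 'k rel \<Rightarrow> ('w set, 'p) pname \<Rightarrow> ('w \<Rightarrow> 'k) \<Rightarrow> ('w \<Rightarrow> 'k) \<Rightarrow> 'p sentence"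
  where "le_sentence P W \<kappa> D f g = forced_mem P {\<alpha> \<in> W. (f \<alpha>, g \<alpha>) \<in> \<kappa>} D"

text \<open>
  ``\<open>F\<close> is pre-wellordered by \<open>le\<close>'': \<open>le\<close> is transitive and total (hence reflexive) on \<open>F\<close>, and
  every nonempty subset of \<open>F\<close> that belongs to the extension has a least element.
\<close>

definition prewellorder_sentence ::
    "'p rel \<Rightarrow> 'x set \<Rightarrow> ('x \<Rightarrow> 'x \<Rightarrow> 'p sentence) \<Rightarrow> 'p sentence"
  where "prewellorder_sentence P F le =
    (forced_all F (\<lambda>f. forced_all F (\<lambda>g. forced_all F (\<lambda>h.
         forced_imp P (le f g \<^bold>\<and> le g h) (le f h))))
     \<^bold>\<and> forced_all F (\<lambda>f. forced_all F (\<lambda>g. forced_or P (le f g) (le g f)))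
     \<^bold>\<and> forced_all (subset_names P F) (\<lambda>E.
         forced_imp P (forced_ex P F (\<lambda>f. forced_mem P f E))
           (forced_ex P F (\<lambda>f. forced_mem P f E
             \<^bold>\<and> forced_all F (\<lambda>g. forced_imp P (forced_mem P g E) (le f g))))))"

definition nice_to :: "'p rel \<Rightarrow> 'p \<Rightarrow> (nat set set, 'p) pname \<Rightarrow> 'k rel \<Rightarrow> bool"
  where "nice_to P one D \<kappa> \<longleftrightarrow>
    pre_nice P one D \<and>
    prewellorder_sentence P (Field omega1 \<rightarrow>\<^sub>E Field \<kappa>) (le_sentence P (Field omega1) \<kappa> D) one"

end

theory Submission
  imports Defs "HOL-Library.Countable_Set_Type"
begin

text \<open>
  Both hypotheses yield a preordered set \<open>P\<close> of conditions, each with a \<open>\<sigma>\<close>-ideal \<open>J p\<close> on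
  \<open>\<omega>\<^sub>1\<close> which grows as \<open>p\<close> is extended, such that every set positive for \<open>p\<close> is measure one for an
  extension, and such that no family of functions from \<open>\<omega>\<^sub>1\<close> into \<open>\<kappa> = \<beth>\<^sub>2(\<omega>\<^sub>1)\<^sup>+\<close> descends forever
  along the extensions. For a nice pair these are its own conditions; for a Ramsey cardinal \<open>\<mu>\<close> they
  are the stationary families of sets \<open>x \<subseteq> \<mu>\<close> of size \<open>\<mu>\<close> which omit an ordinal \<open>\<pi> x < \<omega>\<^sub>1\<close>, and
  functions \<open>f\<close> do not descend because the \<open>f (\<pi> x)\<close>-th element of \<open>x\<close> is a regressive function
  of \<open>x\<close>.

  Identify \<open>\<omega>\<^sub>1\<close> with a subset of \<open>X\<close>. A pigeonhole argument gives colours \<open>i\<close>, \<open>j\<close> and a condition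
  below which every condition splits into two, one to the left of the other, such that, hereditarily,
  almost every point for the one has positively many points for the other in colour \<open>i\<close>, and
  conversely in colour \<open>j\<close>. Splitting again and again, and always leaving one of the two halves
  behind as a reservoir, one finds a point which lies in all the sets chosen on the way; otherwise the
  ranks of the trees of attempts would descend. The reservoirs converge to that point from both
  sides. Repeating this within the reservoirs, which are shrunk each time to the points having a
  colour \<open>i\<close> or \<open>j\<close> with the new one, produces a countable set, all of whose pairs have one of these
  colours, and each of whose points is a limit of others from both sides. Such a set is
  order isomorphic, hence homeomorphic, to \<open>\<rat>\<close>.
\<close>


section \<open>Countable sets approached from both sides\<close>

definition order_iso_on :: "('a::linorder \<times> 'b::linorder) set \<Rightarrow> bool"
  where "order_iso_on R \<longleftrightarrow> (\<forall>(a, b) \<in> R. \<forall>(a', b') \<in> R. a < a' \<longleftrightarrow> b < b')"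

definition dense_unbounded :: "'a::linorder set \<Rightarrow> bool"
  where "dense_unbounded B \<longleftrightarrow> B \<noteq> {} \<and>
    (\<forall>x \<in> B. \<exists>y \<in> B. y < x) \<and> (\<forall>x \<in> B. \<exists>y \<in> B. x < y) \<and>
    (\<forall>x \<in> B. \<forall>y \<in> B. x < y \<longrightarrow> (\<exists>z \<in> B. x < z \<and> z < y))"

text \<open>Finitely many constraints reduce to the maximum of \<open>L\<close> and the minimum of
  \<open>U\<close>; the cases are which of the two exist.\<close>

lemma dense_unbounded_between:
  assumes B: "dense_unbounded B" and fin: "finite L" "finite U" and sub: "L \<subseteq> B" "U \<subseteq> B"
    and LU: "\<And>x y. x \<in> L \<Longrightarrow> y \<in> U \<Longrightarrow> x < y"
  shows "\<exists>b \<in> B. (\<forall>x \<in> L. x < b) \<and> (\<forall>y \<in> U. b < y)"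
proof -
  consider "L = {}" "U = {}" | "L = {}" "U \<noteq> {}" | "L \<noteq> {}" "U = {}" | "L \<noteq> {}" "U \<noteq> {}" by blast
  then show ?thesis
  proof cases
    case 1
    obtain b where "b \<in> B" using B unfolding dense_unbounded_def by blast
    with 1 show ?thesis by blast
  next
    case 2
    have "Min U \<in> B" using 2 fin sub Min_in by blast
    then obtain b where b: "b \<in> B" "b < Min U" using B unfolding dense_unbounded_def by meson
    have "\<forall>y \<in> U. b < y" using Min_gr_iff[OF fin(2) 2(2)] b(2) by blast
    then show ?thesis using 2(1) b(1) by blast
  next
    case 3
    have "Max L \<in> B" using 3 fin sub Max_in by blast
    then obtain b where b: "b \<in> B" "Max L < b" using B unfolding dense_unbounded_def by meson
    have "\<forall>x \<in> L. x < b" using Max_less_iff[OF fin(1) 3(1)] b(2) by blast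
    then show ?thesis using 3(2) b(1) by blast
  next
    case 4
    have m: "Min U \<in> B" "Max L \<in> B" using 4 fin sub Min_in Max_in by blast+
    have "Max L < Min U" using LU[OF Max_in[OF fin(1) 4(1)] Min_in[OF fin(2) 4(2)]] .
    then obtain b where b: "b \<in> B" "Max L < b" "b < Min U"
      using B m unfolding dense_unbounded_def by meson
    have "\<forall>y \<in> U. b < y" using Min_gr_iff[OF fin(2) 4(2)] b(3) by blast
    moreover have "\<forall>x \<in> L. x < b" using Max_less_iff[OF fin(1) 4(1)] b(2) by blast
    ultimately show ?thesis using b(1) by blast
  qed
qed

text \<open>The forth step: the image of a new \<open>a\<close> has to exceed the images of the
  smaller points and stay below those of the larger ones.\<close>

lemma order_iso_on_extend:
  assumes B: "dense_unbounded B" and R: "finite R" "order_iso_on R" "R \<subseteq> A \<times> B"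
  shows "\<exists>b \<in> B. order_iso_on (insert (a, b) R)"
proof (cases "\<exists>b. (a, b) \<in> R")
  case True
  then obtain b where "(a, b) \<in> R" by blast
  then show ?thesis using R by (intro bexI[of _ b]) (auto simp: insert_absorb)
next
  case False
  let ?L = "snd ` {r \<in> R. fst r < a}" and ?U = "snd ` {r \<in> R. a < fst r}"
  have "\<exists>b \<in> B. (\<forall>x \<in> ?L. x < b) \<and> (\<forall>y \<in> ?U. b < y)"
  proof (rule dense_unbounded_between[OF B])
    show "?L \<subseteq> B" "?U \<subseteq> B" using R(3) by auto
    show "x < y" if "x \<in> ?L" "y \<in> ?U" for x y
      using that R(2) unfolding order_iso_on_def by fastforce
  qed (use R(1) in auto)
  then obtain b where b: "b \<in> B" "\<And>a' b'. (a', b') \<in> R \<Longrightarrow> a' < a \<Longrightarrow> b' < b"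
      "\<And>a' b'. (a', b') \<in> R \<Longrightarrow> a < a' \<Longrightarrow> b < b'"
    by force
  have "a < a' \<longleftrightarrow> b < b'" "a' < a \<longleftrightarrow> b' < b" if "(a', b') \<in> R" for a' b'
    using b(2,3)[OF that] that False by (metis linorder_neqE not_less_iff_gr_or_eq)+
  then have "order_iso_on (insert (a, b) R)"
    using R(2) unfolding order_iso_on_def by auto
  then show ?thesis using b(1) by blast
qed

text \<open>Partial isomorphisms are relations, not functions, so that the back step is the forth
  step for the converse. Linearity makes such a relation single-valued and injective.\<close>

lemma order_iso_on_converse: "order_iso_on (R\<inverse>) \<longleftrightarrow> order_iso_on R"
  unfolding order_iso_on_def by fast

text \<open>Stage \<open>n\<close> puts the \<open>n\<close>-th element of \<open>A\<close> into the
  domain and that of \<open>B\<close> into the range of a finite partial isomorphism; the union of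
  the stages is the graph of \<open>h\<close>.\<close>

theorem dense_unbounded_isomorphic:
  assumes A: "dense_unbounded A" "countable A" and B: "dense_unbounded B" "countable B"
  shows "\<exists>h. bij_betw h A B \<and> (\<forall>x \<in> A. \<forall>y \<in> A. x < y \<longleftrightarrow> h x < h y)"
proof -
  have ne: "A \<noteq> {}" "B \<noteq> {}" using A(1) B(1) unfolding dense_unbounded_def by simp_all
  let ?ok = "\<lambda>R. finite R \<and> order_iso_on R \<and> R \<subseteq> A \<times> B"
  have "\<exists>f. \<forall>n. ?ok (f n) \<and> (f n \<subseteq> f (Suc n) \<and> from_nat_into A n \<in> fst ` f (Suc n)
      \<and> from_nat_into B n \<in> snd ` f (Suc n))"
  proof (rule dependent_nat_choice)
    show "\<exists>R. ?ok R" by (rule exI[of _ "{}"]) (auto simp: order_iso_on_def)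
  next
    fix R n assume R: "?ok R"
    let ?a = "from_nat_into A n" and ?b = "from_nat_into B n"
    have ab: "?a \<in> A" "?b \<in> B" using ne by (auto intro: from_nat_into)
    obtain b where b: "b \<in> B" "order_iso_on (insert (?a, b) R)"
      using order_iso_on_extend[OF B(1)] R by blast
    let ?R = "insert (?a, b) R"
    have R': "?ok ?R" using R b ab by auto
    have "\<exists>a \<in> A. order_iso_on (insert (?b, a) (?R\<inverse>))"
      by (rule order_iso_on_extend[OF A(1), where A = B]) (use R' in \<open>auto simp: order_iso_on_converse\<close>)
    then obtain a where a: "a \<in> A" "order_iso_on (insert (?b, a) (?R\<inverse>))" by blast
    have "insert (?b, a) (?R\<inverse>) = (insert (a, ?b) ?R)\<inverse>" by auto
    with a have "order_iso_on (insert (a, ?b) ?R)" by (simp add: order_iso_on_converse)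
    then show "\<exists>R'. ?ok R' \<and> (R \<subseteq> R' \<and> ?a \<in> fst ` R' \<and> ?b \<in> snd ` R')"
      using R' a ab by (intro exI[of _ "insert (a, ?b) ?R"]) auto
  qed
  then obtain f where f: "\<And>n. ?ok (f n)" and mono: "\<And>n. f n \<subseteq> f (Suc n)"
    and cov: "\<And>n. from_nat_into A n \<in> fst ` f (Suc n)" "\<And>n. from_nat_into B n \<in> snd ` f (Suc n)"
    by blast
  have mono: "f m \<subseteq> f n" if "m \<le> n" for m n using lift_Suc_mono_le[of f, OF mono that] .
  define F where "F = (\<Union>n. f n)"
  have iso: "a < a' \<longleftrightarrow> b < b'" if ab: "(a, b) \<in> F" "(a', b') \<in> F" for a b a' b'
  proof -
    obtain m n where "(a, b) \<in> f m" "(a', b') \<in> f n" using ab by (auto simp: F_def)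
    then have "(a, b) \<in> f (max m n)" "(a', b') \<in> f (max m n)"
      using mono[of m "max m n"] mono[of n "max m n"] by auto
    then show ?thesis using f[of "max m n"] unfolding order_iso_on_def by fast
  qed
  have eq: "a = a' \<longleftrightarrow> b = b'" if "(a, b) \<in> F" "(a', b') \<in> F" for a b a' b'
    using iso[OF that] iso[OF that(2,1)] by (metis less_irrefl linorder_neqE)
  have domA: "\<exists>b. (a, b) \<in> F" if a: "a \<in> A" for a
  proof -
    obtain n where "a = from_nat_into A n"
      using from_nat_into_surj[OF A(2) a] by metis
    with cov(1)[of n] show ?thesis by (force simp: F_def)
  qed
  have ranB: "\<exists>a. (a, b) \<in> F" if b: "b \<in> B" for b
  proof -
    obtain n where "b = from_nat_into B n"
      using from_nat_into_surj[OF B(2) b] by metis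
    with cov(2)[of n] show ?thesis by (force simp: F_def)
  qed
  have sub: "F \<subseteq> A \<times> B" unfolding F_def using f by blast
  obtain h where h: "\<And>a. a \<in> A \<Longrightarrow> (a, h a) \<in> F" using domA by metis
  have "bij_betw h A B"
    unfolding bij_betw_def
  proof
    show "inj_on h A" 
    proof (rule inj_onI)
      fix x y assume "x \<in> A" "y \<in> A" "h x = h y"
      then show "x = y" using eq[OF h[of x] h[of y]] by simp
    qed
    have "b \<in> h ` A" if b: "b \<in> B" for b
    proof -
      obtain a where a: "(a, b) \<in> F" using ranB[OF b] by blast
      then have "a \<in> A" using sub by blast
      then have "h a = b" using eq[OF a h[OF \<open>a \<in> A\<close>]] by simp
      then show ?thesis using \<open>a \<in> A\<close> by blast
    qed
    moreover have "h ` A \<subseteq> B" using h sub by (metis SigmaD2 image_subsetI subsetD)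
    ultimately show "h ` A = B" by blast
  qed
  moreover have "x < y \<longleftrightarrow> h x < h y" if "x \<in> A" "y \<in> A" for x y
    using iso[OF h h] that by blast
  ultimately show ?thesis by blast
qed

section \<open>Order isomorphisms that are homeomorphisms\<close>

definition two_sided_limits :: "real set \<Rightarrow> bool"
  where "two_sided_limits Y \<longleftrightarrow> (\<forall>y \<in> Y. \<forall>e > 0. (\<exists>z \<in> Y. y - e < z \<and> z < y) \<and> (\<exists>z \<in> Y. y < z \<and> z < y + e))"

lemma two_sided_limits_dense:
  assumes Y: "two_sided_limits Y" "Y \<noteq> {}"
  shows "dense_unbounded Y"
proof -
  have "\<exists>z \<in> Y. z < y" "\<exists>z \<in> Y. y < z" if "y \<in> Y" for y
    using Y(1) that unfolding two_sided_limits_def by (meson zero_less_one)+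
  moreover have "\<exists>z \<in> Y. x < z \<and> z < y" if xy: "x \<in> Y" "y \<in> Y" "x < y" for x y
  proof -
    have "\<exists>z \<in> Y. x < z \<and> z < x + (y - x)"
      using Y(1) xy unfolding two_sided_limits_def by (metis diff_gt_0_iff_gt)
    then show ?thesis by simp
  qed
  ultimately show ?thesis using Y(2) unfolding dense_unbounded_def by blast
qed

text \<open>Two-sidedness makes the subspace topology of \<open>B\<close> the order topology: within
  distance \<open>e\<close> of \<open>h a\<close> there are points of \<open>B\<close> on either
  side, and their preimages bound a neighbourhood of \<open>a\<close>.\<close>

lemma order_iso_continuous:
  assumes h: "bij_betw h A B" and mono: "\<And>x y. x \<in> A \<Longrightarrow> y \<in> A \<Longrightarrow> x < y \<longleftrightarrow> h x < h y"
    and B: "two_sided_limits B"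
  shows "continuous_on A (h :: real \<Rightarrow> real)"
  unfolding continuous_on_iff
proof (intro ballI allI impI)
  fix a e :: real assume a: "a \<in> A" and e: "0 < e"
  have ha: "h a \<in> B" using h a by (auto simp: bij_betw_def)
  obtain b1 b2 where b: "b1 \<in> B" "h a - e < b1" "b1 < h a" "b2 \<in> B" "h a < b2" "b2 < h a + e"
    using B ha e unfolding two_sided_limits_def by meson
  obtain a1 a2 where a12: "a1 \<in> A" "b1 = h a1" "a2 \<in> A" "b2 = h a2"
    using h b unfolding bij_betw_def by blast
  have lt: "a1 < a" "a < a2" using mono a a12 b by auto
  have "dist (h x) (h a) < e" if x: "x \<in> A" "dist x a < min (a - a1) (a2 - a)" for x
  proof -
    have "a1 < x" "x < a2" using x(2) by (auto simp: dist_real_def)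
    then have "h a1 < h x" "h x < h a2" using mono x a12 by auto
    then show ?thesis using b a12 by (auto simp: dist_real_def)
  qed
  then show "\<exists>d>0. \<forall>x \<in> A. dist x a < d \<longrightarrow> dist (h x) (h a) < e"
    using lt by (intro exI[of _ "min (a - a1) (a2 - a)"]) auto
qed

lemma two_sided_limits_rat: "two_sided_limits \<rat>"
proof -
  have "\<exists>z \<in> \<rat>. x < z \<and> z < y" if "x < y" for x y :: real
    using Rats_dense_in_real[OF that] by blast
  then show ?thesis unfolding two_sided_limits_def by (simp add: less_diff_eq)
qed

theorem two_sided_limits_homeomorphic_rat:
  assumes Y: "two_sided_limits Y" "Y \<noteq> {}" "countable Y"
  shows "Y homeomorphic (\<rat> :: real set)"
proof -
  have Q: "dense_unbounded (\<rat> :: real set)" "countable (\<rat> :: real set)"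
    using two_sided_limits_dense[OF two_sided_limits_rat] Rats_0 countable_rat by auto
  obtain h where h: "bij_betw h Y (\<rat> :: real set)"
    and mono: "\<And>x y. x \<in> Y \<Longrightarrow> y \<in> Y \<Longrightarrow> x < y \<longleftrightarrow> h x < h y"
    using dense_unbounded_isomorphic[OF two_sided_limits_dense[OF Y(1,2)] Y(3) Q] by blast
  let ?g = "the_inv_into Y h"
  have g: "bij_betw ?g \<rat> Y" using bij_betw_the_inv_into[OF h] .
  have hg: "h (?g y) = y" if "y \<in> \<rat>" for y using f_the_inv_into_f_bij_betw[OF h that] .
  have gm: "x < y \<longleftrightarrow> ?g x < ?g y" if "x \<in> \<rat>" "y \<in> \<rat>" for x y
    using mono[of "?g x" "?g y"] hg that g by (auto simp: bij_betw_def)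
  \<comment> \<open>Each direction uses the two-sidedness of its target: of the rationals for
    \<open>h\<close>, of \<open>Y\<close> for the inverse.\<close>
  have "continuous_on Y h" using order_iso_continuous[OF h mono two_sided_limits_rat] .
  moreover have "continuous_on \<rat> ?g" using order_iso_continuous[OF g gm Y(1)] .
  moreover have "?g (h x) = x" if "x \<in> Y" for x
    using h that by (simp add: bij_betw_def the_inv_into_f_f)
  ultimately show ?thesis
    using h g hg unfolding homeomorphic_def homeomorphism_def bij_betw_def by metis
qed


section \<open>Systems of ideals without descending sequences\<close>

lemma regular_card_bound:
  assumes \<kappa>: "Card_order \<kappa>" "regularCard \<kappa>" "infinite (Field \<kappa>)"
    and K: "K \<subseteq> Field \<kappa>" "|K| <o \<kappa>"
  shows "\<exists>b \<in> Field \<kappa>. \<forall>k \<in> K. (k, b) \<in> \<kappa> \<and> k \<noteq> b"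
proof -
  have wo: "Well_order \<kappa>" using \<kappa>(1) card_order_on_well_order_on by blast
  then have lin: "total_on (Field \<kappa>) \<kappa>" "trans \<kappa>" "antisym \<kappa>"
    by (auto simp: order_on_defs)
  have "\<not> cofinal K \<kappa>"
    using \<kappa>(2) K not_ordLess_ordIso unfolding regularCard_def by blast
  then obtain a where a: "a \<in> Field \<kappa>" "\<And>b. b \<in> K \<Longrightarrow> a = b \<or> (a, b) \<notin> \<kappa>"
    unfolding cofinal_def by blast
  \<comment> \<open>So far \<open>a\<close> is only a weak bound, because \<open>cofinal\<close>
    asks for strictly larger elements; as an infinite cardinal has no last element, there is also a
    strict one.\<close>
  obtain b where b: "b \<in> Field \<kappa>" "a \<noteq> b" "(a, b) \<in> \<kappa>"
    using infinite_Card_order_limit[OF \<kappa>(1,3) a(1)] by blast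
  have "(k, b) \<in> \<kappa> \<and> k \<noteq> b" if k: "k \<in> K" for k
  proof -
    have "k = a \<or> (k, a) \<in> \<kappa>"
      using a(2)[OF k] a(1) K(1) k lin(1) unfolding total_on_def by blast
    then show ?thesis using b lin(2,3) by (metis antisymD transD)
  qed
  then show ?thesis using b(1) by blast
qed

text \<open>The usual rank function, with an arbitrary strict bound in place of the least one.
  Regularity keeps it inside \<kappa>, since every point has fewer than \<kappa>
  predecessors.\<close>

lemma wf_rank_into_regular_card:
  assumes \<kappa>: "Card_order \<kappa>" "regularCard \<kappa>" "infinite (Field \<kappa>)"
    and S: "|S| <o \<kappa>" and R: "wf R" "R \<subseteq> S \<times> S"
  shows "\<exists>\<rho>. range \<rho> \<subseteq> Field \<kappa> \<and> (\<forall>(s', s) \<in> R. (\<rho> s', \<rho> s) \<in> \<kappa> \<and> \<rho> s' \<noteq> \<rho> s)"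
proof -
  let ?ub = "\<lambda>K b. b \<in> Field \<kappa> \<and> (\<forall>k \<in> K. (k, b) \<in> \<kappa> \<and> k \<noteq> b)"
  define \<rho> where "\<rho> = wfrec R (\<lambda>h s. SOME b. ?ub (h ` {s'. (s', s) \<in> R}) b)"
  have \<rho>: "\<rho> s = (SOME b. ?ub (\<rho> ` {s'. (s', s) \<in> R}) b)" for s
  proof -
    have "cut \<rho> R s ` {s'. (s', s) \<in> R} = \<rho> ` {s'. (s', s) \<in> R}"
      by (rule image_cong) (auto simp: cut_apply)
    then show ?thesis
      using wfrec[OF R(1), of "\<lambda>h s. SOME b. ?ub (h ` {s'. (s', s) \<in> R}) b" s]
      unfolding \<rho>_def[symmetric] by simp
  qed
  have *: "?ub (\<rho> ` {s'. (s', s) \<in> R}) (\<rho> s)" for s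
    using R(1)
  proof (induction s rule: wf_induct_rule)
    case (less s)
    have "{s'. (s', s) \<in> R} \<subseteq> S" using R(2) by blast
    then have "|\<rho> ` {s'. (s', s) \<in> R}| <o \<kappa>"
      using S card_of_mono1 card_of_image ordLeq_ordLess_trans by metis
    then have "\<exists>b. ?ub (\<rho> ` {s'. (s', s) \<in> R}) b"
      using regular_card_bound[OF \<kappa>, of "\<rho> ` {s'. (s', s) \<in> R}"] less by blast
    then have "?ub (\<rho> ` {s'. (s', s) \<in> R}) (SOME b. ?ub (\<rho> ` {s'. (s', s) \<in> R}) b)"
      by (rule someI_ex)
    then show ?case unfolding \<rho>[of s, symmetric] .
  qed
  then show ?thesis by (intro exI[of _ \<rho>]) blast
qed

text \<open>A generic ultrapower described from the ground model. \<open>no_descent\<close> is its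
  well-foundedness: it forbids a set \<open>E\<close> such that for every \<open>(f, p)\<close> in
  \<open>E\<close> and every extension \<open>q\<close> of \<open>p\<close>, some
  \<open>(f', q')\<close> in \<open>E\<close> with \<open>q'\<close> extending \<open>q\<close> has
  \<open>f'\<close> below \<open>f\<close> almost everywhere for \<open>q'\<close>.\<close>

locale ideal_system =
  fixes P :: "'p rel" and J :: "'p \<Rightarrow> 'w set set" and W :: "'w set" and \<kappa> :: "'k rel"
  assumes preorder: "Preorder P" and P_nonempty: "Field P \<noteq> {}"
    and J_subset: "p \<in> Field P \<Longrightarrow> A \<in> J p \<Longrightarrow> A \<subseteq> W"
    and J_down: "p \<in> Field P \<Longrightarrow> A \<in> J p \<Longrightarrow> B \<subseteq> A \<Longrightarrow> B \<in> J p"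
    and J_UN: "p \<in> Field P \<Longrightarrow> (\<And>n :: nat. F n \<in> J p) \<Longrightarrow> (\<Union>n. F n) \<in> J p"
    and J_proper: "p \<in> Field P \<Longrightarrow> W \<notin> J p"
    and J_singleton: "p \<in> Field P \<Longrightarrow> \<alpha> \<in> W \<Longrightarrow> {\<alpha>} \<in> J p"
    and J_mono: "(q, p) \<in> P \<Longrightarrow> J p \<subseteq> J q"
    and J_extend: "p \<in> Field P \<Longrightarrow> A \<subseteq> W \<Longrightarrow> A \<notin> J p \<Longrightarrow> \<exists>q. (q, p) \<in> P \<and> W - A \<in> J q"
    and \<kappa>: "Card_order \<kappa>" "regularCard \<kappa>" "infinite (Field \<kappa>)" "|Pow (Pow W)| <o \<kappa>"
    and no_descent: "E \<noteq> {} \<Longrightarrow> E \<subseteq> (W \<rightarrow> Field \<kappa>) \<times> Field P \<Longrightarrow>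
      \<exists>f p q. (f, p) \<in> E \<and> (q, p) \<in> P \<and> (\<forall>f' q'. (f', q') \<in> E \<longrightarrow> (q', q) \<in> P \<longrightarrow>
        {\<alpha> \<in> W. \<not> ((f' \<alpha>, f \<alpha>) \<in> \<kappa> \<and> f' \<alpha> \<noteq> f \<alpha>)} \<notin> J q')"
begin

lemma le_Field: "(q, p) \<in> P \<Longrightarrow> q \<in> Field P" "(q, p) \<in> P \<Longrightarrow> p \<in> Field P"
  by (auto simp: Field_def)

lemma le_refl: "p \<in> Field P \<Longrightarrow> (p, p) \<in> P"
  using preorder by (auto simp: preorder_on_def refl_on_def)

lemma le_trans: "(r, q) \<in> P \<Longrightarrow> (q, p) \<in> P \<Longrightarrow> (r, p) \<in> P"
  using preorder by (auto simp: preorder_on_def trans_def)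

definition almost :: "'p \<Rightarrow> 'w set \<Rightarrow> bool"
  where "almost p A \<longleftrightarrow> W - A \<in> J p"

lemma almost_mono: "p \<in> Field P \<Longrightarrow> almost p A \<Longrightarrow> A \<inter> W \<subseteq> B \<Longrightarrow> almost p B"
  unfolding almost_def by (rule J_down) auto

lemma almost_le: "almost p A \<Longrightarrow> (q, p) \<in> P \<Longrightarrow> almost q A"
  unfolding almost_def using J_mono by blast

lemma J_empty: "p \<in> Field P \<Longrightarrow> {} \<in> J p"
proof -
  assume p: "p \<in> Field P"
  \<comment> \<open>Were \<open>W\<close> empty, \<open>{}\<close> would be positive for
    \<open>p\<close> by properness, and \<open>J_extend\<close> would make \<open>W\<close> null for
    some extension.\<close>
  have "W \<noteq> {}" 
  proof
    assume "W = {}"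
    then have "W \<notin> J q" if "(q, p) \<in> P" for q using that J_proper le_Field by blast
    then show False using J_extend[OF p, of "{}"] \<open>W = {}\<close> J_proper[OF p] by auto
  qed
  then show ?thesis using J_singleton[OF p] J_down[OF p] by (meson empty_subsetI ex_in_conv)
qed

lemma almost_UNIV: "p \<in> Field P \<Longrightarrow> W \<subseteq> A \<Longrightarrow> almost p A"
  unfolding almost_def using J_empty by (metis Diff_eq_empty_iff)

lemma almost_INT:
  assumes "p \<in> Field P" "countable I" "\<And>i. i \<in> I \<Longrightarrow> almost p (A i)"
  shows "almost p (\<Inter>i\<in>I. A i)"
proof (cases "I = {}")
  case True
  then show ?thesis using assms by (simp add: almost_UNIV)
next
  case False
  have "(\<Union>n. W - A (from_nat_into I n)) \<in> J p"
    using assms False by (intro J_UN) (auto simp: almost_def from_nat_into)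
  moreover have "W - (\<Inter>i\<in>I. A i) = (\<Union>n. W - A (from_nat_into I n))"
    using False range_from_nat_into[OF False assms(2)] by (force)
  ultimately show ?thesis by (simp add: almost_def)
qed

lemma almost_Int: "p \<in> Field P \<Longrightarrow> almost p A \<Longrightarrow> almost p B \<Longrightarrow> almost p (A \<inter> B)"
  using almost_INT[of p "{A, B}" id] by auto

lemma almost_ex: "p \<in> Field P \<Longrightarrow> almost p A \<Longrightarrow> \<exists>\<alpha> \<in> W. \<alpha> \<in> A"
  using J_proper[of p] unfolding almost_def by (metis Diff_triv disjoint_iff)

lemma almost_extend: "p \<in> Field P \<Longrightarrow> A \<subseteq> W \<Longrightarrow> A \<notin> J p \<Longrightarrow> \<exists>q. (q, p) \<in> P \<and> almost q A"
  unfolding almost_def by (rule J_extend)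

text \<open>
  This replaces the game in which one player picks ever smaller positive sets and the other one
  wants a point in their intersection. The ranks of the trees of plays which keep a given point
  alive would otherwise form a descending sequence; they are below \<open>\<kappa>\<close> only because the states
  \<open>S\<close> form a small set, whereas the conditions \<open>p\<close> can be arbitrarily many.
\<close>

lemma common_point_branch:
  fixes S :: "'s set"
  assumes S: "|S| <o \<kappa>" and start: "ok p0 s0"
    and ok: "\<And>p s. ok p s \<Longrightarrow> p \<in> Field P \<and> s \<in> S \<and> almost p (A s)"
    and step: "\<And>p s q. ok p s \<Longrightarrow> (q, p) \<in> P \<Longrightarrow> \<exists>q' s'. (q', q) \<in> P \<and> step s s' \<and> ok q' s'"
  shows "\<exists>\<alpha> \<in> W. \<exists>\<sigma> :: nat \<Rightarrow> 's. \<forall>n. \<sigma> n \<in> S \<and> \<alpha> \<in> A (\<sigma> n) \<and> step (\<sigma> n) (\<sigma> (Suc n))"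
proof (rule ccontr)
  assume none: "\<not> ?thesis"
  define R where "R \<alpha> = {(s', s). s \<in> S \<and> s' \<in> S \<and> step s s' \<and> \<alpha> \<in> A s \<and> \<alpha> \<in> A s'}" for \<alpha>
  have "wf (R \<alpha>)" if "\<alpha> \<in> W" for \<alpha>
    unfolding wf_iff_no_infinite_down_chain
  proof
    assume "\<exists>\<sigma>. \<forall>n. (\<sigma> (Suc n), \<sigma> n) \<in> R \<alpha>"
    then obtain \<sigma> where "\<And>n. (\<sigma> (Suc n), \<sigma> n) \<in> R \<alpha>" by blast
    then have "\<forall>n. \<sigma> n \<in> S \<and> \<alpha> \<in> A (\<sigma> n) \<and> step (\<sigma> n) (\<sigma> (Suc n))"
      by (simp add: R_def)
    then show False using none that by blast
  qed
  moreover have "R \<alpha> \<subseteq> S \<times> S" for \<alpha> by (auto simp: R_def)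
  ultimately have rank: "\<exists>\<rho>. range \<rho> \<subseteq> Field \<kappa> \<and>
      (\<forall>(s', s) \<in> R \<alpha>. (\<rho> s', \<rho> s) \<in> \<kappa> \<and> \<rho> s' \<noteq> \<rho> s)" if "\<alpha> \<in> W" for \<alpha>
    using wf_rank_into_regular_card[OF \<kappa>(1-3) S, of "R \<alpha>"] that by blast
  define \<rho> where "\<rho> \<alpha> = (SOME \<rho>. range \<rho> \<subseteq> Field \<kappa> \<and>
      (\<forall>(s', s) \<in> R \<alpha>. (\<rho> s', \<rho> s) \<in> \<kappa> \<and> \<rho> s' \<noteq> \<rho> s))" for \<alpha>
  have \<rho>: "range (\<rho> \<alpha>) \<subseteq> Field \<kappa>"
      "\<And>s s'. (s', s) \<in> R \<alpha> \<Longrightarrow> (\<rho> \<alpha> s', \<rho> \<alpha> s) \<in> \<kappa> \<and> \<rho> \<alpha> s' \<noteq> \<rho> \<alpha> s" if "\<alpha> \<in> W" for \<alpha>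
    using someI_ex[OF rank[OF that], folded \<rho>_def] by auto
  \<comment> \<open>A state \<open>s\<close> gives the function that sends each point \<alpha> to
    the rank of \<open>s\<close> in the tree of \<alpha>; a step lowers it at every point lying in
    both sets.\<close>
  define E where "E = {(\<lambda>\<alpha>. \<rho> \<alpha> s, p) |s p. ok p s}"
  have "E \<noteq> {}" using start by (auto simp: E_def)
  moreover have "E \<subseteq> (W \<rightarrow> Field \<kappa>) \<times> Field P" using \<rho>(1) ok by (fastforce simp: E_def)
  ultimately obtain f p q where fpq: "(f, p) \<in> E" "(q, p) \<in> P" and
    no: "\<And>f' q'. (f', q') \<in> E \<Longrightarrow> (q', q) \<in> P \<Longrightarrow>
        {\<alpha> \<in> W. \<not> ((f' \<alpha>, f \<alpha>) \<in> \<kappa> \<and> f' \<alpha> \<noteq> f \<alpha>)} \<notin> J q'"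
    using no_descent[of E] by meson
  obtain s where s: "f = (\<lambda>\<alpha>. \<rho> \<alpha> s)" "ok p s" using fpq(1) by (auto simp: E_def)
  \<comment> \<open>Steps are available below any extension, in particular below the
    \<open>q\<close> that \<open>no_descent\<close> supplies.\<close>
  obtain q' s' where q': "(q', q) \<in> P" "step s s'" "ok q' s'" using step[OF s(2) fpq(2)] by blast
  let ?f' = "\<lambda>\<alpha>. \<rho> \<alpha> s'"
  have fld: "q' \<in> Field P" using q'(3) ok by blast
  have "almost q' (A s \<inter> A s')"
    using ok[OF s(2)] ok[OF q'(3)] almost_le le_trans[OF q'(1) fpq(2)] by (intro almost_Int) auto
  then have "W - A s \<inter> A s' \<in> J q'" by (simp add: almost_def)
  moreover have "{\<alpha> \<in> W. \<not> ((?f' \<alpha>, f \<alpha>) \<in> \<kappa> \<and> ?f' \<alpha> \<noteq> f \<alpha>)} \<subseteq> W - A s \<inter> A s'"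
  proof
    fix \<alpha> assume \<alpha>: "\<alpha> \<in> {\<alpha> \<in> W. \<not> ((?f' \<alpha>, f \<alpha>) \<in> \<kappa> \<and> ?f' \<alpha> \<noteq> f \<alpha>)}"
    have "(s', s) \<notin> R \<alpha>" using \<rho>(2)[of \<alpha> s' s] \<alpha> s(1) by auto
    then show "\<alpha> \<in> W - A s \<inter> A s'"
      using \<alpha> q' ok[OF s(2)] ok[OF q'(3)] by (auto simp: R_def)
  qed
  ultimately have "{\<alpha> \<in> W. \<not> ((?f' \<alpha>, f \<alpha>) \<in> \<kappa> \<and> ?f' \<alpha> \<noteq> f \<alpha>)} \<in> J q'"
    using J_down[OF fld] by blast
  moreover have "(?f', q') \<in> E" using q'(3) by (auto simp: E_def)
  ultimately show False using no q'(1) by blast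
qed

end


section \<open>Linked conditions\<close>

locale coloured_system = ideal_system +
  fixes d :: "'b \<Rightarrow> 'b \<Rightarrow> nat" and l :: nat and \<xi> :: "'b \<Rightarrow> real"
  assumes d_less: "\<alpha> \<in> W \<Longrightarrow> \<beta> \<in> W \<Longrightarrow> \<alpha> \<noteq> \<beta> \<Longrightarrow> d \<alpha> \<beta> < l"
    and d_sym: "d \<alpha> \<beta> = d \<beta> \<alpha>"
    and \<xi>_inj: "inj_on \<xi> W"
begin

text \<open>If no real splits \<open>p\<close>, the set \<open>L\<close> is a Dedekind cut and
  countable completeness makes almost every value of \<xi> equal to its supremum. By injectivity
  that is a single point, and singletons are null.\<close>

lemma ex_left_right:
  assumes p: "p \<in> Field P"
  shows "\<exists>t q r. (q, p) \<in> P \<and> (r, p) \<in> P \<and> almost q {\<alpha>. \<xi> \<alpha> < t} \<and> almost r {\<alpha>. t < \<xi> \<alpha>}"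
proof (rule ccontr)
  assume none: "\<not> ?thesis"
  define L where "L = {t. almost p {\<alpha>. t \<le> \<xi> \<alpha>}}"
  have up: "almost p {\<alpha>. \<xi> \<alpha> \<le> t}" if "t \<notin> L" for t
  proof (rule ccontr)
    assume "\<not> almost p {\<alpha>. \<xi> \<alpha> \<le> t}"
    moreover have "W - {\<alpha>. \<xi> \<alpha> \<le> t} = W \<inter> {\<alpha>. t < \<xi> \<alpha>}" "W - {\<alpha>. t \<le> \<xi> \<alpha>} = W \<inter> {\<alpha>. \<xi> \<alpha> < t}"
      by auto
    ultimately have "W \<inter> {\<alpha>. t < \<xi> \<alpha>} \<notin> J p" "W \<inter> {\<alpha>. \<xi> \<alpha> < t} \<notin> J p"
      using that by (auto simp: L_def almost_def)
    then obtain q r where "(q, p) \<in> P" "almost q (W \<inter> {\<alpha>. \<xi> \<alpha> < t})"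
        "(r, p) \<in> P" "almost r (W \<inter> {\<alpha>. t < \<xi> \<alpha>})"
      using almost_extend[OF p, of "W \<inter> {\<alpha>. \<xi> \<alpha> < t}"] almost_extend[OF p, of "W \<inter> {\<alpha>. t < \<xi> \<alpha>}"]
      by auto
    moreover from this have "almost q {\<alpha>. \<xi> \<alpha> < t}" "almost r {\<alpha>. t < \<xi> \<alpha>}"
      using almost_mono le_Field by (meson Int_iff subsetI)+
    ultimately show False using none by blast
  qed
  have "\<exists>n :: nat. - real n \<in> L"
  proof (rule ccontr)
    assume "\<not> ?thesis"
    then have "almost p (\<Inter>n. {\<alpha>. \<xi> \<alpha> \<le> - real n})"
      using up by (intro almost_INT[OF p]) auto
    from almost_ex[OF p this] obtain \<alpha> where "\<And>n. \<xi> \<alpha> \<le> - real n" by auto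
    moreover obtain n where "- \<xi> \<alpha> < real n" using reals_Archimedean2 by blast
    ultimately show False by (metis less_minus_iff linorder_not_less minus_less_iff)
  qed
  then have ne: "L \<noteq> {}" by blast
  have "\<exists>n :: nat. \<forall>t \<in> L. t \<le> real n"
  proof (rule ccontr)
    assume "\<not> ?thesis"
    then have *: "\<exists>t \<in> L. real n < t" for n by (meson linorder_not_le)
    have "almost p {\<alpha>. real n \<le> \<xi> \<alpha>}" for n
    proof -
      obtain t where t: "t \<in> L" "real n < t" using * by blast
      then have "almost p {\<alpha>. t \<le> \<xi> \<alpha>}" by (simp add: L_def)
      then show ?thesis by (rule almost_mono[OF p]) (use t in auto)
    qed
    then have "almost p (\<Inter>n. {\<alpha>. real n \<le> \<xi> \<alpha>})"
      by (intro almost_INT[OF p]) auto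
    from almost_ex[OF p this] obtain \<alpha> where "\<And>n. real n \<le> \<xi> \<alpha>" by auto
    moreover obtain n where "\<xi> \<alpha> < real n" using reals_Archimedean2 by blast
    ultimately show False by (metis linorder_not_less)
  qed
  then have bdd: "bdd_above L" by (auto simp: bdd_above_def)
  define s where "s = Sup L"
  have "almost p {\<alpha>. s - 1 / real (Suc n) \<le> \<xi> \<alpha> \<and> \<xi> \<alpha> \<le> s + 1 / real (Suc n)}" for n
  proof -
    have "s - 1 / real (Suc n) < Sup L" by (simp add: s_def)
    then obtain t where t: "t \<in> L" "s - 1 / real (Suc n) < t"
      using less_cSup_iff[OF ne bdd] by blast
    have "s + 1 / real (Suc n) \<notin> L"
    proof
      assume "s + 1 / real (Suc n) \<in> L"
      then have "s + 1 / real (Suc n) \<le> s" unfolding s_def using cSup_upper[OF _ bdd] by blast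
      moreover have "0 < 1 / real (Suc n)" by simp
      ultimately show False by linarith
    qed
    then have "almost p ({\<alpha>. t \<le> \<xi> \<alpha>} \<inter> {\<alpha>. \<xi> \<alpha> \<le> s + 1 / real (Suc n)})"
      using t(1) up by (intro almost_Int[OF p]) (auto simp: L_def)
    then show ?thesis by (rule almost_mono[OF p]) (use t in auto)
  qed
  then have al: "almost p (\<Inter>n. {\<alpha>. s - 1 / real (Suc n) \<le> \<xi> \<alpha> \<and> \<xi> \<alpha> \<le> s + 1 / real (Suc n)})"
    by (intro almost_INT[OF p]) auto
  have "\<xi> \<alpha> = s" if \<alpha>: "\<alpha> \<in> (\<Inter>n. {\<alpha>. s - 1 / real (Suc n) \<le> \<xi> \<alpha> \<and> \<xi> \<alpha> \<le> s + 1 / real (Suc n)})" for \<alpha>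
  proof (rule ccontr)
    assume "\<xi> \<alpha> \<noteq> s"
    then obtain n where n: "1 / real (Suc n) < \<bar>\<xi> \<alpha> - s\<bar>"
      using reals_Archimedean[of "\<bar>\<xi> \<alpha> - s\<bar>"] by (auto simp: inverse_eq_divide)
    have "s - 1 / real (Suc n) \<le> \<xi> \<alpha>" "\<xi> \<alpha> \<le> s + 1 / real (Suc n)" using \<alpha> by simp_all
    then show False using n by linarith
  qed
  then have al: "almost p {\<alpha>. \<xi> \<alpha> = s}"
    by (intro almost_mono[OF p al] subsetI CollectI) simp
  from almost_ex[OF p this] obtain \<alpha> where \<alpha>: "\<alpha> \<in> W" "\<xi> \<alpha> = s" by blast
  have "almost p (- {\<alpha>})"
    using J_singleton[OF p \<alpha>(1)] \<alpha>(1) by (simp add: almost_def Diff_Compl)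
  with al have "almost p ({\<alpha>. \<xi> \<alpha> = s} \<inter> - {\<alpha>})" by (rule almost_Int[OF p])
  from almost_ex[OF p this] obtain \<beta> where "\<beta> \<in> W" "\<xi> \<beta> = s" "\<beta> \<noteq> \<alpha>" by blast
  then show False using \<alpha> inj_onD[OF \<xi>_inj, of \<beta> \<alpha>] by simp
qed

text \<open>Countably many intervals of radius \<open>e\<close>, centred at the integer multiples of
  \<open>e\<close>, cover the line, so one of them is positive.\<close>

lemma ex_near:
  assumes p: "p \<in> Field P" and e: "0 < e"
  shows "\<exists>q x. (q, p) \<in> P \<and> almost q {\<alpha>. \<bar>\<xi> \<alpha> - x\<bar> < e}"
proof (rule ccontr)
  assume none: "\<not> ?thesis"
  have "almost p {\<alpha>. e \<le> \<bar>\<xi> \<alpha> - of_int k * e\<bar>}" for k :: int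
  proof (rule ccontr)
    assume "\<not> ?thesis"
    moreover have "W - {\<alpha>. e \<le> \<bar>\<xi> \<alpha> - of_int k * e\<bar>} = W \<inter> {\<alpha>. \<bar>\<xi> \<alpha> - of_int k * e\<bar> < e}"
      by auto
    ultimately have "W \<inter> {\<alpha>. \<bar>\<xi> \<alpha> - of_int k * e\<bar> < e} \<notin> J p" by (auto simp: almost_def)
    then obtain q where "(q, p) \<in> P" "almost q (W \<inter> {\<alpha>. \<bar>\<xi> \<alpha> - of_int k * e\<bar> < e})"
      using almost_extend[OF p, of "W \<inter> {\<alpha>. \<bar>\<xi> \<alpha> - of_int k * e\<bar> < e}"] by auto
    moreover from this have "almost q {\<alpha>. \<bar>\<xi> \<alpha> - of_int k * e\<bar> < e}"
      using almost_mono[of q] le_Field by blast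
    ultimately show False using none by blast
  qed
  then have "almost p (\<Inter>k :: int. {\<alpha>. e \<le> \<bar>\<xi> \<alpha> - of_int k * e\<bar>})"
    by (intro almost_INT[OF p]) auto
  from almost_ex[OF p this] obtain \<alpha> where \<alpha>: "\<And>k :: int. e \<le> \<bar>\<xi> \<alpha> - of_int k * e\<bar>" by blast
  define k where "k = \<lfloor>\<xi> \<alpha> / e\<rfloor>"
  have "of_int k \<le> \<xi> \<alpha> / e" "\<xi> \<alpha> / e < of_int k + 1" unfolding k_def by linarith+
  then have "of_int k * e \<le> \<xi> \<alpha>" "\<xi> \<alpha> < of_int k * e + e"
    using e by (simp_all add: field_simps)
  then show False using \<alpha>[of k] by linarith
qed

definition col :: "nat \<Rightarrow> 'b \<Rightarrow> 'b set"
  where "col i \<alpha> = {\<beta> \<in> W. \<beta> \<noteq> \<alpha> \<and> d \<alpha> \<beta> = i}"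

definition unreachable :: "nat \<Rightarrow> 'a \<Rightarrow> 'b set"
  where "unreachable i q = {\<alpha> \<in> W. col i \<alpha> \<in> J q}"

text \<open>
  \<open>blocked i q \<subseteq> J p\<close> says that, however \<open>p\<close> and \<open>q\<close> are extended, almost every point for \<open>p\<close> has
  positively many points for \<open>q\<close> in colour \<open>i\<close>. It only depends on \<open>q\<close> through the set
  \<open>blocked i q\<close>, of which there are at most \<open>2 ^ 2 ^ |W|\<close>.
\<close>

definition blocked :: "nat \<Rightarrow> 'a \<Rightarrow> 'b set set"
  where "blocked i q = {unreachable i q' |q'. (q', q) \<in> P}"

lemma unreachable_mono: "(q', q) \<in> P \<Longrightarrow> unreachable i q \<subseteq> unreachable i q'"
  using J_mono by (fastforce simp: unreachable_def)

lemma blocked_mono: "(q', q) \<in> P \<Longrightarrow> blocked i q' \<subseteq> blocked i q"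
  using le_trans by (fastforce simp: blocked_def)

text \<open>For a point unreachable in every colour, \<open>W\<close> would be a finite union of
  sets null for \<open>q\<close>: its colour classes and its own singleton.\<close>

lemma ex_reachable:
  assumes p: "p \<in> Field P" and q: "q \<in> Field P"
  shows "\<not> almost p (\<Inter>i<l. unreachable i q)"
proof
  assume "almost p (\<Inter>i<l. unreachable i q)"
  from almost_ex[OF p this] obtain \<alpha> where \<alpha>: "\<alpha> \<in> W" "\<And>i. i < l \<Longrightarrow> col i \<alpha> \<in> J q"
    by (auto simp: unreachable_def)
  have "almost q (- col i \<alpha>)" if "i < l" for i
  proof -
    have "W - - col i \<alpha> = col i \<alpha>" by (auto simp: col_def)
    then show ?thesis using \<alpha>(2)[OF that] by (simp add: almost_def)
  qed
  then have "almost q (\<Inter>i<l. - col i \<alpha>)" by (intro almost_INT[OF q]) auto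
  moreover have "almost q (- {\<alpha>})"
    using J_singleton[OF q \<alpha>(1)] \<alpha>(1) by (simp add: almost_def Diff_Compl)
  ultimately have "almost q ((\<Inter>i<l. - col i \<alpha>) \<inter> - {\<alpha>})" by (rule almost_Int[OF q])
  from almost_ex[OF q this] obtain \<beta> where \<beta>: "\<beta> \<in> W" "\<beta> \<in> (\<Inter>i<l. - col i \<alpha>)" "\<beta> \<noteq> \<alpha>"
    by blast
  then show False using d_less[OF \<alpha>(1) \<beta>(1)] \<alpha>(1) by (auto simp: col_def)
qed

text \<open>Run through the colours. One that does not link allows extensions making almost every
  point unreachable in it, and this persists under further extension; by \<open>ex_reachable\<close>
  this cannot happen for all colours.\<close>

lemma ex_linked:
  assumes p: "p \<in> Field P" and q: "q \<in> Field P"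
  shows "\<exists>i p' q'. i < l \<and> (p', p) \<in> P \<and> (q', q) \<in> P \<and> blocked i q' \<subseteq> J p'"
proof (rule ccontr)
  assume none: "\<not> ?thesis"
  have "k \<le> l \<Longrightarrow> \<exists>p' q'. (p', p) \<in> P \<and> (q', q) \<in> P \<and> (\<forall>i<k. almost p' (unreachable i q'))" for k
  proof (induction k)
    case 0
    then show ?case using le_refl p q by blast
  next
    case (Suc k)
    then obtain p' q' where pq: "(p', p) \<in> P" "(q', q) \<in> P"
      and un: "\<And>i. i < k \<Longrightarrow> almost p' (unreachable i q')" by force
    have "\<not> blocked k q' \<subseteq> J p'" using none Suc pq by (metis Suc_le_eq)
    then obtain q'' where q'': "(q'', q') \<in> P" "unreachable k q'' \<notin> J p'" by (auto simp: blocked_def)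
    then obtain p'' where p'': "(p'', p') \<in> P" "almost p'' (unreachable k q'')"
      using almost_extend[OF le_Field(1)[OF pq(1)], of "unreachable k q''"] by (auto simp: unreachable_def)
    have "almost p'' (unreachable i q'')" if "i < Suc k" for i
    proof (cases "i = k")
      case False
      then have "almost p'' (unreachable i q')" using un that almost_le[OF _ p''(1)] by simp
      then show ?thesis
        using almost_mono[OF le_Field(1)[OF p''(1)]] unreachable_mono[OF q''(1)] by blast
    qed (use p'' in simp)
    then show ?case using le_trans[OF p''(1) pq(1)] le_trans[OF q''(1) pq(2)] by blast
  qed
  from this[of l] obtain p' q' where pq: "(p', p) \<in> P" "(q', q) \<in> P"
      and "\<And>i. i < l \<Longrightarrow> almost p' (unreachable i q')" by blast
  then have "almost p' (\<Inter>i<l. unreachable i q')"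
    using le_Field by (intro almost_INT) auto
  then show False using ex_reachable pq le_Field by blast
qed

text \<open>Here \<open>q\<close> is the left half and \<open>r\<close> the right one;
  \<open>i\<close> is the colour for points on the left looking right, \<open>j\<close> for points
  on the right looking left.\<close>

definition split_pair :: "nat \<Rightarrow> nat \<Rightarrow> 'a \<Rightarrow> 'a \<Rightarrow> 'a \<Rightarrow> bool"
  where "split_pair i j p q r \<longleftrightarrow> (q, p) \<in> P \<and> (r, p) \<in> P \<and>
    blocked i r \<subseteq> J q \<and> blocked j q \<subseteq> J r \<and>
    (\<exists>t. almost q {\<alpha>. \<xi> \<alpha> < t} \<and> almost r {\<alpha>. t < \<xi> \<alpha>})"

text \<open>Link the two halves in one direction, then in the other; the first link survives the
  second extension by monotonicity.\<close>

lemma ex_split_pair: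
  assumes p: "p \<in> Field P"
  shows "\<exists>i<l. \<exists>j<l. \<exists>q r. split_pair i j p q r"
proof -
  obtain t q0 r0 where 0: "(q0, p) \<in> P" "(r0, p) \<in> P" "almost q0 {\<alpha>. \<xi> \<alpha> < t}" "almost r0 {\<alpha>. t < \<xi> \<alpha>}"
    using ex_left_right[OF p] by blast
  obtain i q1 r1 where 1: "i < l" "(q1, q0) \<in> P" "(r1, r0) \<in> P" "blocked i r1 \<subseteq> J q1"
    using ex_linked[OF le_Field(1)[OF 0(1)] le_Field(1)[OF 0(2)]] by blast
  obtain j r2 q2 where 2: "j < l" "(r2, r1) \<in> P" "(q2, q1) \<in> P" "blocked j q2 \<subseteq> J r2"
    using ex_linked[OF le_Field(1)[OF 1(3)] le_Field(1)[OF 1(2)]] by blast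
  have "blocked i r2 \<subseteq> J q2" using 1(4) blocked_mono[OF 2(2)] J_mono[OF 2(3)] by blast
  moreover have "(q2, q0) \<in> P" "(r2, r0) \<in> P" using 1 2 le_trans by blast+
  ultimately have "split_pair i j p q2 r2"
    unfolding split_pair_def using 0 2 le_trans almost_le by blast
  then show ?thesis using 1(1) 2(1) by blast
qed

text \<open>If no pair of colours were dense below any condition, the finitely many pairs could be
  avoided one after another, leaving a condition that contradicts
  \<open>ex_split_pair\<close>.\<close>

lemma ex_dense_split_pair:
  "\<exists>i j p. p \<in> Field P \<and> (\<forall>p'. (p', p) \<in> P \<longrightarrow> (\<exists>q r. split_pair i j p' q r))"
proof (rule ccontr)
  assume none: "\<not> ?thesis"
  have "finite K \<Longrightarrow> \<exists>p \<in> Field P. \<forall>(i, j) \<in> K. \<forall>p'. (p', p) \<in> P \<longrightarrow> \<not> (\<exists>q r. split_pair i j p' q r)" for K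
  proof (induction K rule: finite_induct)
    case empty
    then show ?case using P_nonempty by blast
  next
    case (insert ij K)
    obtain i j where ij: "ij = (i, j)" by force
    obtain p where p: "p \<in> Field P"
        "\<And>i j p'. (i, j) \<in> K \<Longrightarrow> (p', p) \<in> P \<Longrightarrow> \<not> (\<exists>q r. split_pair i j p' q r)"
      using insert.IH by blast
    obtain p1 where p1: "(p1, p) \<in> P" "\<not> (\<exists>q r. split_pair i j p1 q r)" using none p(1) by blast
    \<comment> \<open>A splitting of an extension of \<open>p1\<close> is also a splitting of
      \<open>p1\<close>.\<close>
    have "\<not> (\<exists>q r. split_pair i j p' q r)" if "(p', p1) \<in> P" for p'
      using p1(2) that le_trans[OF _ that] unfolding split_pair_def by blast
    moreover have "\<not> (\<exists>q r. split_pair i' j' p' q r)" if "(i', j') \<in> K" "(p', p1) \<in> P" for i' j' p'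
      using p(2)[OF that(1)] le_trans[OF that(2) p1(1)] by blast
    ultimately show ?case using le_Field(1)[OF p1(1)] ij by blast
  qed
  from this[of "{..<l} \<times> {..<l}"] obtain p where "p \<in> Field P"
      "\<And>i j. i < l \<Longrightarrow> j < l \<Longrightarrow> \<not> (\<exists>q r. split_pair i j p q r)"
    using le_refl by fastforce
  then show False using ex_split_pair by blast
qed

end


section \<open>Points with reservoirs converging to them\<close>

locale dense_split_system = coloured_system +
  fixes i j :: nat and top :: 'a
  assumes top: "top \<in> Field P"
    and split: "(p, top) \<in> P \<Longrightarrow> \<exists>q r. split_pair i j p q r"
begin

text \<open>From here on it does not matter which of the two colours links, nor which half lies on
  the left.\<close>

definition reach :: "'a \<Rightarrow> 'a \<Rightarrow> bool"
  where "reach p q \<longleftrightarrow> blocked i q \<subseteq> J p \<or> blocked j q \<subseteq> J p"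

text \<open>All that the construction has to remember of a condition. There are fewer than \<kappa>
  such triples, while the number of conditions is unbounded.\<close>

definition info :: "'a \<Rightarrow> 'b set set \<times> 'b set set \<times> 'b set set"
  where "info p = (J p, blocked i p, blocked j p)"

definition info_le :: "'b set set \<times> 'b set set \<times> 'b set set \<Rightarrow> 'b set set \<times> 'b set set \<times> 'b set set \<Rightarrow> bool"
  where "info_le u v \<longleftrightarrow> fst v \<subseteq> fst u \<and> fst (snd u) \<subseteq> fst (snd v) \<and> snd (snd u) \<subseteq> snd (snd v)"

text \<open>Conditions recovered from the triples along a branch need not extend one another in
  \<open>P\<close>; this weaker order is what survives.\<close>

definition below :: "'a \<Rightarrow> 'a \<Rightarrow> bool"
  where "below q p \<longleftrightarrow> info_le (info q) (info p)"

lemma below_iff: "below q p \<longleftrightarrow> J p \<subseteq> J q \<and> blocked i q \<subseteq> blocked i p \<and> blocked j q \<subseteq> blocked j p"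
  by (simp add: below_def info_le_def info_def)

lemma below_refl: "below p p"
  by (simp add: below_iff)

lemma below_trans: "below r q \<Longrightarrow> below q p \<Longrightarrow> below r p"
  unfolding below_iff by blast

lemma le_below: "(q, p) \<in> P \<Longrightarrow> below q p"
  using J_mono blocked_mono by (simp add: below_iff)

lemma reach_below: "reach p q \<Longrightarrow> below p' p \<Longrightarrow> below q' q \<Longrightarrow> reach p' q'"
  unfolding reach_def below_iff by blast

text \<open>Alternating the side with the parity lets a single sequence of stages converge from both
  sides.\<close>

definition towards :: "nat \<Rightarrow> real \<Rightarrow> real set"
  where "towards n x = (if even n then {x<..<x + 1 / real (Suc n)} else {x - 1 / real (Suc n)<..<x})"

text \<open>\<open>A\<close> is the set of points still in play, \<open>r\<close> the reservoir left
  behind.\<close>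

definition stage :: "nat \<Rightarrow> 'b set \<Rightarrow> 'a \<Rightarrow> bool"
  where "stage n A r \<longleftrightarrow> (\<forall>\<alpha> \<in> A. almost r (\<xi> -` towards n (\<xi> \<alpha>)) \<and> (col i \<alpha> \<notin> J r \<or> col j \<alpha> \<notin> J r))"

text \<open>Shrinking first to an interval of radius \<open>e\<close> puts any two points closer
  than \<open>1 / real (Suc n)\<close>. Of the two halves of a splitting, the right one becomes the
  reservoir at even \<open>n\<close>, the left one at odd \<open>n\<close>.\<close>

lemma ex_stage:
  assumes q: "(q, top) \<in> P" and G: "almost q G"
  shows "\<exists>p r A. (p, q) \<in> P \<and> (r, q) \<in> P \<and> A \<subseteq> G \<inter> W \<and> almost p A \<and> stage n A r \<and> reach p r \<and> reach r p"
proof -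
  define e where "e = 1 / real (Suc n) / 2"
  have e: "0 < e" "e + e = 1 / real (Suc n)"
    unfolding e_def by (simp, rule field_sum_of_halves)
  obtain q1 x where q1: "(q1, q) \<in> P" "almost q1 {\<alpha>. \<bar>\<xi> \<alpha> - x\<bar> < e}"
    using ex_near[OF le_Field(1)[OF q] e(1)] by blast
  obtain q2 r2 where "split_pair i j q1 q2 r2" using split[OF le_trans[OF q1(1) q]] by blast
  then obtain t where sp: "(q2, q1) \<in> P" "(r2, q1) \<in> P" "blocked i r2 \<subseteq> J q2" "blocked j q2 \<subseteq> J r2"
      "almost q2 {\<alpha>. \<xi> \<alpha> < t}" "almost r2 {\<alpha>. t < \<xi> \<alpha>}"
    unfolding split_pair_def by blast
  have reach: "reach q2 r2" "reach r2 q2" using sp(3,4) by (auto simp: reach_def)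
  \<comment> \<open>Both orientations at once: \<open>p\<close> is the half that continues,
    \<open>r\<close> the reservoir, and \<open>a\<close> the colour in which \<open>p\<close>
    reaches \<open>r\<close>.\<close>
  have *: ?thesis if pr: "(p, q1) \<in> P" "(r, q1) \<in> P" "reach p r" "reach r p"
    and a: "blocked a r \<subseteq> J p" "a = i \<or> a = j" and UV: "almost p U" "almost r V"
    and tow: "\<And>\<alpha> \<beta>. \<alpha> \<in> U \<Longrightarrow> \<beta> \<in> V \<Longrightarrow> \<bar>\<xi> \<beta> - \<xi> \<alpha>\<bar> < e + e \<Longrightarrow> \<xi> \<beta> \<in> towards n (\<xi> \<alpha>)" for p r a U V
  proof -
    have fld: "p \<in> Field P" "r \<in> Field P" using le_Field(1) pr(1,2) by blast+
    define A where "A = (G \<inter> {\<alpha>. \<bar>\<xi> \<alpha> - x\<bar> < e}) \<inter> (U \<inter> (W - unreachable a r))"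
    have "unreachable a r \<in> J p" using a(1) le_refl[OF fld(2)] by (auto simp: blocked_def)
    moreover have "W - (W - unreachable a r) = unreachable a r" by (auto simp: unreachable_def)
    ultimately have "almost p (W - unreachable a r)" by (simp add: almost_def)
    then have A: "almost p A"
      unfolding A_def using G q1 pr(1) UV(1) almost_le le_trans by (intro almost_Int fld) blast+
    have "almost r (V \<inter> {\<alpha>. \<bar>\<xi> \<alpha> - x\<bar> < e})"
      using q1(2) pr(2) UV(2) almost_le by (intro almost_Int fld) blast+
    then have al: "almost r (\<xi> -` towards n (\<xi> \<alpha>))" if "\<alpha> \<in> A" for \<alpha>
      by (rule almost_mono[OF fld(2)]) (use that tow in \<open>auto simp: A_def\<close>)
    have "col a \<alpha> \<notin> J r" if "\<alpha> \<in> A" for \<alpha> using that by (auto simp: A_def unreachable_def)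
    then have "stage n A r" using al a(2) unfolding stage_def by blast
    moreover have "A \<subseteq> G \<inter> W" by (auto simp: A_def)
    ultimately show ?thesis using A pr le_trans[OF _ q1(1)] by blast
  qed
  show ?thesis
  proof (cases "even n")
    case True
    show ?thesis
      by (rule *[OF sp(1,2) reach sp(3) _ sp(5,6)]) (use True e in \<open>auto simp: towards_def\<close>)
  next
    case False
    show ?thesis
      by (rule *[OF sp(2,1) reach(2,1) sp(4) _ sp(6,5)]) (use False e in \<open>auto simp: towards_def\<close>)
  qed
qed

lemma W_infinite: "infinite W"
proof
  assume "finite W"
  have "almost top (- {\<alpha>})" if "\<alpha> \<in> W" for \<alpha>
    using J_singleton[OF top that] that by (simp add: almost_def Diff_Compl)
  then have "almost top (\<Inter>\<alpha>\<in>W. - {\<alpha>})"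
    using \<open>finite W\<close> by (intro almost_INT[OF top]) (auto intro: countable_finite)
  from almost_ex[OF top this] show False by auto
qed

text \<open>A state consists of the stage, the triples of the condition and of the reservoir, and
  the set in play. Each component has fewer than \<kappa> values, and regularity bounds the
  product.\<close>

lemma card_of_states: "|(UNIV :: nat set) \<times> ((Pow (Pow W) \<times> Pow (Pow W) \<times> Pow (Pow W)) \<times>
    (Pow (Pow W) \<times> Pow (Pow W) \<times> Pow (Pow W)) \<times> Pow W)| <o \<kappa>"
proof -
  have W: "|Pow W| <o \<kappa>"
    using card_of_Pow[of "Pow W"] \<kappa>(4) ordLess_transitive by blast
  have "|W| <o \<kappa>" using card_of_Pow[of W] W ordLess_transitive by blast
  moreover have "|UNIV :: nat set| \<le>o |W|" using W_infinite infinite_iff_card_of_nat by blast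
  ultimately have "|UNIV :: nat set| <o \<kappa>" using ordLeq_ordLess_trans by blast
  then show ?thesis by (intro stable_elim[OF regularCard_stable[OF \<kappa>(1,3,2)]] \<kappa>(4) W)
qed

text \<open>\<open>ex_stage\<close> provides the steps for \<open>common_point_branch\<close>. The
  point found lies in the set of every stage, so all the reservoirs approach it.\<close>

lemma ex_point_with_reservoirs:
  assumes q: "(q, top) \<in> P" and G: "almost q G"
  shows "\<exists>\<alpha> \<in> G \<inter> W. \<exists>\<rho>. (\<forall>n :: nat. (\<rho> n, top) \<in> P \<and> below (\<rho> n) q \<and>
      (\<forall>m. m \<noteq> n \<longrightarrow> reach (\<rho> m) (\<rho> n)) \<and> (col i \<alpha> \<notin> J (\<rho> n) \<or> col j \<alpha> \<notin> J (\<rho> n))) \<and>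
    (\<forall>e > 0. (\<exists>n. almost (\<rho> n) (\<xi> -` {\<xi> \<alpha><..<\<xi> \<alpha> + e})) \<and> (\<exists>n. almost (\<rho> n) (\<xi> -` {\<xi> \<alpha> - e<..<\<xi> \<alpha>})))"
proof -
  define good where "good n p r A \<longleftrightarrow> (p, top) \<in> P \<and> (r, top) \<in> P \<and> below p q \<and> below r q \<and>
    A \<subseteq> G \<inter> W \<and> stage n A r \<and> reach p r \<and> reach r p" for n p r A
  define S where "S = {(n, info p, info r, A) |n p r A. good n p r A}"
  define ok where "ok p s \<longleftrightarrow> (\<exists>n r A. s = (n, info p, info r, A) \<and> good n p r A \<and> almost p A)" for p s
  \<comment> \<open>Both the new condition and the new reservoir are compared with the old
    condition, which is the half linked with the old reservoir.\<close>
  define step where "step s s' \<longleftrightarrow> fst s' = Suc (fst s) \<and> info_le (fst (snd s')) (fst (snd s)) \<and>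
    info_le (fst (snd (snd s'))) (fst (snd s))"
    for s s' :: "nat \<times> ('b set set \<times> 'b set set \<times> 'b set set) \<times> ('b set set \<times> 'b set set \<times> 'b set set) \<times> 'b set"
  let ?A = "\<lambda>s :: nat \<times> ('b set set \<times> 'b set set \<times> 'b set set) \<times> ('b set set \<times> 'b set set \<times> 'b set set) \<times> 'b set. snd (snd (snd s))"
  have sub: "J p \<subseteq> Pow W" "blocked k p \<subseteq> Pow W" if "(p, top) \<in> P" for p k
    using J_subset[OF le_Field(1)[OF that]] by (auto simp: blocked_def unreachable_def)
  have "S \<subseteq> UNIV \<times> ((Pow (Pow W) \<times> Pow (Pow W) \<times> Pow (Pow W)) \<times>
    (Pow (Pow W) \<times> Pow (Pow W) \<times> Pow (Pow W)) \<times> Pow W)"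
  proof
    fix s assume "s \<in> S"
    then obtain n p r A where "s = (n, info p, info r, A)" "(p, top) \<in> P" "(r, top) \<in> P" "A \<subseteq> W"
      unfolding S_def good_def by blast
    then show "s \<in> UNIV \<times> ((Pow (Pow W) \<times> Pow (Pow W) \<times> Pow (Pow W)) \<times>
        (Pow (Pow W) \<times> Pow (Pow W) \<times> Pow (Pow W)) \<times> Pow W)"
      using sub[of p] sub[of r] by (simp add: info_def)
  qed
  then have S: "|S| <o \<kappa>" by (rule ordLeq_ordLess_trans[OF card_of_mono1 card_of_states])
  have ex: "\<exists>p' s. (p', p) \<in> P \<and> fst s = n \<and> ok p' s \<and> info_le (fst (snd s)) (info p)
      \<and> info_le (fst (snd (snd s))) (info p)"
    if p: "(p, top) \<in> P" "below p q" "almost p G" for p n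
  proof -
    obtain p' r A where *: "(p', p) \<in> P" "(r, p) \<in> P" "A \<subseteq> G \<inter> W" "almost p' A"
        "stage n A r" "reach p' r" "reach r p'"
      using ex_stage[OF p(1,3)] by blast
    have "good n p' r A"
      unfolding good_def using * p le_trans[OF _ p(1)] below_trans[OF le_below p(2)] by blast
    then have "ok p' (n, info p', info r, A)" using *(4) unfolding ok_def by blast
    then show ?thesis using * le_below unfolding below_def
      by (intro exI[of _ p'] exI[of _ "(n, info p', info r, A)"]) auto
  qed
  obtain p0 s0 where "ok p0 s0" using ex[OF q below_refl G] by blast
  moreover have "p \<in> Field P \<and> s \<in> S \<and> almost p (?A s)" if "ok p s" for p s
    using that le_Field(1) unfolding ok_def S_def good_def by fastforce
  moreover have "\<exists>q' s'. (q', p') \<in> P \<and> step s s' \<and> ok q' s'" if ok: "ok p s" and p': "(p', p) \<in> P" for p s p'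
  proof -
    obtain n r A where s: "s = (n, info p, info r, A)" "good n p r A" "almost p A"
      using ok unfolding ok_def by blast
    have p: "(p', top) \<in> P" "below p' q"
      using s(2) le_trans[OF p'] below_trans[OF le_below[OF p']] unfolding good_def by blast+
    have "almost p' G"
      using almost_mono[OF le_Field(1)[OF p'] almost_le[OF s(3) p']] s(2) unfolding good_def by blast
    from ex[OF p this, of "Suc n"] obtain q' s' where "(q', p') \<in> P" "fst s' = Suc n" "ok q' s'"
        "info_le (fst (snd s')) (info p')" "info_le (fst (snd (snd s'))) (info p')" by blast
    moreover have "info_le (info p') (info p)" using le_below[OF p'] by (simp add: below_def)
    ultimately show ?thesis unfolding step_def s(1) info_le_def
      by (intro exI[of _ q'] exI[of _ s']) auto
  qed
  ultimately obtain \<alpha> \<sigma> where \<alpha>: "\<alpha> \<in> W"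
    and \<sigma>: "\<And>n :: nat. \<sigma> n \<in> S \<and> \<alpha> \<in> ?A (\<sigma> n) \<and> step (\<sigma> n) (\<sigma> (Suc n))"
    using common_point_branch[OF S, of ok p0 s0 ?A step] by blast
  have "\<exists>p r. s = (fst s, info p, info r, ?A s) \<and> good (fst s) p r (?A s)" if "s \<in> S" for s
    using that unfolding S_def by force
  then have "\<forall>n. \<exists>p r. \<sigma> n = (fst (\<sigma> n), info p, info r, ?A (\<sigma> n)) \<and> good (fst (\<sigma> n)) p r (?A (\<sigma> n))"
    using \<sigma> by blast
  \<comment> \<open>The conditions are picked anew from the triples on the branch, hence related
    only by \<open>below\<close>.\<close>
  then obtain \<pi> \<rho> where *: "\<And>n. \<sigma> n = (fst (\<sigma> n), info (\<pi> n), info (\<rho> n), ?A (\<sigma> n))"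
      and good: "\<And>n. good (fst (\<sigma> n)) (\<pi> n) (\<rho> n) (?A (\<sigma> n))"
    by metis
  have parts: "fst (snd (\<sigma> n)) = info (\<pi> n)" "fst (snd (snd (\<sigma> n))) = info (\<rho> n)" for n
    by (subst *, simp)+
  have steps: "fst (\<sigma> (Suc n)) = Suc (fst (\<sigma> n))" "below (\<pi> (Suc n)) (\<pi> n)" "below (\<rho> (Suc n)) (\<pi> n)" for n
    using \<sigma>[of n] parts unfolding step_def below_def by auto
  have \<pi>: "below (\<pi> (n + k)) (\<pi> n)" for n k
    by (induction k) (auto intro: below_refl below_trans steps(2))
  have \<rho>\<pi>: "below (\<rho> m) (\<pi> n)" if nm: "n < m" for n m
  proof -
    obtain k where "m = Suc (n + k)" using nm less_iff_Suc_add by blast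
    then show ?thesis using below_trans[OF steps(3) \<pi>] by simp
  qed
  \<comment> \<open>The later reservoir is below the condition that reaches, and is reached by, the
    earlier one.\<close>
  have reach: "reach (\<rho> m) (\<rho> n)" if "m \<noteq> n" for m n
  proof (cases "n < m")
    case True
    then show ?thesis
      using reach_below[OF _ \<rho>\<pi>[OF True] below_refl] good[of n] unfolding good_def by blast
  next
    case False
    then have "m < n" using that by simp
    then show ?thesis
      using reach_below[OF _ below_refl \<rho>\<pi>[OF \<open>m < n\<close>]] good[of m] unfolding good_def by blast
  qed
  have st: "almost (\<rho> n) (\<xi> -` towards (fst (\<sigma> n)) (\<xi> \<alpha>))" "col i \<alpha> \<notin> J (\<rho> n) \<or> col j \<alpha> \<notin> J (\<rho> n)" for n
    using \<sigma>[of n] good[of n] unfolding good_def stage_def by blast+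
  \<comment> \<open>The branch may start at any stage, hence the offset.\<close>
  have fst: "fst (\<sigma> n) = fst (\<sigma> 0) + n" for n by (induction n) (simp_all add: steps)
  have fld: "\<rho> n \<in> Field P" for n using good[of n] le_Field(1) unfolding good_def by blast
  have near: "\<exists>n. even (fst (\<sigma> n)) = b \<and> 1 / real (Suc (fst (\<sigma> n))) < e" if e: "0 < e" for e b
  proof -
    obtain N where N: "1 / real (Suc N) < e"
      using reals_Archimedean[OF e] by (auto simp: inverse_eq_divide)
    obtain n where n: "N \<le> n" "even (fst (\<sigma> n)) = b"
    proof (cases "even (fst (\<sigma> N)) = b")
      case False
      then have "even (fst (\<sigma> (Suc N))) = b" by (simp add: steps)
      then show ?thesis using that[of "Suc N"] by simp
    qed (use that in blast)
    have "1 / real (Suc (fst (\<sigma> n))) \<le> 1 / real (Suc N)"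
      using n(1) fst[of n] by (intro divide_left_mono) auto
    then show ?thesis using N n(2) by (intro exI[of _ n]) auto
  qed
  have right: "\<exists>n. almost (\<rho> n) (\<xi> -` {\<xi> \<alpha><..<\<xi> \<alpha> + e})" if e: "0 < e" for e
  proof -
    obtain n where n: "even (fst (\<sigma> n))" "1 / real (Suc (fst (\<sigma> n))) < e" using near[OF e, of True] by blast
    have "\<xi> -` towards (fst (\<sigma> n)) (\<xi> \<alpha>) \<subseteq> \<xi> -` {\<xi> \<alpha><..<\<xi> \<alpha> + e}"
      using n by (auto simp: towards_def)
    then show ?thesis using almost_mono[OF fld st(1)] by blast
  qed
  have left: "\<exists>n. almost (\<rho> n) (\<xi> -` {\<xi> \<alpha> - e<..<\<xi> \<alpha>})" if e: "0 < e" for e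
  proof -
    obtain n where n: "odd (fst (\<sigma> n))" "1 / real (Suc (fst (\<sigma> n))) < e" using near[OF e, of False] by blast
    have "\<xi> -` towards (fst (\<sigma> n)) (\<xi> \<alpha>) \<subseteq> \<xi> -` {\<xi> \<alpha> - e<..<\<xi> \<alpha>}"
      using n by (auto simp: towards_def)
    then show ?thesis using almost_mono[OF fld st(1)] by blast
  qed
  have \<alpha>: "\<alpha> \<in> G \<inter> W" using \<sigma>[of 0] good[of 0] unfolding good_def by blast
  have "(\<rho> n, top) \<in> P" "below (\<rho> n) q" for n using good[of n] unfolding good_def by blast+
  then show ?thesis
    using reach st(2) right left by (intro bexI[OF _ \<alpha>] exI[of _ \<rho>] conjI allI impI) simp_all
qed

end


section \<open>Building the two-coloured set from finite approximations\<close>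

context dense_split_system
begin

text \<open>The invariant: \<open>F\<close> holds the points chosen so far, \<open>R\<close> the
  reservoirs for later ones. Each reservoir commits to one of the two colours with each chosen
  point.\<close>

definition extendable :: "'b set \<Rightarrow> 'a set \<Rightarrow> bool"
  where "extendable F R \<longleftrightarrow> finite F \<and> F \<subseteq> W \<and> countable R \<and> (\<forall>p \<in> R. (p, top) \<in> P) \<and>
    (\<forall>p \<in> R. \<forall>q \<in> R. p \<noteq> q \<longrightarrow> reach p q) \<and>
    (\<forall>\<alpha> \<in> F. \<forall>p \<in> R. almost p (col i \<alpha>) \<or> almost p (col j \<alpha>)) \<and>
    (\<forall>\<alpha> \<in> F. \<forall>\<beta> \<in> F. \<alpha> \<noteq> \<beta> \<longrightarrow> d \<alpha> \<beta> \<in> {i, j}) \<and>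
    (\<forall>\<alpha> \<in> F. \<forall>e > 0. (\<exists>p \<in> R. almost p (\<xi> -` {\<xi> \<alpha><..<\<xi> \<alpha> + e})) \<and>
      (\<exists>p \<in> R. almost p (\<xi> -` {\<xi> \<alpha> - e<..<\<xi> \<alpha>})))"

lemma extendable_near:
  assumes "extendable F R" "\<alpha> \<in> F" "0 < e"
  shows "\<exists>p \<in> R. almost p (\<xi> -` {\<xi> \<alpha><..<\<xi> \<alpha> + e})"
    and "\<exists>p \<in> R. almost p (\<xi> -` {\<xi> \<alpha> - e<..<\<xi> \<alpha>})"
  using assms by (simp_all add: extendable_def)

lemma almost_below: "almost p A \<Longrightarrow> below q p \<Longrightarrow> almost q A"
  by (auto simp: almost_def below_iff)

text \<open>A new point is taken from the reservoir \<open>p\<close>, which is replaced by the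
  reservoirs around that point. As \<open>R\<close> is countable, the point can be reachable for all
  other reservoirs at once, and these are shrunk to its neighbours in one colour.\<close>

lemma extend_by_point:
  assumes FR: "extendable F R" and p: "p \<in> R" and G: "almost p G"
  shows "\<exists>\<alpha> R'. \<alpha> \<in> G \<and> extendable (insert \<alpha> F) R'"
proof -
  have F: "finite F" "F \<subseteq> W" and R: "countable R" "\<And>q. q \<in> R \<Longrightarrow> (q, top) \<in> P"
    and reach: "\<And>q r. q \<in> R \<Longrightarrow> r \<in> R \<Longrightarrow> q \<noteq> r \<Longrightarrow> reach q r"
    and col: "\<And>\<beta> q. \<beta> \<in> F \<Longrightarrow> q \<in> R \<Longrightarrow> almost q (col i \<beta>) \<or> almost q (col j \<beta>)"
    and dF: "\<And>\<beta> \<gamma>. \<beta> \<in> F \<Longrightarrow> \<gamma> \<in> F \<Longrightarrow> \<beta> \<noteq> \<gamma> \<Longrightarrow> d \<beta> \<gamma> \<in> {i, j}"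
    and right: "\<And>\<beta> e. \<beta> \<in> F \<Longrightarrow> 0 < e \<Longrightarrow> \<exists>q \<in> R. almost q (\<xi> -` {\<xi> \<beta><..<\<xi> \<beta> + e})"
    and left: "\<And>\<beta> e. \<beta> \<in> F \<Longrightarrow> 0 < e \<Longrightarrow> \<exists>q \<in> R. almost q (\<xi> -` {\<xi> \<beta> - e<..<\<xi> \<beta>})"
    using FR unfolding extendable_def by simp_all
  have fld: "q \<in> Field P" if "q \<in> R" for q using R(2)[OF that] le_Field(1) by blast
  \<comment> \<open>The colour in which \<open>p\<close> reaches \<open>q\<close>: almost every
    point for \<open>p\<close> has positively many points for \<open>q\<close> in it.\<close>
  define a where "a q = (if blocked i q \<subseteq> J p then i else j)" for q
  have a: "a q \<in> {i, j}" "blocked (a q) q \<subseteq> J p" if "q \<in> R - {p}" for q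
    using reach[OF p, of q] that by (auto simp: a_def reach_def)
  have "almost p (W - unreachable (a q) q)" if q: "q \<in> R - {p}" for q
  proof -
    have "unreachable (a q) q \<in> J p"
      using a(2)[OF q] le_refl[OF fld, of q] q by (auto simp: blocked_def)
    moreover have "W - (W - unreachable (a q) q) = unreachable (a q) q" by (auto simp: unreachable_def)
    ultimately show ?thesis by (simp add: almost_def)
  qed
  then have aR: "almost p (\<Inter>q\<in>R - {p}. W - unreachable (a q) q)"
    using R(1) by (intro almost_INT[OF fld[OF p]]) auto
  have aF: "almost p (\<Inter>\<beta>\<in>F. col i \<beta> \<union> col j \<beta>)"
  proof (intro almost_INT[OF fld[OF p]])
    show "almost p (col i \<beta> \<union> col j \<beta>)" if "\<beta> \<in> F" for \<beta>
      using col[OF that p] almost_mono[OF fld[OF p]] by (meson Int_lower1 le_supI1 le_supI2)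
  qed (use F in \<open>auto intro: countable_finite\<close>)
  define G' where "G' = G \<inter> ((\<Inter>q\<in>R - {p}. W - unreachable (a q) q) \<inter> (\<Inter>\<beta>\<in>F. col i \<beta> \<union> col j \<beta>))"
  have "almost p G'" unfolding G'_def using G aF aR by (intro almost_Int fld[OF p])
  from ex_point_with_reservoirs[OF R(2)[OF p] this]
  obtain \<alpha> \<rho> where *: "\<alpha> \<in> G'" "\<alpha> \<in> W" and
    \<rho>': "\<forall>n :: nat. (\<rho> n, top) \<in> P \<and> below (\<rho> n) p \<and>
      (\<forall>m. m \<noteq> n \<longrightarrow> reach (\<rho> m) (\<rho> n)) \<and> (col i \<alpha> \<notin> J (\<rho> n) \<or> col j \<alpha> \<notin> J (\<rho> n))" and
    near: "\<And>e. 0 < e \<Longrightarrow> \<exists>n. almost (\<rho> n) (\<xi> -` {\<xi> \<alpha><..<\<xi> \<alpha> + e})"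
      "\<And>e. 0 < e \<Longrightarrow> \<exists>n. almost (\<rho> n) (\<xi> -` {\<xi> \<alpha> - e<..<\<xi> \<alpha>})"
    by (elim bexE exE conjE IntE) metis
  have \<rho>: "(\<rho> n, top) \<in> P" "below (\<rho> n) p" "m \<noteq> n \<Longrightarrow> reach (\<rho> m) (\<rho> n)"
      "col i \<alpha> \<notin> J (\<rho> n) \<or> col j \<alpha> \<notin> J (\<rho> n)" for m n
    using \<rho>' by blast+
  have \<alpha>: "\<alpha> \<in> G" "\<alpha> \<in> W" "\<And>q. q \<in> R - {p} \<Longrightarrow> \<alpha> \<notin> unreachable (a q) q"
      "\<And>\<beta>. \<beta> \<in> F \<Longrightarrow> \<alpha> \<in> col i \<beta> \<union> col j \<beta>"
    using * unfolding G'_def by blast+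
  have "\<exists>q'. (q', q) \<in> P \<and> almost q' (col (a q) \<alpha>)" if q: "q \<in> R - {p}" for q
  proof (rule almost_extend)
    show "col (a q) \<alpha> \<notin> J q" using \<alpha>(2,3) q by (auto simp: unreachable_def)
  qed (use q fld in \<open>auto simp: col_def\<close>)
  then obtain \<epsilon> where \<epsilon>: "\<And>q. q \<in> R - {p} \<Longrightarrow> (\<epsilon> q, q) \<in> P"
      "\<And>q. q \<in> R - {p} \<Longrightarrow> almost (\<epsilon> q) (col (a q) \<alpha>)"
    by metis
  have "\<exists>q'. (q', \<rho> n) \<in> P \<and> (almost q' (col i \<alpha>) \<or> almost q' (col j \<alpha>))" for n
  proof -
    have "col k \<alpha> \<notin> J (\<rho> n) \<Longrightarrow> \<exists>q'. (q', \<rho> n) \<in> P \<and> almost q' (col k \<alpha>)" for k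
      using le_Field(1)[OF \<rho>(1)] by (intro almost_extend) (auto simp: col_def)
    then show ?thesis using \<rho>(4)[of n] by blast
  qed
  then obtain \<tau> where \<tau>: "\<And>n. (\<tau> n, \<rho> n) \<in> P" "\<And>n. almost (\<tau> n) (col i \<alpha>) \<or> almost (\<tau> n) (col j \<alpha>)"
    by metis
  define R' where "R' = \<epsilon> ` (R - {p}) \<union> range \<tau>"
  have \<epsilon>_below: "below (\<epsilon> q) q" if "q \<in> R - {p}" for q using le_below[OF \<epsilon>(1)[OF that]] .
  have \<tau>_below: "below (\<tau> n) (\<rho> n)" "below (\<tau> n) p" for n
    using le_below[OF \<tau>(1)] below_trans \<rho>(2) by blast+
  \<comment> \<open>Every old reservoir survives in a smaller one, which preserves the limits; every
    new one refines an old one, which preserves the colours.\<close>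
  have below: "\<exists>r \<in> R'. below r q" if "q \<in> R" for q
    using \<epsilon>_below[of q] \<tau>_below(2) that unfolding R'_def by blast
  have anc: "\<exists>q \<in> R. below r q" if "r \<in> R'" for r
    using \<epsilon>_below \<tau>_below(2) p that unfolding R'_def by blast
  have reach': "reach x y" if xy: "x \<in> R'" "y \<in> R'" "x \<noteq> y" for x y
  proof -
    consider q r where "q \<in> R - {p}" "r \<in> R - {p}" "x = \<epsilon> q" "y = \<epsilon> r"
      | q n where "q \<in> R - {p}" "x = \<epsilon> q" "y = \<tau> n"
      | q n where "q \<in> R - {p}" "y = \<epsilon> q" "x = \<tau> n"
      | m n where "x = \<tau> m" "y = \<tau> n"
      using xy(1,2) unfolding R'_def by blast
    then show ?thesis
    proof cases
      case 1
      then show ?thesis using reach_below[OF reach \<epsilon>_below \<epsilon>_below, of q r] xy(3) by auto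
    next
      case 2
      then show ?thesis using reach_below[OF reach \<epsilon>_below \<tau>_below(2), of q] p by auto
    next
      case 3
      then show ?thesis using reach_below[OF reach \<tau>_below(2) \<epsilon>_below, of q] p by auto
    next
      case 4
      then show ?thesis using reach_below[OF \<rho>(3) \<tau>_below(1) \<tau>_below(1), of m n] xy(3) by auto
    qed
  qed
  have col': "almost r (col i \<beta>) \<or> almost r (col j \<beta>)" if \<beta>: "\<beta> \<in> insert \<alpha> F" and r: "r \<in> R'" for \<beta> r
  proof (cases "\<beta> \<in> F")
    case True
    then show ?thesis using col anc[OF r] almost_below by blast
  next
    case False
    then have "\<beta> = \<alpha>" using \<beta> by blast
    then show ?thesis using r \<epsilon>(2) \<tau>(2) a(1) unfolding R'_def by fastforce
  qed
  have d\<alpha>: "d \<beta> \<alpha> \<in> {i, j}" if "\<beta> \<in> F" for \<beta> using \<alpha>(4)[OF that] by (auto simp: col_def)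
  have d': "d \<beta> \<gamma> \<in> {i, j}" if \<beta>\<gamma>: "\<beta> \<in> insert \<alpha> F" "\<gamma> \<in> insert \<alpha> F" "\<beta> \<noteq> \<gamma>" for \<beta> \<gamma>
  proof -
    consider "\<beta> = \<alpha>" "\<gamma> \<in> F" | "\<gamma> = \<alpha>" "\<beta> \<in> F" | "\<beta> \<in> F" "\<gamma> \<in> F" using \<beta>\<gamma> by blast
    then show ?thesis
    proof cases
      case 1
      then show ?thesis using d\<alpha>[of \<gamma>] d_sym[of \<alpha> \<gamma>] by simp
    qed (use d\<alpha> dF \<beta>\<gamma>(3) in blast)+
  qed
  have right': "\<exists>r \<in> R'. almost r (\<xi> -` {\<xi> \<beta><..<\<xi> \<beta> + e})" if "\<beta> \<in> insert \<alpha> F" "0 < e" for \<beta> e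
  proof (cases "\<beta> \<in> F")
    case True
    then show ?thesis using right[OF True that(2)] below almost_below by meson
  next
    case False
    then show ?thesis using near(1)[OF that(2)] that(1) almost_below[OF _ \<tau>_below(1)] unfolding R'_def by blast
  qed
  have left': "\<exists>r \<in> R'. almost r (\<xi> -` {\<xi> \<beta> - e<..<\<xi> \<beta>})" if "\<beta> \<in> insert \<alpha> F" "0 < e" for \<beta> e
  proof (cases "\<beta> \<in> F")
    case True
    then show ?thesis using left[OF True that(2)] below almost_below by meson
  next
    case False
    then show ?thesis using near(2)[OF that(2)] that(1) almost_below[OF _ \<tau>_below(1)] unfolding R'_def by blast
  qed
  have top': "(r, top) \<in> P" if "r \<in> R'" for r
    using that \<epsilon>(1) \<tau>(1) \<rho>(1) R(2) le_trans unfolding R'_def by blast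
  have "countable R'" using R(1) by (simp add: R'_def)
  then have "extendable (insert \<alpha> F) R'"
    unfolding extendable_def using F \<alpha>(2) top' reach' col' d' right' left'
    by (intro conjI ballI allI impI) simp_all
  then show ?thesis using \<alpha>(1) by blast
qed

text \<open>For each point of \<open>K\<close> in turn, one new point is taken from a reservoir
  close to it on the right and one from a reservoir on the left.\<close>

lemma extend_near_points:
  assumes FR: "extendable F R" and e: "0 < e" and K: "finite K" "K \<subseteq> F"
  shows "\<exists>F' R'. F \<subseteq> F' \<and> extendable F' R' \<and> (\<forall>\<alpha> \<in> K.
    (\<exists>\<beta> \<in> F'. \<xi> \<alpha> < \<xi> \<beta> \<and> \<xi> \<beta> < \<xi> \<alpha> + e) \<and> (\<exists>\<beta> \<in> F'. \<xi> \<alpha> - e < \<xi> \<beta> \<and> \<xi> \<beta> < \<xi> \<alpha>))"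
  using K
proof (induction K rule: finite_induct)
  case empty
  then show ?case using FR by blast
next
  case (insert \<alpha> K)
  obtain F1 R1 where 1: "F \<subseteq> F1" "extendable F1 R1" and K: "\<forall>\<alpha> \<in> K.
      (\<exists>\<beta> \<in> F1. \<xi> \<alpha> < \<xi> \<beta> \<and> \<xi> \<beta> < \<xi> \<alpha> + e) \<and> (\<exists>\<beta> \<in> F1. \<xi> \<alpha> - e < \<xi> \<beta> \<and> \<xi> \<beta> < \<xi> \<alpha>)"
    using insert.IH insert.prems by blast
  have "\<alpha> \<in> F1" using insert.prems 1(1) by blast
  then obtain p where "p \<in> R1" "almost p (\<xi> -` {\<xi> \<alpha><..<\<xi> \<alpha> + e})"
    using extendable_near(1)[OF 1(2) _ e] by metis
  from extend_by_point[OF 1(2) this]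
  obtain \<beta> R2 where 2: "\<xi> \<alpha> < \<xi> \<beta>" "\<xi> \<beta> < \<xi> \<alpha> + e" "extendable (insert \<beta> F1) R2" by auto
  then obtain q where "q \<in> R2" "almost q (\<xi> -` {\<xi> \<alpha> - e<..<\<xi> \<alpha>})"
    using extendable_near(2)[OF 2(3) _ e, of \<alpha>] \<open>\<alpha> \<in> F1\<close> by auto
  from extend_by_point[OF 2(3) this]
  obtain \<gamma> R3 where 3: "\<xi> \<alpha> - e < \<xi> \<gamma>" "\<xi> \<gamma> < \<xi> \<alpha>" "extendable (insert \<gamma> (insert \<beta> F1)) R3" by auto
  let ?F = "insert \<gamma> (insert \<beta> F1)"
  have "(\<exists>\<beta> \<in> ?F. \<xi> \<delta> < \<xi> \<beta> \<and> \<xi> \<beta> < \<xi> \<delta> + e) \<and> (\<exists>\<beta> \<in> ?F. \<xi> \<delta> - e < \<xi> \<beta> \<and> \<xi> \<beta> < \<xi> \<delta>)"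
    if "\<delta> \<in> insert \<alpha> K" for \<delta>
  proof (cases "\<delta> = \<alpha>")
    case True
    then show ?thesis using 2(1,2) 3(1,2) by blast
  next
    case False
    then have "\<delta> \<in> K" using that by blast
    from bspec[OF K this] show ?thesis by blast
  qed
  then show ?case using 1(1) 3(3) by (intro exI[of _ ?F] exI[of _ R3] conjI ballI) blast+
qed

text \<open>Round \<open>n\<close> adds points within \<open>1 / real (Suc n)\<close> on both sides
  of all earlier ones, so each point of the union is a limit of others from both sides.\<close>

lemma ex_two_sided_two_coloured:
  "\<exists>Z \<subseteq> W. Z \<noteq> {} \<and> countable Z \<and> two_sided_limits (\<xi> ` Z) \<and>
    (\<forall>\<alpha> \<in> Z. \<forall>\<beta> \<in> Z. \<alpha> \<noteq> \<beta> \<longrightarrow> d \<alpha> \<beta> \<in> {i, j})"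
proof -
  have "extendable {} {top}" using le_refl[OF top] by (simp add: extendable_def)
  then obtain \<alpha>0 R0 where 0: "extendable {\<alpha>0} R0"
    using extend_by_point[of "{}" "{top}" top UNIV] almost_UNIV[OF top] by auto
  define next_to where "next_to n F F' \<longleftrightarrow> F \<subseteq> F' \<and> (\<forall>\<alpha> \<in> F.
      (\<exists>\<beta> \<in> F'. \<xi> \<alpha> < \<xi> \<beta> \<and> \<xi> \<beta> < \<xi> \<alpha> + 1 / real (Suc n)) \<and>
      (\<exists>\<beta> \<in> F'. \<xi> \<alpha> - 1 / real (Suc n) < \<xi> \<beta> \<and> \<xi> \<beta> < \<xi> \<alpha>))" for n F F'
  have "\<exists>\<sigma>. \<forall>n. (\<alpha>0 \<in> fst (\<sigma> n) \<and> extendable (fst (\<sigma> n)) (snd (\<sigma> n))) \<and> next_to n (fst (\<sigma> n)) (fst (\<sigma> (Suc n)))"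
  proof (rule dependent_nat_choice)
    show "\<exists>x. \<alpha>0 \<in> fst x \<and> extendable (fst x) (snd x)" by (rule exI[of _ "({\<alpha>0}, R0)"]) (simp add: 0)
    fix x n assume x: "\<alpha>0 \<in> fst x \<and> extendable (fst x) (snd x)"
    then have "finite (fst x)" by (simp add: extendable_def)
    with x obtain F' R' where "fst x \<subseteq> F'" "extendable F' R'" "next_to n (fst x) F'"
      using extend_near_points[of "fst x" "snd x" "1 / real (Suc n)" "fst x"] unfolding next_to_def by auto
    then show "\<exists>y. (\<alpha>0 \<in> fst y \<and> extendable (fst y) (snd y)) \<and> next_to n (fst x) (fst y)"
      using x by (intro exI[of _ "(F', R')"]) auto
  qed
  then obtain \<sigma> where \<sigma>: "\<And>n. \<alpha>0 \<in> fst (\<sigma> n)" "\<And>n. extendable (fst (\<sigma> n)) (snd (\<sigma> n))"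
      "\<And>n. next_to n (fst (\<sigma> n)) (fst (\<sigma> (Suc n)))"
    by blast
  define F where "F n = fst (\<sigma> n)" for n
  have F: "finite (F n)" "F n \<subseteq> W" "\<And>\<alpha> \<beta>. \<alpha> \<in> F n \<Longrightarrow> \<beta> \<in> F n \<Longrightarrow> \<alpha> \<noteq> \<beta> \<Longrightarrow> d \<alpha> \<beta> \<in> {i, j}" for n
    using \<sigma>(2)[of n] unfolding extendable_def F_def by auto
  have nxt: "next_to n (F n) (F (Suc n))" for n using \<sigma>(3) by (simp add: F_def)
  then have "F n \<subseteq> F (Suc n)" for n by (simp add: next_to_def)
  then have mono: "F m \<subseteq> F n" if "m \<le> n" for m n using lift_Suc_mono_le[of F] that by blast
  let ?Z = "\<Union>n. F n"
  have "two_sided_limits (\<xi> ` ?Z)"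
    unfolding two_sided_limits_def
  proof (intro ballI allI impI)
    fix y e :: real assume "y \<in> \<xi> ` ?Z" and e: "0 < e"
    then obtain \<alpha> m where \<alpha>: "y = \<xi> \<alpha>" "\<alpha> \<in> F m" by blast
    obtain N where N: "1 / real (Suc N) < e"
      using reals_Archimedean[OF e] by (auto simp: inverse_eq_divide)
    define n where "n = max m N"
    have "\<alpha> \<in> F n" using \<alpha>(2) mono[of m n] by (auto simp: n_def)
    then obtain \<beta> \<gamma> where \<beta>\<gamma>: "\<beta> \<in> F (Suc n)" "\<xi> \<alpha> < \<xi> \<beta>" "\<xi> \<beta> < \<xi> \<alpha> + 1 / real (Suc n)"
        "\<gamma> \<in> F (Suc n)" "\<xi> \<alpha> - 1 / real (Suc n) < \<xi> \<gamma>" "\<xi> \<gamma> < \<xi> \<alpha>"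
      using nxt[of n] unfolding next_to_def by meson
    have "1 / real (Suc n) \<le> 1 / real (Suc N)" by (intro divide_left_mono) (auto simp: n_def)
    then have "\<xi> \<beta> < y + e" "y - e < \<xi> \<gamma>" using \<beta>\<gamma> N \<alpha>(1) by linarith+
    moreover have "\<xi> \<beta> \<in> \<xi> ` ?Z" "\<xi> \<gamma> \<in> \<xi> ` ?Z" using \<beta>\<gamma>(1,4) by blast+
    ultimately show "(\<exists>z\<in>\<xi> ` ?Z. y - e < z \<and> z < y) \<and> (\<exists>z\<in>\<xi> ` ?Z. y < z \<and> z < y + e)"
      using \<beta>\<gamma> \<alpha>(1) by blast
  qed
  moreover have "d \<alpha> \<beta> \<in> {i, j}" if \<alpha>\<beta>: "\<alpha> \<in> ?Z" "\<beta> \<in> ?Z" "\<alpha> \<noteq> \<beta>" for \<alpha> \<beta>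
  proof -
    obtain m n where "\<alpha> \<in> F m" "\<beta> \<in> F n" using \<alpha>\<beta> by blast
    then have "\<alpha> \<in> F (max m n)" "\<beta> \<in> F (max m n)"
      using mono[of m "max m n"] mono[of n "max m n"] by auto
    then show ?thesis using F(3) \<alpha>\<beta>(3) by blast
  qed
  moreover have "countable ?Z" using F(1) by (auto intro: countable_finite)
  moreover have "?Z \<noteq> {}" "?Z \<subseteq> W" using \<sigma>(1) F(2) unfolding F_def by blast+
  ultimately show ?thesis by (intro exI[of _ ?Z]) simp
qed

end

lemma (in coloured_system) ex_two_sided_few_colours:
  "\<exists>Z \<subseteq> W. Z \<noteq> {} \<and> countable Z \<and> two_sided_limits (\<xi> ` Z) \<and>
    (\<exists>i j. \<forall>\<alpha> \<in> Z. \<forall>\<beta> \<in> Z. \<alpha> \<noteq> \<beta> \<longrightarrow> d \<alpha> \<beta> \<in> {i, j})"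
proof -
  obtain i j top where "top \<in> Field P" "\<And>p. (p, top) \<in> P \<Longrightarrow> \<exists>q r. split_pair i j p q r"
    using ex_dense_split_pair by blast
  then interpret dense_split_system P J W \<kappa> d l \<xi> i j top by unfold_locales
  show ?thesis using ex_two_sided_two_coloured by blast
qed

lemma (in ideal_system) ex_rational_copy_two_colours:
  fixes X :: "real set" and c :: "real set \<Rightarrow> nat"
  assumes \<xi>: "inj_on \<xi> W" "\<xi> ` W \<subseteq> X" and c: "c \<in> [X]\<^bsup>2\<^esup> \<rightarrow> {..<l}"
  shows "\<exists>Y \<subseteq> X. Y homeomorphic (\<rat> :: real set) \<and> card (c ` [Y]\<^bsup>2\<^esup>) \<le> 2"
proof -
  define d where "d \<alpha> \<beta> = c {\<xi> \<alpha>, \<xi> \<beta>}" for \<alpha> \<beta>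
  interpret coloured_system P J W \<kappa> d l \<xi>
  proof unfold_locales
    show "d \<alpha> \<beta> < l" if "\<alpha> \<in> W" "\<beta> \<in> W" "\<alpha> \<noteq> \<beta>" for \<alpha> \<beta>
    proof -
      have "\<xi> \<alpha> \<noteq> \<xi> \<beta>" using that \<xi>(1) by (meson inj_onD)
      then have "{\<xi> \<alpha>, \<xi> \<beta>} \<in> [X]\<^bsup>2\<^esup>" using that(1,2) \<xi>(2) by (simp add: image_subset_iff)
      then show ?thesis using c by (auto simp: d_def)
    qed
    show "d \<alpha> \<beta> = d \<beta> \<alpha>" for \<alpha> \<beta> unfolding d_def by (rule arg_cong[of _ _ c]) blast
    show "inj_on \<xi> W" by (rule \<xi>(1))
  qed
  from ex_two_sided_few_colours
  obtain Z i j where Z: "Z \<subseteq> W" "Z \<noteq> {}" "countable Z" "two_sided_limits (\<xi> ` Z)"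
    and "\<forall>\<alpha> \<in> Z. \<forall>\<beta> \<in> Z. \<alpha> \<noteq> \<beta> \<longrightarrow> d \<alpha> \<beta> \<in> {i, j}"
    by (elim exE conjE) (rule that)
  then have ij: "c {\<xi> \<alpha>, \<xi> \<beta>} \<in> {i, j}" if "\<alpha> \<in> Z" "\<beta> \<in> Z" "\<alpha> \<noteq> \<beta>" for \<alpha> \<beta>
    using that unfolding d_def by blast
  have "c ` [\<xi> ` Z]\<^bsup>2\<^esup> \<subseteq> {i, j}"
  proof
    fix k assume "k \<in> c ` [\<xi> ` Z]\<^bsup>2\<^esup>"
    then obtain e where e: "k = c e" "e \<in> [\<xi> ` Z]\<^bsup>2\<^esup>" by blast
    then obtain x y where xy: "e = {x, y}" "x \<in> \<xi> ` Z" "y \<in> \<xi> ` Z" "x \<noteq> y" by (elim nsets2_E)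
    then obtain \<alpha> \<beta> where "\<alpha> \<in> Z" "\<beta> \<in> Z" "x = \<xi> \<alpha>" "y = \<xi> \<beta>" by blast
    then show "k \<in> {i, j}" using ij[of \<alpha> \<beta>] xy(1,4) e(1) by blast
  qed
  then have "card (c ` [\<xi> ` Z]\<^bsup>2\<^esup>) \<le> card {i, j}" by (rule card_mono[rotated]) simp
  also have "card {i, j} \<le> 2" by (simp add: card_insert_if)
  finally have "card (c ` [\<xi> ` Z]\<^bsup>2\<^esup>) \<le> 2" .
  moreover have "\<xi> ` Z homeomorphic (\<rat> :: real set)"
    using Z by (intro two_sided_limits_homeomorphic_rat) simp_all
  moreover have "\<xi> ` Z \<subseteq> X" using Z(1) \<xi>(2) by blast
  ultimately show ?thesis by blast
qed


section \<open>The cardinals \<open>\<omega>\<^sub>1\<close> and \<open>\<beth>\<^sub>2(\<omega>\<^sub>1)\<^sup>+\<close>\<close>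

lemma Card_order_omega1: "Card_order omega1"
  unfolding omega1_def by (rule cardSuc_Card_order[OF natLeq_Card_order])

lemma infinite_Field_omega1: "infinite (Field omega1)"
  unfolding omega1_def using cardSuc_finite[OF natLeq_Card_order] by (simp add: Field_natLeq)

lemma regularCard_omega1: "regularCard omega1"
  unfolding omega1_def
  by (rule infinite_cardSuc_regularCard[OF _ natLeq_Card_order]) (simp add: Field_natLeq)

lemma countable_ordLess_omega1:
  assumes "countable N"
  shows "|N| <o omega1"
proof -
  have "|N| \<le>o natLeq" using assms by (simp add: countable_card_le_natLeq)
  then show ?thesis unfolding omega1_def using cardSuc_greater[OF natLeq_Card_order] ordLeq_ordLess_trans by blast
qed

lemma uncountable_Field_omega1: "uncountable (Field omega1)"
proof
  assume "countable (Field omega1)"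
  then have "|Field omega1| <o omega1" by (rule countable_ordLess_omega1)
  then show False using card_of_Field_ordIso[OF Card_order_omega1] not_ordLess_ordIso by blast
qed

lemma uncountable_imp_inj_omega1:
  assumes "uncountable X"
  shows "\<exists>\<xi>. inj_on \<xi> (Field omega1) \<and> \<xi> ` Field omega1 \<subseteq> X"
proof -
  have "\<not> |X| \<le>o natLeq" using assms by (simp add: countable_card_le_natLeq)
  then have "natLeq <o |X|"
    using ordLess_or_ordLeq[OF natLeq_Well_order card_of_Well_order] by blast
  then have "omega1 \<le>o |X|"
    unfolding omega1_def by (rule cardSuc_least[OF natLeq_Card_order card_of_Card_order])
  then have "|Field omega1| \<le>o |X|"
    using card_of_Field_ordIso[OF Card_order_omega1] ordIso_ordLeq_trans by blast
  then show ?thesis using card_of_ordLeq[of "Field omega1" X] by auto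
qed

lemma card_of_Pow_cong:
  assumes "|A| =o |B|"
  shows "|Pow A| =o |Pow B|"
proof -
  obtain f where "bij_betw f A B" using assms card_of_ordIso by blast
  then have "bij_betw (image f) (Pow A) (Pow B)" by (rule bij_betw_Pow)
  then show ?thesis using card_of_ordIso by blast
qed

lemma ctwo_cexp: "ctwo ^c r = |Func (Field r) (UNIV :: bool set)|"
  by (simp add: ctwo_def cexp_def Field_card_of)

lemma card_of_Pow_Pow_omega1: "|Pow (Pow (Field omega1))| =o ctwo ^c (ctwo ^c omega1)"
proof -
  have "|Pow (Pow (Field omega1))| =o |Pow (Func (Field omega1) (UNIV :: bool set))|"
    by (rule card_of_Pow_cong[OF card_of_Pow_Func])
  also have "|Pow (Func (Field omega1) (UNIV :: bool set))| =o ctwo ^c (ctwo ^c omega1)"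
    using card_of_Pow_Func by (simp add: ctwo_cexp Field_card_of)
  finally show ?thesis .
qed

lemma Card_order_ctwo_cexp: "Card_order (ctwo ^c r)"
  by (simp add: ctwo_cexp card_of_Card_order)

lemma infinite_Field_beth2: "infinite (Field (ctwo ^c (ctwo ^c omega1)))"
proof -
  have "infinite (Pow (Pow (Field omega1)))" using infinite_Field_omega1 by (simp add: finite_Pow_iff)
  moreover have "|Pow (Pow (Field omega1))| =o |Field (ctwo ^c (ctwo ^c omega1))|"
    using card_of_Pow_Pow_omega1 card_of_Field_ordIso[OF Card_order_ctwo_cexp] ordIso_symmetric ordIso_transitive by blast
  ultimately show ?thesis using card_of_ordIso_finite by blast
qed

lemma beth2_omega1_plus:
  "Card_order beth2_omega1_plus" "regularCard beth2_omega1_plus" "infinite (Field beth2_omega1_plus)"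
  "|Pow (Pow (Field omega1))| <o beth2_omega1_plus"
proof -
  show "Card_order beth2_omega1_plus"
    unfolding beth2_omega1_plus_def by (rule cardSuc_Card_order[OF Card_order_ctwo_cexp])
  show "regularCard beth2_omega1_plus"
    unfolding beth2_omega1_plus_def
    by (rule infinite_cardSuc_regularCard[OF infinite_Field_beth2 Card_order_ctwo_cexp])
  show "infinite (Field beth2_omega1_plus)"
    unfolding beth2_omega1_plus_def
    using cardSuc_finite[OF Card_order_ctwo_cexp] infinite_Field_beth2 by blast
  show "|Pow (Pow (Field omega1))| <o beth2_omega1_plus"
    unfolding beth2_omega1_plus_def
    using card_of_Pow_Pow_omega1 cardSuc_greater[OF Card_order_ctwo_cexp] ordIso_ordLess_trans by blast
qed


section \<open>Nice pairs\<close>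

lemma omega1_bound:
  assumes "countable N" "N \<subseteq> Field omega1"
  shows "\<exists>\<delta> \<in> Field omega1. N \<subseteq> underS omega1 \<delta>"
proof -
  obtain \<delta> where "\<delta> \<in> Field omega1" "\<forall>k \<in> N. (k, \<delta>) \<in> omega1 \<and> k \<noteq> \<delta>"
    using regular_card_bound[OF Card_order_omega1 regularCard_omega1 infinite_Field_omega1 assms(2)
        countable_ordLess_omega1[OF assms(1)]] by blast
  then show ?thesis by (intro bexI[of _ \<delta>]) (auto simp: underS_def)
qed

lemma normal_ideal_singleton:
  assumes J: "normal_ideal omega1 J" and \<alpha>: "\<alpha> \<in> Field omega1"
  shows "{\<alpha>} \<in> J"
proof -
  obtain \<delta> where "\<delta> \<in> Field omega1" "{\<alpha>} \<subseteq> underS omega1 \<delta>" using omega1_bound[of "{\<alpha>}"] \<alpha> by auto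
  then show ?thesis using J unfolding normal_ideal_def by meson
qed

text \<open>Index the sets by a countable subset \<open>range e\<close> of \<open>omega1\<close>,
  with \<open>{}\<close> at the other indices. Beyond a bound \<delta> of that subset, the diagonal
  union contains the plain one.\<close>

lemma normal_ideal_UN:
  fixes F :: "nat \<Rightarrow> nat set set"
  assumes J: "normal_ideal omega1 J" and F: "\<And>n. F n \<in> J"
  shows "(\<Union>n. F n) \<in> J"
proof -
  let ?W = "Field omega1"
  obtain e :: "nat \<Rightarrow> nat set" where e: "inj e" "range e \<subseteq> ?W"
    using infinite_Field_omega1 infinite_countable_subset by blast
  define A where "A \<alpha> = (if \<alpha> \<in> range e then F (inv e \<alpha>) else {})" for \<alpha>
  have "{} \<in> J" and down: "\<And>A B. A \<in> J \<Longrightarrow> B \<subseteq> A \<Longrightarrow> B \<in> J" and un: "\<And>A B. A \<in> J \<Longrightarrow> B \<in> J \<Longrightarrow> A \<union> B \<in> J"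
    and bdd: "\<And>\<alpha>. \<alpha> \<in> ?W \<Longrightarrow> underS omega1 \<alpha> \<in> J" and sub: "J \<subseteq> Pow ?W"
    and diag: "\<And>A. (\<And>\<alpha>. \<alpha> \<in> ?W \<Longrightarrow> A \<alpha> \<in> J) \<Longrightarrow> {\<beta> \<in> ?W. \<exists>\<alpha> \<in> underS omega1 \<beta>. \<beta> \<in> A \<alpha>} \<in> J"
    using J unfolding normal_ideal_def by simp_all
  obtain \<delta> where \<delta>: "\<delta> \<in> ?W" "range e \<subseteq> underS omega1 \<delta>" using omega1_bound[of "range e"] e(2) by auto
  have wo: "wo_rel omega1"
    using Card_order_omega1 unfolding wo_rel_def card_order_on_def by blast
  let ?D = "{\<beta> \<in> ?W. \<exists>\<alpha> \<in> underS omega1 \<beta>. \<beta> \<in> A \<alpha>}"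
  have "A \<alpha> \<in> J" for \<alpha> using F \<open>{} \<in> J\<close> by (simp add: A_def)
  then have "?D \<union> underS omega1 \<delta> \<in> J" using un diag bdd[OF \<delta>(1)] by blast
  moreover have "F n \<subseteq> ?D \<union> underS omega1 \<delta>" for n
  proof
    fix \<beta> assume \<beta>: "\<beta> \<in> F n"
    then have "\<beta> \<in> ?W" using F[of n] sub by blast
    have "A (e n) = F n" using e(1) by (simp add: A_def)
    have "e n \<in> underS omega1 \<delta>" using \<delta>(2) by blast
    show "\<beta> \<in> ?D \<union> underS omega1 \<delta>"
    proof (cases "\<beta> \<in> underS omega1 \<delta>")
      case False
      then have "\<beta> = \<delta> \<or> (\<delta>, \<beta>) \<in> omega1"
        using wo_rel.TOTALS[OF wo] \<delta>(1) \<open>\<beta> \<in> ?W\<close> unfolding underS_def by blast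
      then have "e n \<in> underS omega1 \<beta>"
        using \<open>e n \<in> underS omega1 \<delta>\<close> wo_rel.TRANS[OF wo] wo_rel.ANTISYM[OF wo]
        unfolding underS_def trans_def antisym_def by blast
      then show ?thesis using \<open>A (e n) = F n\<close> \<beta> \<open>\<beta> \<in> ?W\<close> by blast
    qed simp
  qed
  ultimately show ?thesis using down[of "?D \<union> underS omega1 \<delta>" "\<Union>n. F n"] by blast
qed

section \<open>From the forcing relation to systems of ideals\<close>

lemma forced_mem_mono:
  assumes "trans P" "forced_mem P x N p" "(q, p) \<in> P"
  shows "forced_mem P x N q"
  using assms unfolding forced_mem_def by (meson transD)

text \<open>Implication is expressed through negation, so modus ponens yields its conclusion only
  after a further extension.\<close>

lemma forced_imp_top:
  assumes "forced_imp P \<phi> \<psi> one" "(q, one) \<in> P" "\<phi> q"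
  shows "\<exists>r. (r, q) \<in> P \<and> \<psi> r"
  using assms unfolding forced_imp_def forced_not_def forced_and_def by blast

text \<open>\<open>p0\<close> forces the set named by \<open>E\<close> to be nonempty, so below it
  some \<open>f\<close> is forced to be least.\<close>

lemma nice_least:
  assumes P: "Preorder P" and wo: "prewellorder_sentence P F le one"
    and E: "E \<in> subset_names P F" "(f0, p0) \<in> E" and p0: "(p0, one) \<in> P"
  shows "\<exists>f u r. (f, u) \<in> E \<and> (r, u) \<in> P \<and>
    (\<forall>g \<in> F. \<forall>q. (q, r) \<in> P \<longrightarrow> forced_mem P g E q \<longrightarrow> (\<exists>s. (s, q) \<in> P \<and> le f g s))"
proof -
  have refl: "\<And>p. p \<in> Field P \<Longrightarrow> (p, p) \<in> P" and tr: "trans P"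
    using P by (auto simp: preorder_on_def refl_on_def)
  let ?ex = "forced_ex P F (\<lambda>f. forced_mem P f E)"
  let ?min = "\<lambda>f. forced_mem P f E \<^bold>\<and> forced_all F (\<lambda>g. forced_imp P (forced_mem P g E) (le f g))"
  have imp: "forced_imp P ?ex (forced_ex P F ?min) one"
    using wo E(1) unfolding prewellorder_sentence_def forced_and_def forced_all_def by blast
  have "f0 \<in> F" "p0 \<in> Field P" using E by (auto simp: subset_names_def)
  have "forced_mem P f0 E p" if "(p, p0) \<in> P" for p
    unfolding forced_mem_def using E(2) that tr refl by (meson FieldI1 transD)
  then have "?ex p0"
    using \<open>f0 \<in> F\<close> refl unfolding forced_ex_def forced_not_def forced_all_def by (meson FieldI1)
  from forced_imp_top[of P ?ex "forced_ex P F ?min" one p0, OF imp p0 this]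
  obtain r where r: "(r, p0) \<in> P" "forced_ex P F ?min r" by blast
  then obtain f r' where f: "f \<in> F" "(r', r) \<in> P" "?min f r'"
    using refl[of r] unfolding forced_ex_def forced_not_def forced_all_def by (meson FieldI1)
  then have "forced_mem P f E r'" by (simp add: forced_and_def)
  \<comment> \<open>One more extension exhibits the pair of \<open>E\<close> that puts
    \<open>f\<close> into the named set.\<close>
  then obtain s u where s: "(s, r') \<in> P" "(f, u) \<in> E" "(s, u) \<in> P"
    using refl[of r'] f(2) unfolding forced_mem_def by (meson FieldI1)
  have "\<exists>t. (t, q) \<in> P \<and> le f g t" if g: "g \<in> F" "(q, s) \<in> P" "forced_mem P g E q" for g q
  proof -
    have "forced_imp P (forced_mem P g E) (le f g) r'"
      using f(3) g(1) by (simp add: forced_and_def forced_all_def)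
    moreover have "(q, r') \<in> P" using g(2) s(1) tr by (meson transD)
    ultimately show ?thesis using g(3) by (rule forced_imp_top)
  qed
  then show ?thesis using s by blast
qed

text \<open>Positivity for \<open>p\<close> means being forced into \<open>D\<close> by some
  extension. A descending \<open>E\<close> would name a set of functions without a least
  element.\<close>

theorem nice_ideal_system:
  assumes nice: "nice_to P one D beth2_omega1_plus"
  shows "ideal_system P (J_ideal P (Field omega1) D) (Field omega1) beth2_omega1_plus"
proof -
  let ?W = "Field omega1" and ?\<kappa> = beth2_omega1_plus
  let ?J = "J_ideal P ?W D"
  have pre: "pre_nice P one D" using nice by (simp add: nice_to_def)
  then have P: "Preorder P" "one \<in> Field P" and one: "\<And>p. p \<in> Field P \<Longrightarrow> (p, one) \<in> P"
    by (auto simp: pre_nice_def notion_of_forcing_def)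
  have refl: "\<And>p. p \<in> Field P \<Longrightarrow> (p, p) \<in> P" and tr: "trans P"
    using P(1) by (auto simp: preorder_on_def refl_on_def)
  have normal: "normal_ideal omega1 (?J p)" if "p \<in> Field P" for p
    using pre that by (simp add: pre_nice_def)
  have uf: "ultrafilter_sentence P ?W D one"
    using pre by (simp add: pre_nice_def ultrafilter_name_def)
  have mono: "?J p \<subseteq> ?J q" if "(q, p) \<in> P" for p q
    using that tr unfolding J_ideal_def forced_not_def by (auto dest: transD)
  \<comment> \<open>A condition forcing \<open>A\<close> into the ultrafilter forces the complement
    out, since their intersection is empty. This yields \<open>J_extend\<close>.\<close>
  have disj: "W' \<in> ?J q" if W': "W' = ?W - A" "A \<subseteq> ?W" and q: "forced_mem P A D q" "q \<in> Field P" for A W' q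
  proof -
    have "\<not> forced_mem P W' D r" if r: "(r, q) \<in> P" for r
    proof
      assume "forced_mem P W' D r"
      then have both: "(forced_mem P A D \<^bold>\<and> forced_mem P W' D) r"
        using forced_mem_mono[OF tr q(1) r] by (simp add: forced_and_def)
      have "forced_imp P (forced_mem P A D \<^bold>\<and> forced_mem P W' D) (forced_mem P (A \<inter> W') D) one"
        using uf W' unfolding ultrafilter_sentence_def forced_and_def[abs_def] forced_all_def by blast
      moreover have "r \<in> Field P" using r by (auto simp: Field_def)
      ultimately obtain s where s: "(s, r) \<in> P" "forced_mem P (A \<inter> W') D s"
        using forced_imp_top[of P "forced_mem P A D \<^bold>\<and> forced_mem P W' D" "forced_mem P (A \<inter> W') D" one r]
          one both by blast
      have "A \<inter> W' = {}" using W'(1) by blast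
      moreover have "forced_not P (forced_mem P {} D) one"
        using uf by (simp add: ultrafilter_sentence_def forced_and_def)
      moreover have "(s, one) \<in> P" using s(1) one by (auto simp: Field_def)
      ultimately show False using s(2) by (auto simp: forced_not_def)
    qed
    then show ?thesis using W' by (auto simp: J_ideal_def forced_not_def)
  qed
  show ?thesis
  proof unfold_locales
    show "Preorder P" "Field P \<noteq> {}" using P by auto
    show "A \<subseteq> ?W" if "p \<in> Field P" "A \<in> ?J p" for p A using that by (simp add: J_ideal_def)
    show "B \<in> ?J p" if "p \<in> Field P" "A \<in> ?J p" "B \<subseteq> A" for p A B
      using normal[OF that(1)] that(2,3) unfolding normal_ideal_def by meson
    show "(\<Union>n. F n) \<in> ?J p" if "p \<in> Field P" "\<And>n :: nat. F n \<in> ?J p" for p F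
      by (rule normal_ideal_UN[OF normal[OF that(1)] that(2)])
    show "?W \<notin> ?J p" if "p \<in> Field P" for p
      using normal[OF that] by (simp add: normal_ideal_def)
    show "{\<alpha>} \<in> ?J p" if "p \<in> Field P" "\<alpha> \<in> ?W" for p \<alpha>
      by (rule normal_ideal_singleton[OF normal[OF that(1)] that(2)])
    show "?J p \<subseteq> ?J q" if "(q, p) \<in> P" for p q by (rule mono[OF that])
    show "\<exists>q. (q, p) \<in> P \<and> ?W - A \<in> ?J q" if A: "p \<in> Field P" "A \<subseteq> ?W" "A \<notin> ?J p" for p A
    proof -
      obtain q where q: "(q, p) \<in> P" "forced_mem P A D q"
        using A(2,3) by (auto simp: J_ideal_def forced_not_def)
      then have "q \<in> Field P" by (auto simp: Field_def)
      then show ?thesis using disj[OF HOL.refl A(2) q(2)] q(1) by blast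
    qed
    show "Card_order ?\<kappa>" "regularCard ?\<kappa>" "infinite (Field ?\<kappa>)" "|Pow (Pow ?W)| <o ?\<kappa>"
      by (rule beth2_omega1_plus)+
    fix E :: "((nat set \<Rightarrow> ((nat set \<Rightarrow> bool) \<Rightarrow> bool) set) \<times> 'a) set"
    assume ne: "E \<noteq> {}" and sub: "E \<subseteq> (?W \<rightarrow> Field ?\<kappa>) \<times> Field P"
    let ?bad = "\<lambda>f f'. {\<alpha> \<in> ?W. \<not> ((f' \<alpha>, f \<alpha>) \<in> ?\<kappa> \<and> f' \<alpha> \<noteq> f \<alpha>)}"
    show "\<exists>f p q. (f, p) \<in> E \<and> (q, p) \<in> P \<and> (\<forall>f' q'. (f', q') \<in> E \<longrightarrow> (q', q) \<in> P \<longrightarrow> ?bad f f' \<notin> ?J q')"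
    proof (rule ccontr)
      assume "\<not> ?thesis"
      then have descend: "\<exists>f' q'. (f', q') \<in> E \<and> (q', q) \<in> P \<and> ?bad f f' \<in> ?J q'"
        if "(f, p) \<in> E" "(q, p) \<in> P" for f p q
        using that by meson
      \<comment> \<open>\<open>E\<close> itself, with its functions made extensional, serves as a
        name.\<close>
      define N where "N = (\<lambda>(f, p). (restrict f ?W, p)) ` E"
      let ?F = "?W \<rightarrow>\<^sub>E Field ?\<kappa>"
      have fn: "restrict f ?W \<in> ?F \<and> p \<in> Field P" if "(f, p) \<in> E" for f p
        using that sub by (auto simp: subset_iff)
      then have N: "N \<in> subset_names P ?F" unfolding N_def subset_names_def by fast
      obtain f0 p0 where 0: "(f0, p0) \<in> E" using ne by auto
      then have 0: "(restrict f0 ?W, p0) \<in> N" "(p0, one) \<in> P" using one fn by (auto simp: N_def image_iff intro!: bexI[of _ "(f0, p0)"])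
      have wo: "prewellorder_sentence P ?F (le_sentence P ?W ?\<kappa> D) one"
        using nice unfolding nice_to_def by (rule conjunct2)
      from nice_least[OF P(1) wo N 0]
      obtain h u r where h: "(h, u) \<in> N" "(r, u) \<in> P"
        and least: "\<forall>g \<in> ?F. \<forall>q. (q, r) \<in> P \<longrightarrow> forced_mem P g N q \<longrightarrow>
          (\<exists>s. (s, q) \<in> P \<and> le_sentence P ?W ?\<kappa> D h g s)"
        by (elim exE conjE) (rule that)
      obtain f where f: "(f, u) \<in> E" "h = restrict f ?W" using h(1) by (auto simp: N_def)
      obtain f' q where q: "(f', q) \<in> E" "(q, r) \<in> P" "?bad f f' \<in> ?J q"
        using descend[OF f(1) h(2)] by blast
      let ?g = "restrict f' ?W"
      have g: "?g \<in> ?F" "(?g, q) \<in> N"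
        using q(1) fn by (auto simp: N_def image_iff intro!: bexI[of _ "(f', q)"])
      have "(q, q) \<in> P" using q(2) refl by (auto simp: Field_def)
      then have "forced_mem P ?g N q"
        unfolding forced_mem_def using g(2) refl by (meson FieldI1)
      with least g(1) q(2) obtain s where s: "(s, q) \<in> P"
        "forced_mem P {\<alpha> \<in> ?W. (h \<alpha>, ?g \<alpha>) \<in> ?\<kappa>} D s"
        unfolding le_sentence_def by meson
      have anti: "antisym ?\<kappa>"
        using beth2_omega1_plus(1) card_order_on_well_order_on by (auto simp: order_on_defs)
      \<comment> \<open>Where \<open>h\<close> is at most \<open>?g\<close>, antisymmetry keeps
        \<open>f'\<close> from being strictly below \<open>f\<close>; so leastness of
        \<open>h\<close> contradicts the descent.\<close>
      have "{\<alpha> \<in> ?W. (h \<alpha>, ?g \<alpha>) \<in> ?\<kappa>} \<subseteq> ?bad f f'"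
        using antisymD[OF anti] by (auto simp: f(2))
      moreover have "q \<in> Field P" using q(2) by (auto simp: Field_def)
      ultimately have "{\<alpha> \<in> ?W. (h \<alpha>, ?g \<alpha>) \<in> ?\<kappa>} \<in> ?J q"
        using normal[of q] q(3) unfolding normal_ideal_def by meson
      then show False using s by (auto simp: J_ideal_def forced_not_def)
    qed
  qed
qed


section \<open>Ramsey cardinals\<close>

locale ramsey_cardinal =
  fixes \<mu> :: "'r rel"
  assumes Ramsey: "Ramsey_cardinal \<mu>"
begin

abbreviation below_in :: "'r \<Rightarrow> 'r \<Rightarrow> bool"  (infix \<open>\<sqsubset>\<close> 50)
  where "x \<sqsubset> y \<equiv> (x, y) \<in> \<mu> - Id"

lemma Card_order: "Card_order \<mu>" and natLeq_less: "natLeq <o \<mu>"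
  using Ramsey by (simp_all add: Ramsey_cardinal_def)

lemma wo: "wo_rel \<mu>"
  using Card_order unfolding wo_rel_def card_order_on_def by blast

lemma below_trans: "x \<sqsubset> y \<Longrightarrow> y \<sqsubset> z \<Longrightarrow> x \<sqsubset> z"
  using wo_rel.TRANS[OF wo] wo_rel.ANTISYM[OF wo] by (auto dest: transD antisymD)

lemma below_irrefl: "\<not> x \<sqsubset> x"
  by simp

lemma below_total: "x \<in> Field \<mu> \<Longrightarrow> y \<in> Field \<mu> \<Longrightarrow> x \<noteq> y \<Longrightarrow> x \<sqsubset> y \<or> y \<sqsubset> x"
  using wo_rel.TOTALS[OF wo] by auto

lemma wf_below: "wf (\<mu> - Id)"
  by (rule wo_rel.WF[OF wo])

lemma infinite_Field: "infinite (Field \<mu>)"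
proof
  assume "finite (Field \<mu>)"
  then have "|Field \<mu>| <o natLeq" using finite_iff_ordLess_natLeq by blast
  then show False
    using card_of_Field_ordIso[OF Card_order] natLeq_less not_ordLess_ordLeq ordLess_imp_ordLeq
      ordIso_ordLess_trans ordIso_symmetric by metis
qed

lemma finite_ordLess: "finite A \<Longrightarrow> |A| <o \<mu>"
  using finite_iff_ordLess_natLeq natLeq_less ordLess_transitive by blast

definition large :: "'r set \<Rightarrow> bool"
  where "large H \<longleftrightarrow> H \<subseteq> Field \<mu> \<and> |H| =o \<mu>"

lemma large_not_ordLess: "large H \<Longrightarrow> \<not> |H| <o \<mu>"
  using not_ordLess_ordIso unfolding large_def by blast

lemma homogeneous: "\<exists>H. large H \<and> (\<forall>n. \<forall>a \<in> [H]\<^bsup>n\<^esup>. \<forall>b \<in> [H]\<^bsup>n\<^esup>. (c :: 'r set \<Rightarrow> bool) a = c b)"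
proof -
  have "\<exists>H \<subseteq> Field \<mu>. |H| =o \<mu> \<and> (\<forall>n. \<forall>a \<in> [H]\<^bsup>n\<^esup>. \<forall>b \<in> [H]\<^bsup>n\<^esup>. c a = c b)"
    using Ramsey unfolding Ramsey_cardinal_def by (elim conjE allE[of _ c])
  then show ?thesis unfolding large_def by (elim exE conjE) (intro exI conjI)
qed

text \<open>A bound would confine \<open>H\<close> to a proper initial segment and one more point,
  which is too small.\<close>

lemma large_unbounded:
  assumes H: "large H" and h: "h \<in> H"
  shows "\<exists>h' \<in> H. h \<sqsubset> h'"
proof (rule ccontr)
  assume none: "\<not> ?thesis"
  have "h' \<in> underS \<mu> h \<union> {h}" if h': "h' \<in> H" for h'
  proof -
    have "h' \<in> Field \<mu>" "h \<in> Field \<mu>" using H h h' unfolding large_def by blast+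
    then show ?thesis using below_total[of h' h] none h' by (auto simp: underS_def)
  qed
  then have sub: "H \<subseteq> underS \<mu> h \<union> {h}" by blast
  have "h \<in> Field \<mu>" using H h unfolding large_def by blast
  then have "|underS \<mu> h \<union> {h}| <o \<mu>"
    using card_of_Un_ordLess_infinite_Field[OF infinite_Field Card_order card_of_underS[OF Card_order]]
      finite_ordLess[of "{h}"] by blast
  then have "|H| <o \<mu>" using card_of_mono1[OF sub] ordLeq_ordLess_trans by blast
  then show False using large_not_ordLess[OF H] by blast
qed

definition nxt :: "'r set \<Rightarrow> 'r \<Rightarrow> 'r"
  where "nxt H h = (SOME h'. h' \<in> H \<and> h \<sqsubset> h' \<and> (\<forall>h'' \<in> H. h \<sqsubset> h'' \<longrightarrow> \<not> h'' \<sqsubset> h'))"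

lemma nxt:
  assumes H: "large H" and h: "h \<in> H"
  shows "nxt H h \<in> H" "h \<sqsubset> nxt H h" "h' \<in> H \<Longrightarrow> h \<sqsubset> h' \<Longrightarrow> h' = nxt H h \<or> nxt H h \<sqsubset> h'"
proof -
  obtain h0 where h0: "h0 \<in> {h' \<in> H. h \<sqsubset> h'}" using large_unbounded[OF H h] by blast
  obtain h1 where "h1 \<in> {h' \<in> H. h \<sqsubset> h'}" "\<And>y. (y, h1) \<in> \<mu> - Id \<Longrightarrow> y \<notin> {h' \<in> H. h \<sqsubset> h'}"
    by (rule wfE_min[OF wf_below h0]) (rule that)
  then have "\<exists>h'. h' \<in> H \<and> h \<sqsubset> h' \<and> (\<forall>h'' \<in> H. h \<sqsubset> h'' \<longrightarrow> \<not> h'' \<sqsubset> h')" by blast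
  from someI_ex[OF this, folded nxt_def]
  have n: "nxt H h \<in> H" "h \<sqsubset> nxt H h" "\<And>h''. h'' \<in> H \<Longrightarrow> h \<sqsubset> h'' \<Longrightarrow> \<not> h'' \<sqsubset> nxt H h" by blast+
  show "nxt H h \<in> H" "h \<sqsubset> nxt H h" by (rule n)+
  show "h' = nxt H h \<or> nxt H h \<sqsubset> h'" if "h' \<in> H" "h \<sqsubset> h'"
    using n(3)[OF that] below_total[of h' "nxt H h"] that n(1) H unfolding large_def by blast
qed

text \<open>Finite increasing tuples are treated as initial parts of infinite increasing sequences;
  \<open>seq\<close> supplies such a sequence from any starting point.\<close>

definition incr :: "'r set \<Rightarrow> (nat \<Rightarrow> 'r) \<Rightarrow> bool"
  where "incr H a \<longleftrightarrow> (\<forall>n. a n \<in> H \<and> a n \<sqsubset> a (Suc n))"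

lemma incr_less: "incr H a \<Longrightarrow> m < n \<Longrightarrow> a m \<sqsubset> a n"
proof (induction n)
  case (Suc n)
  have "a n \<sqsubset> a (Suc n)" using Suc.prems(1) by (simp add: incr_def)
  then show ?case using Suc below_trans by (metis less_antisym)
qed simp

lemma incr_inj: "incr H a \<Longrightarrow> inj a"
  using incr_less below_irrefl by (intro injI) (metis linorder_neqE_nat)

lemma incr_less_iff: "incr H a \<Longrightarrow> a m \<sqsubset> a n \<longleftrightarrow> m < n"
  using incr_less[of H a m n] incr_less[of H a n m] below_trans below_irrefl
  by (metis linorder_neqE_nat)

lemma incr_nsets: "incr H a \<Longrightarrow> a ` {..<m} \<in> [H]\<^bsup>m\<^esup>"
  using incr_inj[of H a] by (auto simp: nsets_def incr_def card_image inj_on_subset)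

definition seq :: "'r set \<Rightarrow> 'r \<Rightarrow> nat \<Rightarrow> 'r"
  where "seq H h n = (nxt H ^^ n) h"

lemma seq_simps: "seq H h 0 = h" "seq H h (Suc n) = nxt H (seq H h n)"
  by (simp_all add: seq_def)

lemma seq_mem: "large H \<Longrightarrow> h \<in> H \<Longrightarrow> seq H h n \<in> H"
  by (induction n) (simp_all add: seq_simps nxt(1))

lemma incr_seq: "large H \<Longrightarrow> h \<in> H \<Longrightarrow> incr H (seq H h)"
  using seq_mem nxt(2) by (auto simp: incr_def seq_simps)

definition splice :: "nat \<Rightarrow> (nat \<Rightarrow> 'r) \<Rightarrow> (nat \<Rightarrow> 'r) \<Rightarrow> nat \<Rightarrow> 'r"
  where "splice k a b i = (if i \<le> k then a i else b (i - Suc k))"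

lemma incr_splice:
  assumes "incr H a" "incr H b" "a k \<sqsubset> b 0"
  shows "incr H (splice k a b)"
  unfolding incr_def
proof
  fix n
  consider "n < k" | "n = k" | "k < n" by linarith
  then show "splice k a b n \<in> H \<and> splice k a b n \<sqsubset> splice k a b (Suc n)"
  proof cases
    case 3
    then have "Suc n - Suc k = Suc (n - Suc k)" by simp
    then show ?thesis using 3 assms(2) by (simp add: splice_def incr_def)
  qed (use assms in \<open>simp_all add: splice_def incr_def\<close>)
qed

lemma incr_Cons:
  assumes "x \<in> H" "incr H a" "x \<sqsubset> a 0"
  shows "incr H (case_nat x a)"
  using assms by (auto simp: incr_def split: nat.split)

text \<open>Colourings only see sets; counting predecessors recovers the increasing
  enumeration.\<close>

definition nth_of :: "'r set \<Rightarrow> nat \<Rightarrow> 'r"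
  where "nth_of B i = (THE b. b \<in> B \<and> card {b' \<in> B. b' \<sqsubset> b} = i)"

lemma nth_of_incr:
  assumes a: "incr H a" and i: "i < m"
  shows "nth_of (a ` {..<m}) i = a i"
proof -
  have card: "card {b' \<in> a ` {..<m}. b' \<sqsubset> a k} = k" if "k < m" for k
  proof -
    have "{b' \<in> a ` {..<m}. b' \<sqsubset> a k} = a ` {..<k}"
      using incr_less_iff[OF a] that by (auto simp del: Diff_iff)
    then show ?thesis using incr_inj[OF a] by (simp add: card_image inj_on_subset)
  qed
  show ?thesis
    unfolding nth_of_def
  proof (rule the_equality)
    show "a i \<in> a ` {..<m} \<and> card {b' \<in> a ` {..<m}. b' \<sqsubset> a i} = i" using card[OF i] i by simp
    fix b assume b: "b \<in> a ` {..<m} \<and> card {b' \<in> a ` {..<m}. b' \<sqsubset> b} = i"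
    then obtain k where k: "k < m" "b = a k" by blast
    then have "k = i" using card[OF k(1)] b by (simp only: k(2))
    then show "b = a i" using k(2) by simp
  qed
qed

text \<open>
  Were \<open>\<mu>\<close> at most \<open>2 ^ |A|\<close>, consider, for \<open>x \<sqsubset> y \<sqsubset> z\<close> in a set of subsets of \<open>A\<close>, whether the
  first difference of \<open>x\<close> and \<open>y\<close> comes before the one of \<open>y\<close> and \<open>z\<close>.
\<close>

lemma strong_limit:
  fixes A :: "'a set"
  assumes A: "|A| <o \<mu>"
  shows "|Pow A| <o \<mu>"
proof (rule ccontr)
  assume "\<not> ?thesis"
  then have "\<mu> \<le>o |Pow A|"
    using ordLess_or_ordLeq card_of_Well_order wo unfolding wo_rel_def by blast
  then have "|Field \<mu>| \<le>o |Pow A|"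
    using card_of_Field_ordIso[OF Card_order] ordIso_ordLeq_trans by blast
  then obtain h where h: "inj_on h (Field \<mu>)" "h ` Field \<mu> \<subseteq> Pow A"
    using card_of_ordLeq[of "Field \<mu>" "Pow A"] by auto
  have woA: "wo_rel |A|" by (simp add: wo_rel_def card_of_Well_order)
  have tot: "\<gamma> = \<delta> \<or> (\<gamma>, \<delta>) \<in> |A| - Id \<or> (\<delta>, \<gamma>) \<in> |A| - Id" if "\<gamma> \<in> A" "\<delta> \<in> A" for \<gamma> \<delta>
    using wo_rel.TOTALS[OF woA] that by (auto simp: Field_card_of)
  have wfA: "wf ( |A| - Id)" by (rule wo_rel.WF[OF woA])
  have asym: "(\<delta>, \<gamma>) \<notin> |A| - Id" if "(\<gamma>, \<delta>) \<in> |A| - Id" for \<gamma> \<delta>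
    using wf_not_sym[OF wfA that] .
  have tr: "(\<gamma>, \<epsilon>) \<in> |A| - Id" if "(\<gamma>, \<delta>) \<in> |A| - Id" "(\<delta>, \<epsilon>) \<in> |A| - Id" for \<gamma> \<delta> \<epsilon>
    using that wo_rel.TRANS[OF woA] wo_rel.ANTISYM[OF woA] by (auto dest: transD antisymD)
  define first where "first x y \<delta> \<longleftrightarrow> \<delta> \<in> A \<and> (\<delta> \<in> h x) \<noteq> (\<delta> \<in> h y) \<and>
      (\<forall>\<gamma> \<in> A. (\<gamma>, \<delta>) \<in> |A| - Id \<longrightarrow> (\<gamma> \<in> h x) = (\<gamma> \<in> h y))" for x y \<delta>
  have first_unique: "\<gamma> = \<delta>" if "first x y \<gamma>" "first x y \<delta>" for x y \<gamma> \<delta>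
    using that tot[of \<gamma> \<delta>] unfolding first_def by blast
  define \<Delta> where "\<Delta> x y = (SOME \<delta>. first x y \<delta>)" for x y
  have \<Delta>: "first x y (\<Delta> x y)" if "x \<in> Field \<mu>" "y \<in> Field \<mu>" "x \<noteq> y" for x y
  proof -
    have "h x \<noteq> h y" using inj_onD[OF h(1) _ that(1,2)] that(3) by blast
    moreover have "h x \<subseteq> A" "h y \<subseteq> A" using h(2) that(1,2) by (simp_all add: image_subset_iff)
    ultimately obtain \<gamma> where \<gamma>: "\<gamma> \<in> {\<gamma> \<in> A. (\<gamma> \<in> h x) \<noteq> (\<gamma> \<in> h y)}" by blast
    obtain \<delta> where "\<delta> \<in> {\<gamma> \<in> A. (\<gamma> \<in> h x) \<noteq> (\<gamma> \<in> h y)}"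
        "\<And>\<gamma>. (\<gamma>, \<delta>) \<in> |A| - Id \<Longrightarrow> \<gamma> \<notin> {\<gamma> \<in> A. (\<gamma> \<in> h x) \<noteq> (\<gamma> \<in> h y)}"
      by (rule wfE_min[OF wfA \<gamma>]) (rule that)
    then have "first x y \<delta>" unfolding first_def by blast
    then show ?thesis unfolding \<Delta>_def by (rule someI)
  qed
  have \<Delta>_eq: "\<Delta> x y = \<delta>" if "x \<in> Field \<mu>" "y \<in> Field \<mu>" "x \<noteq> y" "first x y \<delta>" for x y \<delta>
    using first_unique[OF \<Delta>[OF that(1-3)] that(4)] .
  obtain H where H: "large H" and hom: "\<And>m a b. a \<in> [H]\<^bsup>m\<^esup> \<Longrightarrow> b \<in> [H]\<^bsup>m\<^esup> \<Longrightarrow>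
      ((\<Delta> (nth_of a 0) (nth_of a 1), \<Delta> (nth_of a 1) (nth_of a 2)) \<in> |A| - Id) =
      ((\<Delta> (nth_of b 0) (nth_of b 1), \<Delta> (nth_of b 1) (nth_of b 2)) \<in> |A| - Id)"
    using homogeneous[of "\<lambda>a. (\<Delta> (nth_of a 0) (nth_of a 1), \<Delta> (nth_of a 1) (nth_of a 2)) \<in> |A| - Id"]
    by blast
  have fld: "x \<in> Field \<mu>" if "x \<in> H" for x using H that unfolding large_def by blast
  have triple: "\<exists>B \<in> [H]\<^bsup>3\<^esup>. nth_of B 0 = x \<and> nth_of B 1 = y \<and> nth_of B 2 = z"
    if "x \<in> H" "y \<in> H" "z \<in> H" "x \<sqsubset> y" "y \<sqsubset> z" for x y z
  proof -
    let ?a = "case_nat x (case_nat y (seq H z))"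
    have a: "incr H ?a"
      using that incr_seq[OF H] by (intro incr_Cons) (simp_all add: seq_simps)
    have "nth_of (?a ` {..<3}) 0 = x" "nth_of (?a ` {..<3}) 1 = y" "nth_of (?a ` {..<3}) 2 = z"
      using nth_of_incr[OF a, of 0 3] nth_of_incr[OF a, of 1 3] nth_of_incr[OF a, of 2 3]
      by (simp_all add: seq_simps numeral_2_eq_2)
    then show ?thesis using incr_nsets[OF a, of 3] by blast
  qed
  have same: "((\<Delta> x y, \<Delta> y z) \<in> |A| - Id) = ((\<Delta> x' y', \<Delta> y' z') \<in> |A| - Id)"
    if xyz: "x \<in> H" "y \<in> H" "z \<in> H" "x \<sqsubset> y" "y \<sqsubset> z" and xyz': "x' \<in> H" "y' \<in> H" "z' \<in> H" "x' \<sqsubset> y'" "y' \<sqsubset> z'"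
    for x y z x' y' z'
  proof -
    obtain B where B: "B \<in> [H]\<^bsup>3\<^esup>" "nth_of B 0 = x" "nth_of B 1 = y" "nth_of B 2 = z"
      using triple[OF xyz] by (elim bexE conjE)
    obtain B' where B': "B' \<in> [H]\<^bsup>3\<^esup>" "nth_of B' 0 = x'" "nth_of B' 1 = y'" "nth_of B' 2 = z'"
      using triple[OF xyz'] by (elim bexE conjE)
    show ?thesis using hom[OF B(1) B'(1)] unfolding B B' .
  qed
  define v where "v \<longleftrightarrow> (\<exists>x \<in> H. \<exists>y \<in> H. \<exists>z \<in> H. x \<sqsubset> y \<and> y \<sqsubset> z \<and> (\<Delta> x y, \<Delta> y z) \<in> |A| - Id)"
  have v: "((\<Delta> x y, \<Delta> y z) \<in> |A| - Id) = v"
    if "x \<in> H" "y \<in> H" "z \<in> H" "x \<sqsubset> y" "y \<sqsubset> z" for x y z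
    unfolding v_def using same[OF that] that by (intro iffI bexI conjI) (assumption+, elim bexE conjE, metis)
  show False
  proof (cases v)
    case True
    \<comment> \<open>Here first differences increase along \<open>H\<close>, so
      \<open>\<Delta> x y\<close> depends only on \<open>x\<close>; as a function of
      \<open>x\<close> it embeds \<open>H\<close> into \<open>A\<close>.\<close>
    define D where "D x = \<Delta> x (nxt H x)" for x
    have D: "\<Delta> x y = D x" if xy: "x \<in> H" "y \<in> H" "x \<sqsubset> y" for x y
    proof (cases "y = nxt H x")
      case False
      let ?n = "nxt H x"
      have n: "?n \<in> H" "x \<sqsubset> ?n" "?n \<sqsubset> y" using nxt[OF H xy(1)] xy False by blast+
      have lt: "(\<Delta> x ?n, \<Delta> ?n y) \<in> |A| - Id" using v[OF xy(1) n(1) xy(2) n(2,3)] True by simp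
      have 1: "first x ?n (\<Delta> x ?n)" using \<Delta>[of x ?n] n xy fld by blast
      have 2: "first ?n y (\<Delta> ?n y)" using \<Delta>[of ?n y] n xy fld by blast
      have "(\<gamma> \<in> h ?n) = (\<gamma> \<in> h y)" if "\<gamma> \<in> A" "\<gamma> = \<Delta> x ?n \<or> (\<gamma>, \<Delta> x ?n) \<in> |A| - Id" for \<gamma>
        using 2 that lt tr unfolding first_def by blast
      then have "first x y (\<Delta> x ?n)" using 1 unfolding first_def by auto
      then show ?thesis using \<Delta>_eq[of x y] xy fld unfolding D_def by blast
    qed (simp add: D_def)
    have less: "(D x, D y) \<in> |A| - Id" if "x \<in> H" "y \<in> H" "x \<sqsubset> y" for x y
      using v[of x y "nxt H y"] D[of x y] that nxt[OF H, of y] True unfolding D_def by auto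
    have "inj_on D H"
    proof (rule inj_onI)
      fix x y assume "x \<in> H" "y \<in> H" "D x = D y"
      then show "x = y" using less[of x y] less[of y x] below_total[of x y] fld by auto
    qed
    moreover have "D ` H \<subseteq> A"
      using \<Delta> nxt[OF H] fld unfolding D_def first_def by blast
    ultimately have "|H| \<le>o |A|" using card_of_ordLeq[of H A] by blast
    then show False using A large_not_ordLess[OF H] ordLeq_ordLess_trans by blast
  next
    case False
    \<comment> \<open>Here first differences never increase, so the least one, \<delta>, persists
      for later pairs. Three sets would then disagree pairwise about containing \<delta>.\<close>
    define N where "N = {\<Delta> x y |x y. x \<in> H \<and> y \<in> H \<and> x \<sqsubset> y}"
    have "H \<noteq> {}" using finite_ordLess[of "{}"] large_not_ordLess[OF H] by auto
    then obtain x0 where "x0 \<in> H" by blast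
    then have x0: "\<Delta> x0 (nxt H x0) \<in> N" using nxt[OF H] unfolding N_def by blast
    obtain \<delta> where \<delta>: "\<delta> \<in> N" "\<And>\<gamma>. (\<gamma>, \<delta>) \<in> |A| - Id \<Longrightarrow> \<gamma> \<notin> N"
      by (rule wfE_min[OF wfA x0]) (rule that)
    then obtain x y where xy: "x \<in> H" "y \<in> H" "x \<sqsubset> y" "\<Delta> x y = \<delta>" unfolding N_def by blast
    have NA: "\<gamma> \<in> A" if "\<gamma> \<in> N" for \<gamma>
      using that \<Delta> fld unfolding N_def first_def by blast
    have const: "\<Delta> b c = \<delta>" if abc: "a \<in> H" "b \<in> H" "c \<in> H" "a \<sqsubset> b" "b \<sqsubset> c" "\<Delta> a b = \<delta>" for a b c
    proof -
      have "(\<delta>, \<Delta> b c) \<notin> |A| - Id" using v[OF abc(1-5)] abc(6) False by simp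
      moreover have "\<Delta> b c \<in> N" using abc unfolding N_def by blast
      ultimately show ?thesis using \<delta> tot[of "\<Delta> b c" \<delta>] NA by blast
    qed
    let ?z = "nxt H y"
    let ?w = "nxt H ?z"
    have z: "?z \<in> H" "y \<sqsubset> ?z" and w: "?w \<in> H" "?z \<sqsubset> ?w"
      using nxt[OF H xy(2)] nxt[OF H, of ?z] by blast+
    have "\<Delta> y ?z = \<delta>" using const[OF xy(1,2) z(1) xy(3) z(2) xy(4)] .
    moreover from this have "\<Delta> ?z ?w = \<delta>" using const[OF xy(2) z(1) w(1) z(2) w(2)] by blast
    moreover have "\<Delta> y ?w = \<delta>" using const[OF xy(1,2) w(1) xy(3) below_trans[OF z(2) w(2)] xy(4)] .
    ultimately have "first y ?z \<delta>" "first ?z ?w \<delta>" "first y ?w \<delta>"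
      using \<Delta>[of y ?z] \<Delta>[of ?z ?w] \<Delta>[of y ?w] xy z w fld below_trans[OF z(2) w(2)] by auto
    then show False unfolding first_def by blast
  qed
qed

end


subsection \<open>Hulls which omit a small ordinal\<close>

text \<open>Terms in countably many finitary operations. As there are only countably many, an
  element of a hull is given by a number and a finite tuple.\<close>

datatype hull_term = Var nat | App nat "hull_term list"

instance hull_term :: countable
  by countable_datatype

primrec eval_term :: "(nat \<Rightarrow> 'a list \<Rightarrow> 'a) \<Rightarrow> (nat \<Rightarrow> 'a) \<Rightarrow> hull_term \<Rightarrow> 'a"
  where "eval_term F e (Var i) = e i"
  | "eval_term F e (App n ts) = F n (map (eval_term F e) ts)"

section \<open>Hulls of homogeneous sets\<close>

context ramsey_cardinal
begin

text \<open>Values outside \<open>Field \<mu>\<close> count as undefined, so that hulls stay inside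
  the cardinal.\<close>

inductive_set generated :: "(nat \<Rightarrow> 'r list \<Rightarrow> 'r) \<Rightarrow> 'r set \<Rightarrow> 'r set" for F A
  where base: "a \<in> A \<Longrightarrow> a \<in> generated F A"
  | step: "(\<And>y. y \<in> set ys \<Longrightarrow> y \<in> generated F A) \<Longrightarrow> F n ys \<in> Field \<mu> \<Longrightarrow> F n ys \<in> generated F A"

lemma generated_mono:
  assumes "A \<subseteq> B"
  shows "generated F A \<subseteq> generated F B"
proof
  fix y assume "y \<in> generated F A"
  then show "y \<in> generated F B" by induction (use assms in \<open>auto intro: generated.intros\<close>)
qed

lemma generated_subset_Field: "A \<subseteq> Field \<mu> \<Longrightarrow> generated F A \<subseteq> Field \<mu>"
proof
  fix y assume "A \<subseteq> Field \<mu>" "y \<in> generated F A"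
  then show "y \<in> Field \<mu>" by (induction rule: generated.induct[OF \<open>y \<in> generated F A\<close>]) auto
qed

lemma generated_finite_support:
  assumes "y \<in> generated F A"
  shows "\<exists>B. finite B \<and> B \<subseteq> A \<and> y \<in> generated F B"
  using assms
proof induction
  case (base a)
  then show ?case by (intro exI[of _ "{a}"]) (auto intro: generated.base)
next
  case (step ys n)
  have "\<forall>y \<in> set ys. \<exists>B. finite B \<and> B \<subseteq> A \<and> y \<in> generated F B" using step.IH by blast
  from bchoice[OF this] obtain B where B: "\<forall>y \<in> set ys. finite (B y) \<and> B y \<subseteq> A \<and> y \<in> generated F (B y)" by blast
  let ?B = "\<Union>y \<in> set ys. B y"
  have "y \<in> generated F ?B" if "y \<in> set ys" for y
    using generated_mono[of "B y" ?B F] B that by blast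
  then have "F n ys \<in> generated F ?B" using step.hyps(2) by (rule generated.step)
  then show ?case using B by (intro exI[of _ ?B]) auto
qed

lemma generated_eval_term:
  assumes "y \<in> generated F (e ` I)"
  shows "\<exists>t. eval_term F e t = y"
  using assms
proof induction
  case (base a)
  then obtain i where "a = e i" by blast
  then show ?case by (intro exI[of _ "Var i"]) simp
next
  case (step ys n)
  have "\<forall>y \<in> set ys. \<exists>t. eval_term F e t = y" using step.IH by blast
  from bchoice[OF this] obtain g where "\<forall>y \<in> set ys. eval_term F e (g y) = y" by blast
  then have "map (eval_term F e) (map g ys) = ys" by (simp add: map_idI)
  then show ?case by (intro exI[of _ "App n (map g ys)"]) simp
qed

text \<open>Induction on the size: the largest element \<open>m\<close> is appended by splicing
  \<open>seq H m\<close> behind the enumeration of the others.\<close>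

lemma ex_incr_enumeration:
  assumes H: "large H" and A: "finite A" "A \<subseteq> H"
  shows "\<exists>a n. incr H a \<and> A = a ` {..<n}"
  using A
proof (induction "card A" arbitrary: A)
  case 0
  have "H \<noteq> {}" using finite_ordLess[of "{}"] large_not_ordLess[OF H] by auto
  then obtain h where "h \<in> H" by blast
  then show ?case using 0 incr_seq[OF H] by (intro exI[of _ "seq H h"] exI[of _ 0]) simp
next
  case (Suc k)
  have fld: "x \<in> Field \<mu>" if "x \<in> H" for x using H that unfolding large_def by blast
  have max: "finite B \<Longrightarrow> B \<noteq> {} \<Longrightarrow> B \<subseteq> H \<Longrightarrow> \<exists>m \<in> B. \<forall>x \<in> B. x = m \<or> x \<sqsubset> m" for B
  proof (induction B rule: finite_ne_induct)
    case (insert x B)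
    then obtain m where m: "m \<in> B" "\<And>y. y \<in> B \<Longrightarrow> y = m \<or> y \<sqsubset> m" by auto
    have "x \<noteq> m" using insert m(1) by blast
    then consider "x \<sqsubset> m" | "m \<sqsubset> x" using below_total[of x m] fld insert.prems m(1) by blast
    then show ?case
    proof cases
      case 1
      then show ?thesis using m by (intro bexI[of _ m]) blast+
    next
      case 2
      then have "y = x \<or> y \<sqsubset> x" if "y \<in> insert x B" for y
        using that m(2)[of y] below_trans[of y m x] by blast
      then show ?thesis by blast
    qed
  qed simp
  have "A \<noteq> {}" using Suc.hyps(2) by auto
  then obtain m where m: "m \<in> A" "\<And>x. x \<in> A \<Longrightarrow> x = m \<or> x \<sqsubset> m"
    using max[OF Suc.prems(1) _ Suc.prems(2)] by blast
  have mH: "m \<in> H" using m(1) Suc.prems by blast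
  have "k = card (A - {m})" using Suc.hyps(2) m(1) Suc.prems(1) by simp
  then obtain a n where a: "incr H a" "A - {m} = a ` {..<n}"
    using Suc.hyps(1)[of "A - {m}"] Suc.prems by auto
  show ?case
  proof (cases n)
    case 0
    then have "A = {m}" using a(2) m(1) by auto
    then show ?thesis using incr_seq[OF H mH]
      by (intro exI[of _ "seq H m"] exI[of _ 1]) (auto simp: seq_simps lessThan_Suc)
  next
    case (Suc j)
    then have "a j \<in> A - {m}" using a(2) by auto
    then have "a j \<sqsubset> seq H m 0" using m(2)[of "a j"] by (simp add: seq_simps)
    then have "incr H (splice j a (seq H m))" using incr_splice[OF a(1) incr_seq[OF H mH]] by blast
    moreover have "A = splice j a (seq H m) ` {..<Suc n}"
    proof -
      have "splice j a (seq H m) ` {..<n} = a ` {..<n}"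
        using Suc by (intro image_cong) (simp_all add: splice_def)
      moreover have "splice j a (seq H m) n = m" using Suc by (simp add: splice_def seq_simps)
      ultimately have "splice j a (seq H m) ` {..<Suc n} = insert m (A - {m})"
        unfolding lessThan_Suc image_insert a(2) by simp
      then show ?thesis using m(1) by (simp only: insert_Diff)
    qed
    ultimately show ?thesis by blast
  qed
qed

text \<open>The fixed value beyond \<open>n\<close> turns a function of sequences into one of
  \<open>n\<close>-tuples.\<close>

definition cut_at :: "nat \<Rightarrow> (nat \<Rightarrow> 'r) \<Rightarrow> nat \<Rightarrow> 'r"
  where "cut_at n a = (\<lambda>i. if i < n then a i else undefined)"

text \<open>Two colours suffice for a function with many values: the colour of \<open>2 * n\<close>
  increasing points is whether \<open>f\<close> agrees on their two halves.\<close>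

definition homogeneous_for :: "((nat \<Rightarrow> 'r) \<Rightarrow> 'r) \<Rightarrow> nat \<Rightarrow> 'r set \<Rightarrow> bool"
  where "homogeneous_for f n H \<longleftrightarrow> (\<exists>v. \<forall>a. incr H a \<longrightarrow> (f (cut_at n a) = f (cut_at n (\<lambda>i. a (i + n)))) = v)"

text \<open>Successive blocks cannot always disagree, since \<open>f\<close> has too few values. So
  they always agree, and any two tuples can be compared with a third one beyond both.\<close>

lemma homogeneous_for_constant:
  assumes H: "large H" and hom: "homogeneous_for f n H"
    and f: "\<And>a. f a \<in> V" and V: "|V| <o \<mu>" "infinite V"
    and ab: "incr H a" "incr H b"
  shows "f (cut_at n a) = f (cut_at n b)"
proof (cases n)
  case 0
  then show ?thesis by (simp add: cut_at_def)
next
  case (Suc k)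
  obtain v where v: "\<And>a. incr H a \<Longrightarrow> (f (cut_at n a) = f (cut_at n (\<lambda>i. a (i + n)))) = v"
    using hom unfolding homogeneous_for_def by blast
  have cut_splice: "cut_at n (splice k a b) = cut_at n a" "(\<lambda>i. splice k a b (i + n)) = b" for a b
    using Suc by (auto simp: cut_at_def splice_def)
  have fld: "x \<in> Field \<mu>" if "x \<in> H" for x using H that unfolding large_def by blast
  have vs: "(f (cut_at n a) = f (cut_at n b)) = v" if "incr H a" "incr H b" "a k \<sqsubset> b 0" for a b
    using v[OF incr_splice[OF that]] by (simp only: cut_splice)
  have v
  proof (rule ccontr)
    assume "\<not> v"
    \<comment> \<open>Otherwise \<open>H\<close> would be a union of \<open>|V|\<close> finite
      sets.\<close>
    have "\<exists>w \<in> V. infinite {h \<in> H. f (cut_at n (seq H h)) = w}"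
    proof (rule ccontr)
      assume "\<not> ?thesis"
      then have "|{h \<in> H. f (cut_at n (seq H h)) = w}| <o natLeq" if "w \<in> V" for w
        using that finite_iff_ordLess_natLeq by blast
      moreover have "natLeq \<le>o |V|" using V(2) infinite_iff_natLeq_ordLeq by blast
      ultimately have "\<forall>w \<in> V. |{h \<in> H. f (cut_at n (seq H h)) = w}| \<le>o |V|"
        using ordLess_imp_ordLeq[OF ordLess_ordLeq_trans] by blast
      then have "|\<Union>w \<in> V. {h \<in> H. f (cut_at n (seq H h)) = w}| \<le>o |V|"
        by (rule card_of_UNION_ordLeq_infinite[OF V(2) ordLeq_reflexive[OF card_of_Well_order]])
      moreover have "(\<Union>w \<in> V. {h \<in> H. f (cut_at n (seq H h)) = w}) = H" using f by auto
      ultimately have "|H| \<le>o |V|" by (simp only:)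
      then show False using large_not_ordLess[OF H] ordLeq_ordLess_trans[OF _ V(1)] by blast
    qed
    then obtain w where inf: "infinite {h \<in> H. f (cut_at n (seq H h)) = w}" by blast
    then obtain h1 where h1: "h1 \<in> {h \<in> H. f (cut_at n (seq H h)) = w}"
      using infinite_imp_nonempty by blast
    obtain h where h: "h \<in> {h \<in> H. f (cut_at n (seq H h)) = w}"
        "\<And>y. (y, h) \<in> \<mu> - Id \<Longrightarrow> y \<notin> {h \<in> H. f (cut_at n (seq H h)) = w}"
      by (rule wfE_min[OF wf_below h1]) (rule that)
    \<comment> \<open>As \<open>h\<close> is minimal, another starting point with the same value
      outside the first block of \<open>h\<close> lies beyond that block.\<close>
    have "infinite ({h \<in> H. f (cut_at n (seq H h)) = w} - seq H h ` {..k})"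
      using inf by (intro Diff_infinite_finite) simp_all
    then obtain h' where h': "h' \<in> {h \<in> H. f (cut_at n (seq H h)) = w}" "h' \<notin> seq H h ` {..k}"
      using infinite_imp_nonempty by blast
    have hH: "h \<in> H" "h' \<in> H" using h(1) h'(1) by blast+
    have "i \<le> k \<Longrightarrow> seq H h i \<sqsubset> h'" for i
    proof (induction i)
      case 0
      have "h' \<noteq> h" using h'(2) seq_simps(1)[of H h] by (metis atMost_iff image_eqI le0)
      moreover have "\<not> h' \<sqsubset> h" using h(2) h'(1) by blast
      ultimately show ?case using below_total[of h h'] fld hH by (simp only: seq_simps) blast
    next
      case (Suc i)
      then have "h' \<noteq> seq H h (Suc i)" using h'(2) by blast
      then show ?case using nxt(3)[OF H seq_mem[OF H hH(1)] hH(2), of i] Suc by (simp only: seq_simps) auto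
    qed
    then have "seq H h k \<sqsubset> seq H h' 0" by (simp only: seq_simps(1))
    from vs[OF incr_seq[OF H hH(1)] incr_seq[OF H hH(2)] this] show False
      using h(1) h'(1) \<open>\<not> v\<close> by simp
  qed
  have "\<exists>z \<in> H. x \<sqsubset> z \<and> y \<sqsubset> z" if "x \<in> H" "y \<in> H" for x y
  proof (cases "x \<sqsubset> y")
    case True
    then show ?thesis using nxt(1,2)[OF H that(2)] below_trans by blast
  next
    case False
    then have "x = y \<or> y \<sqsubset> x" using below_total[of x y] that fld by blast
    then show ?thesis using nxt(1,2)[OF H that(1)] below_trans[of y x "nxt H x"] by blast
  qed
  then obtain z where z: "z \<in> H" "a k \<sqsubset> z" "b k \<sqsubset> z" using ab unfolding incr_def by metis
  have "f (cut_at n a) = f (cut_at n (seq H z))" "f (cut_at n b) = f (cut_at n (seq H z))"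
    using vs[OF ab(1) incr_seq[OF H z(1)]] vs[OF ab(2) incr_seq[OF H z(1)]] z \<open>v\<close> by (simp_all add: seq_simps)
  then show ?thesis by simp
qed

text \<open>The colour of a set codes the function it is meant for, and its arity, by its size.\<close>

lemma ex_homogeneous_for_all:
  fixes f :: "nat \<Rightarrow> (nat \<Rightarrow> 'r) \<Rightarrow> 'r"
  shows "\<exists>H. large H \<and> (\<forall>k n. homogeneous_for (f k) n H)"
proof -
  \<comment> \<open>Size \<open>prod_encode (k, 2 * n)\<close> stands for function \<open>k\<close>
    and arity \<open>n\<close>; it is at least \<open>2 * n\<close>, so both halves can be read
    off.\<close>
  define c where "c B = (let k = fst (prod_decode (card B)); n = snd (prod_decode (card B)) div 2 in
      f k (cut_at n (nth_of B)) = f k (cut_at n (\<lambda>i. nth_of B (i + n))))" for B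
  obtain H where H: "large H" and hom: "\<forall>m. \<forall>a \<in> [H]\<^bsup>m\<^esup>. \<forall>b \<in> [H]\<^bsup>m\<^esup>. c a = c b"
    using homogeneous[of c] by (elim exE conjE)
  have "homogeneous_for (f k) n H" for k n
  proof -
    define m where "m = prod_encode (k, 2 * n)"
    have m: "2 * n \<le> m" unfolding m_def by (rule le_prod_encode_2)
    have c: "c (a ` {..<m}) = (f k (cut_at n a) = f k (cut_at n (\<lambda>i. a (i + n))))" if a: "incr H a" for a
    proof -
      have "card (a ` {..<m}) = m" using incr_inj[OF a] by (simp add: card_image inj_on_subset)
      moreover have "cut_at n (nth_of (a ` {..<m})) = cut_at n a"
        using nth_of_incr[OF a, of _ m] m by (auto simp: cut_at_def)
      moreover have "cut_at n (\<lambda>i. nth_of (a ` {..<m}) (i + n)) = cut_at n (\<lambda>i. a (i + n))"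
        using nth_of_incr[OF a, of _ m] m by (auto simp: cut_at_def)
      ultimately show ?thesis by (simp add: c_def m_def)
    qed
    have "(f k (cut_at n a) = f k (cut_at n (\<lambda>i. a (i + n)))) = (f k (cut_at n b) = f k (cut_at n (\<lambda>i. b (i + n))))"
      if "incr H a" "incr H b" for a b
      using bspec[OF bspec[OF spec[OF hom] incr_nsets[OF that(1)]] incr_nsets[OF that(2)], of m] c that by simp
    then show ?thesis unfolding homogeneous_for_def by metis
  qed
  then show ?thesis using H by blast
qed

definition closed_under :: "(nat \<Rightarrow> 'r list \<Rightarrow> 'r) \<Rightarrow> 'r set \<Rightarrow> bool"
  where "closed_under F x \<longleftrightarrow> (\<forall>n ys. set ys \<subseteq> x \<longrightarrow> F n ys \<in> Field \<mu> \<longrightarrow> F n ys \<in> x)"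

text \<open>The hull of a homogeneous set meets \<open>V\<close> in a countable set: each element is
  the value of a term at an increasing tuple, and this value does not depend on the tuple.\<close>

lemma ex_large_closed_omitting:
  assumes V: "|V| <o \<mu>" "uncountable V"
  shows "\<exists>x. large x \<and> closed_under F x \<and> \<not> V \<subseteq> x"
proof -
  obtain w where w: "w \<in> V" using V(2) by (metis countable_empty ex_in_conv)
  \<comment> \<open>The default \<open>w\<close> keeps all values in \<open>V\<close>, whose size is
    what \<open>homogeneous_for_constant\<close> needs.\<close>
  define f where "f k e = (let y = eval_term F e (from_nat k) in if y \<in> V then y else w)" for k e
  obtain H where H: "large H" and hom: "\<And>k n. homogeneous_for (f k) n H"
    using ex_homogeneous_for_all[of f] by blast
  have "H \<noteq> {}" using finite_ordLess[of "{}"] large_not_ordLess[OF H] by auto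
  then obtain h where h: "h \<in> H" by blast
  let ?x = "generated F H"
  have HF: "H \<subseteq> Field \<mu>" using H by (simp add: large_def)
  have x: "?x \<subseteq> Field \<mu>" using generated_subset_Field[OF HF] .
  have "H \<subseteq> ?x" using generated.base by blast
  then have "|H| \<le>o |?x|" by (rule card_of_mono1)
  then have "\<mu> \<le>o |?x|" using H ordIso_symmetric ordIso_ordLeq_trans unfolding large_def by blast
  moreover have "|?x| \<le>o \<mu>"
    using card_of_mono1[OF x] card_of_Field_ordIso[OF Card_order] ordLeq_ordIso_trans by blast
  ultimately have "large ?x" using x ordIso_iff_ordLeq unfolding large_def by blast
  moreover have "closed_under F ?x" 
    unfolding closed_under_def
  proof (intro allI impI)
    fix n ys assume ys: "set ys \<subseteq> ?x" "F n ys \<in> Field \<mu>"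
    show "F n ys \<in> ?x" by (rule generated.step[OF subsetD[OF ys(1)] ys(2)])
  qed
  moreover have "?x \<inter> V \<subseteq> (\<lambda>(k, n). f k (cut_at n (seq H h))) ` UNIV"
  proof
    fix y assume y: "y \<in> ?x \<inter> V"
    then obtain B where B: "finite B" "B \<subseteq> H" "y \<in> generated F B"
      using generated_finite_support[of y F H] by auto
    obtain a n where a: "incr H a" "B = a ` {..<n}" using ex_incr_enumeration[OF H B(1,2)] by blast
    have "a ` {..<n} = cut_at n a ` {..<n}" by (auto simp: cut_at_def)
    then obtain t where t: "eval_term F (cut_at n a) t = y" using generated_eval_term B(3) a(2) by metis
    have "f (to_nat t) (cut_at n a) = y" using t y by (simp add: f_def)
    moreover have "f (to_nat t) (cut_at n a) = f (to_nat t) (cut_at n (seq H h))"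
    proof (rule homogeneous_for_constant[OF H hom _ V(1) _ a(1) incr_seq[OF H h]])
      show "f (to_nat t) e \<in> V" for e using w by (simp add: f_def Let_def)
      show "infinite V" using V(2) countable_finite by blast
    qed
    ultimately show "y \<in> (\<lambda>(k, n). f k (cut_at n (seq H h))) ` UNIV"
      by (intro image_eqI[of _ _ "(to_nat t, n)"]) simp_all
  qed
  then have "countable (?x \<inter> V)" by (rule countable_subset) simp
  then have "\<not> V \<subseteq> ?x" using V(2) by (metis inf.absorb_iff2)
  ultimately show ?thesis by blast
qed

end


subsection \<open>Stationary families of large sets\<close>

context ramsey_cardinal
begin

text \<open>Non-stationarity: the sets closed under countably many finitary operations play the role
  of a club.\<close>

definition thin :: "'r set set \<Rightarrow> bool"
  where "thin S \<longleftrightarrow> (\<exists>F. \<forall>x \<in> S. \<not> closed_under F x)"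

lemma thin_subset: "thin S \<Longrightarrow> T \<subseteq> S \<Longrightarrow> thin T"
  unfolding thin_def by blast

lemma thin_empty: "thin {}"
  by (simp add: thin_def)

lemma thin_UN:
  fixes S :: "nat \<Rightarrow> 'r set set"
  assumes "\<And>n. thin (S n)"
  shows "thin (\<Union>n. S n)"
proof -
  have "\<forall>n. \<exists>F. \<forall>x \<in> S n. \<not> closed_under F x" using assms by (simp add: thin_def)
  from choice[OF this] obtain F where F: "\<And>n x. x \<in> S n \<Longrightarrow> \<not> closed_under (F n) x" by blast
  define G where "G m = F (fst (prod_decode m)) (snd (prod_decode m))" for m
  have "closed_under (F n) x" if G: "closed_under G x" for n x
    unfolding closed_under_def
  proof (intro allI impI)
    fix k ys assume "set ys \<subseteq> x" "F n k ys \<in> Field \<mu>"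
    moreover have "G (prod_encode (n, k)) = F n k" by (simp add: G_def)
    ultimately show "F n k ys \<in> x" using G unfolding closed_under_def by metis
  qed
  then show ?thesis using F unfolding thin_def by blast
qed

lemma thin_Un:
  assumes "thin S" "thin T"
  shows "thin (S \<union> T)"
proof -
  have "thin (\<Union>n :: nat. if n = 0 then S else T)" using assms by (intro thin_UN) simp
  then show ?thesis by (rule thin_subset) (auto split: if_splits)
qed

text \<open>Fodor's argument: if all fibres were thin, let the first argument of \<open>G\<close>
  select the operations that witness it. A set \<open>x\<close> closed under \<open>G\<close> would
  then be closed under those for \<open>g x\<close>, as \<open>g x\<close> belongs to
  \<open>x\<close>.\<close>

lemma pressing_down:
  assumes S: "\<not> thin S" and g: "\<And>x. x \<in> S \<Longrightarrow> g x \<in> x"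
  shows "\<exists>\<gamma>. \<not> thin {x \<in> S. g x = \<gamma>}"
proof (rule ccontr)
  assume "\<not> ?thesis"
  then have "\<forall>\<gamma>. \<exists>F. \<forall>x \<in> {x \<in> S. g x = \<gamma>}. \<not> closed_under F x"
    unfolding thin_def by blast
  from choice[OF this] obtain F where "\<forall>\<gamma>. \<forall>x \<in> {x \<in> S. g x = \<gamma>}. \<not> closed_under (F \<gamma>) x" by (rule exE)
  then have F: "\<not> closed_under (F (g x)) x" if "x \<in> S" for x using that by simp
  define G where "G n ys = F (hd ys) n (tl ys)" for n ys
  have "\<not> closed_under G x" if x: "x \<in> S" for x
  proof
    assume G: "closed_under G x"
    have "closed_under (F (g x)) x"
      unfolding closed_under_def
    proof (intro allI impI)
      fix n ys assume ys: "set ys \<subseteq> x" "F (g x) n ys \<in> Field \<mu>"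
      have "set (g x # ys) \<subseteq> x" using g[OF x] ys(1) by simp
      moreover have "G n (g x # ys) = F (g x) n ys" by (simp add: G_def)
      ultimately show "F (g x) n ys \<in> x" using G ys(2) unfolding closed_under_def by metis
    qed
    then show False using F[OF x] by blast
  qed
  then show False using S unfolding thin_def by blast
qed

text \<open>A set of size \<mu> has order type at least \<mu>.\<close>

lemma ex_increasing_into_large:
  assumes \<kappa>: "\<kappa> \<le>o \<mu>" and x: "large x"
  shows "\<exists>g. \<forall>a \<in> Field \<kappa>. g a \<in> x \<and> (\<forall>b. (b, a) \<in> \<kappa> \<and> b \<noteq> a \<longrightarrow> g b \<sqsubset> g a)"
proof -
  have wo\<mu>: "Well_order \<mu>" using wo by (simp add: wo_rel_def)
  have sub: "x \<subseteq> Field \<mu>" using x by (simp add: large_def)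
  have "\<mu> \<le>o |x|" using x ordIso_symmetric ordIso_iff_ordLeq unfolding large_def by blast
  moreover have "|x| \<le>o Restr \<mu> x" by (rule card_of_least[OF well_order_on_Restr[OF wo\<mu> sub]])
  ultimately have "\<kappa> \<le>o Restr \<mu> x" using \<kappa> ordLeq_transitive by blast
  then obtain g where g: "Well_order \<kappa>" "embed \<kappa> (Restr \<mu> x) g" unfolding ordLeq_def by blast
  have inj: "inj_on g (Field \<kappa>)" by (rule embed_inj_on[OF g])
  have mem: "g a \<in> x" if "a \<in> Field \<kappa>" for a
    using embed_Field[OF g(2)] Field_Restr_subset[of \<mu> x] that by blast
  have less: "g b \<sqsubset> g a" if ba: "(b, a) \<in> \<kappa>" "b \<noteq> a" for a b
  proof -
    have "(g b, g a) \<in> \<mu>" using embed_compat[OF g(2)] ba(1) unfolding compat_def by blast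
    moreover have "g b \<noteq> g a" using inj_on_eq_iff[OF inj FieldI1[OF ba(1)] FieldI2[OF ba(1)]] ba(2) by simp
    ultimately show ?thesis by simp
  qed
  show ?thesis
  proof (intro exI[of _ g] ballI conjI allI impI)
    show "g a \<in> x" if "a \<in> Field \<kappa>" for a by (rule mem[OF that])
    show "g b \<sqsubset> g a" if "(b, a) \<in> \<kappa> \<and> b \<noteq> a" for a b using that less by simp
  qed
qed

text \<open>\<open>strong_limit\<close> puts the continuum, which is at least \<open>omega1\<close>,
  below \<mu>, and then two further power sets.\<close>

lemma card_of_Pow_Pow_omega1_less: "|Field omega1| <o \<mu>" "|Pow (Pow (Field omega1))| <o \<mu>"
proof -
  have "|UNIV :: nat set| <o \<mu>" using card_of_nat natLeq_less ordIso_ordLess_trans by blast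
  then have "|Pow (UNIV :: nat set)| <o \<mu>" by (rule strong_limit)
  moreover have "omega1 \<le>o |Pow (UNIV :: nat set)|"
  proof -
    have "natLeq <o |Pow (UNIV :: nat set)|"
      using card_of_nat card_of_Pow ordIso_symmetric ordIso_ordLess_trans by blast
    then show ?thesis
      unfolding omega1_def by (rule cardSuc_least[OF natLeq_Card_order card_of_Card_order])
  qed
  ultimately have "omega1 <o \<mu>" using ordLeq_ordLess_trans by blast
  then show "|Field omega1| <o \<mu>"
    using card_of_Field_ordIso[OF Card_order_omega1] ordIso_ordLess_trans by blast
  then show "|Pow (Pow (Field omega1))| <o \<mu>" by (intro strong_limit)
qed

lemma beth2_omega1_plus_le: "beth2_omega1_plus \<le>o \<mu>"
proof -
  have "ctwo ^c (ctwo ^c omega1) <o \<mu>"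
    using card_of_Pow_Pow_omega1 card_of_Pow_Pow_omega1_less(2) ordIso_symmetric ordIso_ordLess_trans by blast
  then show ?thesis
    unfolding beth2_omega1_plus_def by (rule cardSuc_least[OF Card_order_ctwo_cexp Card_order])
qed

text \<open>Restricting a stationary family by the value of \<pi> gives \<open>J_extend\<close>, and
  pressing down excludes descent.\<close>

theorem ex_ideal_system:
  "\<exists>(P :: 'r set set rel) J. ideal_system P J (Field omega1) beth2_omega1_plus"
proof -
  let ?W = "Field omega1" and ?\<kappa> = beth2_omega1_plus
  have "|?W| \<le>o |Field \<mu>|"
    using card_of_Pow_Pow_omega1_less(1) ordLess_imp_ordLeq card_of_Field_ordIso[OF Card_order]
      ordIso_symmetric ordLeq_ordIso_trans by blast
  then obtain \<iota> where \<iota>: "inj_on \<iota> ?W" "\<iota> ` ?W \<subseteq> Field \<mu>" using card_of_ordLeq[of ?W "Field \<mu>"] by auto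
  have V: "|\<iota> ` ?W| <o \<mu>" "uncountable (\<iota> ` ?W)"
    using card_of_image[of \<iota> ?W] card_of_Pow_Pow_omega1_less(1) ordLeq_ordLess_trans
      countable_image_inj_on[OF _ \<iota>(1)] uncountable_Field_omega1 by blast+
  define Z where "Z = {x. large x \<and> \<not> \<iota> ` ?W \<subseteq> x}"
  have Z: "\<not> thin Z" using ex_large_closed_omitting[OF V] unfolding thin_def Z_def by blast
  define \<pi> where "\<pi> x = (SOME \<alpha>. \<alpha> \<in> ?W \<and> \<iota> \<alpha> \<notin> x)" for x
  have \<pi>: "\<pi> x \<in> ?W" "\<iota> (\<pi> x) \<notin> x" if "x \<in> Z" for x
  proof -
    have "\<exists>\<alpha>. \<alpha> \<in> ?W \<and> \<iota> \<alpha> \<notin> x" using that unfolding Z_def by blast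
    from someI_ex[OF this] show "\<pi> x \<in> ?W" "\<iota> (\<pi> x) \<notin> x" unfolding \<pi>_def by blast+
  qed
  have "\<forall>x \<in> Z. \<exists>g. \<forall>a \<in> Field ?\<kappa>. g a \<in> x \<and> (\<forall>b. (b, a) \<in> ?\<kappa> \<and> b \<noteq> a \<longrightarrow> g b \<sqsubset> g a)"
    using ex_increasing_into_large[OF beth2_omega1_plus_le] unfolding Z_def by blast
  \<comment> \<open>\<open>e x\<close> is an increasing copy of \<open>beth2_omega1_plus\<close>
    inside \<open>x\<close>.\<close>
  from bchoice[OF this] obtain e where
    e: "\<forall>x \<in> Z. \<forall>a \<in> Field ?\<kappa>. e x a \<in> x \<and> (\<forall>b. (b, a) \<in> ?\<kappa> \<and> b \<noteq> a \<longrightarrow> e x b \<sqsubset> e x a)" by blast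
  define P where "P = {(S, S'). S \<subseteq> S' \<and> S' \<subseteq> Z \<and> \<not> thin S}"
  define J where "J S = {A. A \<subseteq> ?W \<and> thin {x \<in> S. \<pi> x \<in> A}}" for S
  have P_iff: "(S, S') \<in> P \<longleftrightarrow> S \<subseteq> S' \<and> S' \<subseteq> Z \<and> \<not> thin S" for S S' by (simp add: P_def)
  have Field: "S \<in> Field P \<longleftrightarrow> S \<subseteq> Z \<and> \<not> thin S" for S
  proof
    assume "S \<in> Field P"
    then obtain T where "(S, T) \<in> P \<or> (T, S) \<in> P" by (auto simp: Field_def)
    then show "S \<subseteq> Z \<and> \<not> thin S" using thin_subset unfolding P_iff by blast
  next
    assume "S \<subseteq> Z \<and> \<not> thin S"
    then have "(S, S) \<in> P" by (simp add: P_iff)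
    then show "S \<in> Field P" by (rule FieldI1)
  qed
  have "ideal_system P J ?W ?\<kappa>"
  proof unfold_locales
    show "Preorder P"
      unfolding preorder_on_def
    proof (intro conjI)
      show "P \<subseteq> Field P \<times> Field P" by (auto simp: Field_def)
      show "refl_on (Field P) P" by (rule refl_onI) (simp add: Field P_iff)
      show "trans P" by (rule transI) (use thin_subset in \<open>unfold P_iff, blast\<close>)
    qed
    show "Field P \<noteq> {}" using Field[of Z] Z by blast
    show "A \<subseteq> ?W" if "A \<in> J S" for A S using that by (simp add: J_def)
    show "B \<in> J S" if "A \<in> J S" "B \<subseteq> A" for A B S
    proof -
      have "thin {x \<in> S. \<pi> x \<in> B}"
        by (rule thin_subset[of "{x \<in> S. \<pi> x \<in> A}"]) (use that in \<open>auto simp: J_def\<close>)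
      then show ?thesis using that unfolding J_def by blast
    qed
    show "(\<Union>n. F n) \<in> J S" if "\<And>n :: nat. F n \<in> J S" for F S
    proof -
      have "thin (\<Union>n. {x \<in> S. \<pi> x \<in> F n})" using that by (intro thin_UN) (simp add: J_def)
      then have "thin {x \<in> S. \<pi> x \<in> (\<Union>n. F n)}" by (rule thin_subset) blast
      then show ?thesis using that unfolding J_def by blast
    qed
    show "?W \<notin> J S" if "S \<in> Field P" for S
    proof -
      have "{x \<in> S. \<pi> x \<in> ?W} = S" using that \<pi>(1) unfolding Field by blast
      then show ?thesis using that unfolding Field J_def by simp
    qed
    show "{\<alpha>} \<in> J S" if "S \<in> Field P" "\<alpha> \<in> ?W" for S \<alpha>
    proof -
      \<comment> \<open>A set closed under the constant operation with value
        \<open>\<iota> \<alpha>\<close> contains this value, while \<open>\<pi> x = \<alpha>\<close>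
        says that it is omitted.\<close>
      have "\<not> closed_under (\<lambda>_ _. \<iota> \<alpha>) x" if x: "x \<in> {x \<in> S. \<pi> x \<in> {\<alpha>}}" for x
      proof
        assume "closed_under (\<lambda>_ _. \<iota> \<alpha>) x"
        moreover have "\<iota> \<alpha> \<in> Field \<mu>" using \<iota>(2) \<open>\<alpha> \<in> ?W\<close> by blast
        ultimately have "\<iota> \<alpha> \<in> x" unfolding closed_under_def by (metis empty_set empty_subsetI)
        moreover have "x \<in> Z" "\<pi> x = \<alpha>" using x \<open>S \<in> Field P\<close> unfolding Field by blast+
        ultimately show False using \<pi>(2)[of x] by simp
      qed
      then have "thin {x \<in> S. \<pi> x \<in> {\<alpha>}}" unfolding thin_def by blast
      then show ?thesis using that(2) by (simp add: J_def)
    qed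
    show "J S \<subseteq> J T" if "(T, S) \<in> P" for S T
    proof
      fix A assume A: "A \<in> J S"
      have "thin {x \<in> T. \<pi> x \<in> A}"
        by (rule thin_subset[of "{x \<in> S. \<pi> x \<in> A}"]) (use A that in \<open>auto simp: J_def P_iff\<close>)
      then show "A \<in> J T" using A unfolding J_def by blast
    qed
    show "\<exists>T. (T, S) \<in> P \<and> ?W - A \<in> J T" if "S \<in> Field P" "A \<subseteq> ?W" "A \<notin> J S" for S A
    proof (intro exI conjI)
      show "({x \<in> S. \<pi> x \<in> A}, S) \<in> P" using that unfolding P_iff Field J_def by blast
      have "thin {x \<in> {x \<in> S. \<pi> x \<in> A}. \<pi> x \<in> ?W - A}" by (rule thin_subset[OF thin_empty]) blast
      then show "?W - A \<in> J {x \<in> S. \<pi> x \<in> A}" unfolding J_def by blast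
    qed
    show "Card_order ?\<kappa>" "regularCard ?\<kappa>" "infinite (Field ?\<kappa>)" "|Pow (Pow ?W)| <o ?\<kappa>"
      by (rule beth2_omega1_plus)+
    fix E :: "((nat set \<Rightarrow> ((nat set \<Rightarrow> bool) \<Rightarrow> bool) set) \<times> 'r set set) set"
    assume ne: "E \<noteq> {}" and sub: "E \<subseteq> (?W \<rightarrow> Field ?\<kappa>) \<times> Field P"
    let ?bad = "\<lambda>f f'. {\<alpha> \<in> ?W. \<not> ((f' \<alpha>, f \<alpha>) \<in> ?\<kappa> \<and> f' \<alpha> \<noteq> f \<alpha>)}"
    show "\<exists>f p q. (f, p) \<in> E \<and> (q, p) \<in> P \<and> (\<forall>f' q'. (f', q') \<in> E \<longrightarrow> (q', q) \<in> P \<longrightarrow> ?bad f f' \<notin> J q')"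
    proof (rule ccontr)
      assume "\<not> ?thesis"
      then have descend: "\<exists>f' q'. (f', q') \<in> E \<and> (q', q) \<in> P \<and> ?bad f f' \<in> J q'"
        if "(f, p) \<in> E" "(q, p) \<in> P" for f p q
        using that by meson
      \<comment> \<open>\<open>f (\<pi> x)\<close> is below the order type of \<open>x\<close>, so the corresponding element of \<open>x\<close> can be pressed down.\<close>
      define v where "v f x = e x (f (\<pi> x))" for f x
      have E: "f \<in> ?W \<rightarrow> Field ?\<kappa>" "p \<subseteq> Z" "\<not> thin p" if "(f, p) \<in> E" for f p
        using that sub Field[of p] by blast+
      have v: "v f x \<in> x" if "f \<in> ?W \<rightarrow> Field ?\<kappa>" "x \<in> Z" for f x
        using e \<pi>(1)[OF that(2)] that unfolding v_def by blast
      have press: "\<exists>\<gamma> q. (q, p) \<in> P \<and> q \<subseteq> T \<and> (\<forall>x \<in> q. v f x = \<gamma>)"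
        if fp: "(f, p) \<in> E" and T: "T \<subseteq> p" "\<not> thin T" for f p T
      proof -
        have "\<exists>\<gamma>. \<not> thin {x \<in> T. v f x = \<gamma>}"
          using v[OF E(1)[OF fp]] E(2)[OF fp] T by (intro pressing_down[OF T(2)]) blast
        then obtain \<gamma> where \<gamma>: "\<not> thin {x \<in> T. v f x = \<gamma>}" by blast
        have "({x \<in> T. v f x = \<gamma>}, p) \<in> P" using \<gamma> T(1) E(2)[OF fp] unfolding P_iff by blast
        then show ?thesis by blast
      qed
      \<comment> \<open>The values to which functions of \<open>E\<close> can be pressed; the
        well-order \<mu> provides a least one.\<close>
      let ?G = "{\<gamma>. \<exists>f p q. (f, p) \<in> E \<and> (q, p) \<in> P \<and> (\<forall>x \<in> q. v f x = \<gamma>)}"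
      obtain f0 p0 where fp0: "(f0, p0) \<in> E" using ne by auto
      obtain \<gamma>0 where \<gamma>0: "\<gamma>0 \<in> ?G" using press[OF fp0 order_refl E(3)[OF fp0]] fp0 by blast
      obtain \<gamma> where \<gamma>: "\<gamma> \<in> ?G" "\<And>\<gamma>'. (\<gamma>', \<gamma>) \<in> \<mu> - Id \<Longrightarrow> \<gamma>' \<notin> ?G"
        by (rule wfE_min[OF wf_below \<gamma>0]) (rule that)
      then obtain f p q where fpq: "(f, p) \<in> E" "(q, p) \<in> P" "\<And>x. x \<in> q \<Longrightarrow> v f x = \<gamma>" by blast
      obtain f' q' where q': "(f', q') \<in> E" "(q', q) \<in> P" "?bad f f' \<in> J q'"
        using descend[OF fpq(1,2)] by blast
      \<comment> \<open>Outside the null part, \<open>f' (\<pi> x)\<close> is strictly below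
        \<open>f (\<pi> x)\<close>, so pressing \<open>v f'\<close> down on \<open>T\<close>
        undercuts the least value.\<close>
      define T where "T = {x \<in> q'. \<pi> x \<notin> ?bad f f'}"
      have T: "\<not> thin T"
      proof
        assume "thin T"
        moreover have "thin {x \<in> q'. \<pi> x \<in> ?bad f f'}" using q'(3) unfolding J_def by blast
        ultimately have "thin (T \<union> {x \<in> q'. \<pi> x \<in> ?bad f f'})" by (rule thin_Un)
        moreover have "T \<union> {x \<in> q'. \<pi> x \<in> ?bad f f'} = q'" unfolding T_def by blast
        ultimately show False using E(3)[OF q'(1)] by simp
      qed
      have "T \<subseteq> q'" by (auto simp: T_def)
      from press[OF q'(1) this T]
      obtain \<gamma>' r where r: "(r, q') \<in> P" "r \<subseteq> T" "\<forall>x \<in> r. v f' x = \<gamma>'"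
        by (elim exE conjE)
      have "r \<noteq> {}" using r(1) thin_empty unfolding P_iff by blast
      then obtain x where x: "x \<in> r" by blast
      then have xT: "x \<in> q'" "\<pi> x \<notin> ?bad f f'" using r(2) unfolding T_def by blast+
      have xZ: "x \<in> Z" using xT(1) E(2)[OF q'(1)] by blast
      have "x \<in> q" using xT(1) q'(2) unfolding P_iff by blast
      have "(f' (\<pi> x), f (\<pi> x)) \<in> ?\<kappa> \<and> f' (\<pi> x) \<noteq> f (\<pi> x)" using xT(2) \<pi>(1)[OF xZ] by blast
      moreover have "f (\<pi> x) \<in> Field ?\<kappa>" by (rule funcset_mem[OF E(1)[OF fpq(1)] \<pi>(1)[OF xZ]])
      ultimately have "v f' x \<sqsubset> v f x" using bspec[OF bspec[OF e xZ]] unfolding v_def by meson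
      then have "\<gamma>' \<sqsubset> \<gamma>" using bspec[OF r(3) x] fpq(3)[OF \<open>x \<in> q\<close>] by simp
      moreover have "\<gamma>' \<in> ?G" using q'(1) r(1,3) by blast
      ultimately show False using \<gamma>(2) by blast
    qed
  qed
  then show ?thesis by blast
qed

end

theorem mainTheorem1:
  fixes X :: "real set" and l :: nat and c :: "real set \<Rightarrow> nat"
  assumes "(\<exists>\<mu> :: 'r rel. Ramsey_cardinal \<mu>) \<or>
      (\<exists>(P :: 'p rel) one D. nice_to P one D beth2_omega1_plus)"
    and "uncountable X"
    and "c \<in> [X]\<^bsup>2\<^esup> \<rightarrow> {..<l}"
  shows "\<exists>Y \<subseteq> X. Y homeomorphic (\<rat> :: real set) \<and> card (c ` [Y]\<^bsup>2\<^esup>) \<le> 2"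
proof -
  obtain \<xi> where \<xi>: "inj_on \<xi> (Field omega1)" "\<xi> ` Field omega1 \<subseteq> X"
    using uncountable_imp_inj_omega1[OF assms(2)] by blast
  from assms(1) show ?thesis
  proof (elim disjE exE)
    fix \<mu> :: "'r rel"
    assume "Ramsey_cardinal \<mu>"
    then interpret ramsey_cardinal \<mu> by unfold_locales
    obtain P :: "'r set set rel" and J where "ideal_system P J (Field omega1) beth2_omega1_plus"
      using ex_ideal_system by blast
    then show ?thesis by (rule ideal_system.ex_rational_copy_two_colours[OF _ \<xi> assms(3)])
  next
    fix P :: "'p rel" and one D
    assume "nice_to P one D beth2_omega1_plus"
    then show ?thesis
      by (rule ideal_system.ex_rational_copy_two_colours[OF nice_ideal_system \<xi> assms(3)])
  qed
qed

end
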